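(* For any countable ICC group $G$ there exist a probability measure $\mu$ on $G$ (which can be chosen to be symmetric, non-degenerate, and of finite entropy) and a locally finite forest $\mathcal F$ with vertex set $G$ such that: (i) almost all sample paths of the random walk $(G,\mu)$ converge to the boundary $\partial\mathcal F$ of the forest $\mathcal F$; (ii) almost every sample path visits all but a finite number of points of any geodesic ray in $\mathcal F$ ending at the limit point of the path; (iii) the arising quotient map from the Poisson boundary $\partial_\mu G$ to the boundary $\partial\mathcal F$ endowed with the family of the resulting hitting distributions is an isomorphism (mod 0); (iv) the action of the group $G$ on the Poisson boundary $\partial_\mu G$ is free (mod 0), i.e., the stabilizer of almost every point of $\partial_\mu G$ is trivial.
   Context: ICC groups. A group $G$ is an ICC group if $G\neq\{e\}$ and the conjugacy class of every non-identity element is infinite. Random walks. For a probability measure $\mu$ on a countable group $G$, $\operatorname{supp}\mu=\{g:\mu(g)>0\}$. The measure $\mu$ is non-degenerate if $\operatorname{supp}\mu$ generates $G$ as a semigroup, symmetric if $\mu(g)=\mu(g^{-1})$ for all $g$, and of finite entropy if $-\sum_g\mu(g)\log\mu(g)<\infty$. The random walk $(G,\mu)$ is the Markov chain on $G$ with transitions $g\mapsto gh$, $h$ sampled from $\mu$; its sample paths are $\boldsymbol y=(y_0,y_1,\dots)$ with $y_n=y_0x_1\cdots x_n$, where $(x_n)$ are independent and $\mu$-distributed. $\mathbf P_g$ is the measure on the path space $G^{\mathbb Z_+}$ for the starting point $y_0=g$, and $\mathbf P_\#=\sum_{g\in G}\mathbf P_g$. "Almost all sample paths" means $\mathbf P_\#$-almost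 all (i.e., $\mathbf P_g$-almost all for every $g$). Poisson boundary. Let $T$ be the time shift on $G^{\mathbb Z_+}$. The exit $\sigma$-algebra consists of all measurable subsets of $(G^{\mathbb Z_+},\mathbf P_\#)$ that are ($\mathbf P_\#$-mod 0) $T$-invariant, i.e., unions of classes of the equivalence relation $\boldsymbol y\sim\boldsymbol y'\iff T^n\boldsymbol y=T^{n'}\boldsymbol y'$ for some $n,n'\ge0$. The Poisson boundary $\partial_\mu G$ is the corresponding quotient measure space of the path space, with quotient map $\operatorname{bnd}$ and harmonic measures $\nu_g=\operatorname{bnd}\mathbf P_g$. "Almost every" point of $\partial_\mu G$ refers to the common class of the measures $\sum_g\theta(g)\nu_g$, where $\theta$ is a probability measure with full support on $G$. The coordinate-wise left action of $G$ on paths commutes with $T$ and descends to an action on $\partial_\mu G$ preserving this measure class. Forests. A forest is a graph with no cycles (its connected components are trees). The boundary $\partial\mathcal T$ of a tree is the set of geodesic rays modulo the equivalence $(x_i)\sim(x'_i)\iff x_{n+i}=x'_{n'+i}$ for some $n,n'$ and all $i\ge0$; given a root $o$, it is identified with the set of geodesic rays issued from $o$, with the topology of pointwise convergence. The boundary $\partial\mathcal F$ of a forest is the disjoint union of the boundaries of its trees. A sequence of vertices $\tau_n$ converges to $\tau_\infty\in\partial\mathcal F$ if it is eventually contained in a single tree $\mathcal T$ with $\tau_\infty\in\partial\mathcal T$, and the geodesic segments $[o,\tau_n]$ in $\mathcal T$ converge pointwise to the geodesic ray from $o$ representing $\tau_\infty$. No relationship between the graph structure of $\mathcal F$ and the group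 structure of $G$ is assumed. The hitting distribution from $g$ is the distribution of $\lim y_n\in\partial\mathcal F$ under $\mathbf P_g$; since the map $\boldsymbol y\mapsto\lim y_n$ is $T$-invariant, it factors through $\partial_\mu G$, and this is the quotient map in (iii). *)

theory Defs
  imports "HOL-Algebra.Group" "HOL-Probability.Probability"
begin

section \<open>Groups and step distributions\<close>

definition icc_group :: "('a, 'b) monoid_scheme \<Rightarrow> bool" where
  "icc_group G \<longleftrightarrow>
     group G \<and> carrier G \<noteq> {\<one>\<^bsub>G\<^esub>} \<and>
     (\<forall>x \<in> carrier G - {\<one>\<^bsub>G\<^esub>}.
        infinite ((\<lambda>h. h \<otimes>\<^bsub>G\<^esub> x \<otimes>\<^bsub>G\<^esub> inv\<^bsub>G\<^esub> h) ` carrier G))"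

text \<open>A probability measure on \<open>G\<close> is a \<open>pmf\<close> on the ambient type supported in the carrier.\<close>

definition pmf_on_group :: "('a, 'b) monoid_scheme \<Rightarrow> 'a pmf \<Rightarrow> bool" where
  "pmf_on_group G \<mu> \<longleftrightarrow> set_pmf \<mu> \<subseteq> carrier G"

inductive_set semigroup_span :: "('a, 'b) monoid_scheme \<Rightarrow> 'a set \<Rightarrow> 'a set"
  for G (structure) and S where
  base: "s \<in> S \<Longrightarrow> s \<in> semigroup_span G S"
| mult: "x \<in> semigroup_span G S \<Longrightarrow> y \<in> semigroup_span G S \<Longrightarrow> x \<otimes> y \<in> semigroup_span G S"

definition nondegenerate :: "('a, 'b) monoid_scheme \<Rightarrow> 'a pmf \<Rightarrow> bool" where
  "nondegenerate G \<mu> \<longleftrightarrow> semigroup_span G (set_pmf \<mu>) = carrier G"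

definition symmetric_pmf :: "('a, 'b) monoid_scheme \<Rightarrow> 'a pmf \<Rightarrow> bool" where
  "symmetric_pmf G \<mu> \<longleftrightarrow> (\<forall>g \<in> carrier G. pmf \<mu> g = pmf \<mu> (inv\<^bsub>G\<^esub> g))"

definition finite_entropy :: "('a, 'b) monoid_scheme \<Rightarrow> 'a pmf \<Rightarrow> bool" where
  "finite_entropy G \<mu> \<longleftrightarrow> (\<lambda>g. - (pmf \<mu> g * ln (pmf \<mu> g))) summable_on carrier G"


section \<open>The random walk\<close>

definition path_space :: "('a, 'b) monoid_scheme \<Rightarrow> (nat \<Rightarrow> 'a) measure" where
  "path_space G = (\<Pi>\<^sub>M n \<in> (UNIV :: nat set). count_space (carrier G))"

definition increments :: "('a, 'b) monoid_scheme \<Rightarrow> 'a pmf \<Rightarrow> (nat \<Rightarrow> 'a) measure" where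
  "increments G \<mu> = (\<Pi>\<^sub>M n \<in> (UNIV :: nat set). restrict_space (measure_pmf \<mu>) (carrier G))"

text \<open>The increment leading from time \<open>n\<close> to time \<open>n + 1\<close> is \<open>x n\<close>.\<close>

primrec walk :: "('a, 'b) monoid_scheme \<Rightarrow> 'a \<Rightarrow> (nat \<Rightarrow> 'a) \<Rightarrow> nat \<Rightarrow> 'a" where
  "walk G g x 0 = g"
| "walk G g x (Suc n) = walk G g x n \<otimes>\<^bsub>G\<^esub> x n"

definition path_measure :: "('a, 'b) monoid_scheme \<Rightarrow> 'a pmf \<Rightarrow> 'a \<Rightarrow> (nat \<Rightarrow> 'a) measure" where
  "path_measure G \<mu> g = distr (increments G \<mu>) (path_space G) (walk G g)"

definition almost_all_paths ::
    "('a, 'b) monoid_scheme \<Rightarrow> 'a pmf \<Rightarrow> ((nat \<Rightarrow> 'a) \<Rightarrow> bool) \<Rightarrow> bool" where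
  "almost_all_paths G \<mu> Q \<longleftrightarrow> (\<forall>g \<in> carrier G. AE y in path_measure G \<mu> g. Q y)"

definition path_shift :: "(nat \<Rightarrow> 'a) \<Rightarrow> nat \<Rightarrow> 'a" where
  "path_shift y = (\<lambda>n. y (Suc n))"

definition path_translate :: "('a, 'b) monoid_scheme \<Rightarrow> 'a \<Rightarrow> (nat \<Rightarrow> 'a) \<Rightarrow> nat \<Rightarrow> 'a" where
  "path_translate G g y = (\<lambda>n. g \<otimes>\<^bsub>G\<^esub> y n)"


section \<open>The Poisson boundary\<close>

definition exit_sets :: "('a, 'b) monoid_scheme \<Rightarrow> 'a pmf \<Rightarrow> (nat \<Rightarrow> 'a) set set" where
  "exit_sets G \<mu> =
     {A \<in> sets (path_space G). almost_all_paths G \<mu> (\<lambda>y. path_shift y \<in> A \<longleftrightarrow> y \<in> A)}"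

text \<open>
  The quotient of the path space by the exit \<open>\<sigma>\<close>-algebra is taken in the category of Lebesgue
  spaces (Rokhlin): it is a Lebesgue space with a measurable map from the path space such that
  the preimages of its measurable sets are, modulo null sets, exactly the sets of the exit
  \<open>\<sigma>\<close>-algebra; this determines it up to isomorphism (mod 0). The set-theoretic quotient by the
  orbit equivalence relation of the shift would not do, as it is in general not countably
  separated. Every Lebesgue space is isomorphic (mod 0) to the real line with a Borel measure,
  so we let the quotient live on \<open>borel :: real measure\<close>.
\<close>

definition exit_quotient_map ::
    "('a, 'b) monoid_scheme \<Rightarrow> 'a pmf \<Rightarrow> ((nat \<Rightarrow> 'a) \<Rightarrow> real) \<Rightarrow> bool" where
  "exit_quotient_map G \<mu> bnd \<longleftrightarrow>
     bnd \<in> path_space G \<rightarrow>\<^sub>M borel \<and>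
     (\<forall>S \<in> sets borel. bnd -` S \<inter> space (path_space G) \<in> exit_sets G \<mu>) \<and>
     (\<forall>A \<in> exit_sets G \<mu>. \<exists>S \<in> sets borel. almost_all_paths G \<mu> (\<lambda>y. y \<in> A \<longleftrightarrow> bnd y \<in> S))"

definition harmonic_measure ::
    "('a, 'b) monoid_scheme \<Rightarrow> 'a pmf \<Rightarrow> ((nat \<Rightarrow> 'a) \<Rightarrow> real) \<Rightarrow> 'a \<Rightarrow> real measure" where
  "harmonic_measure G \<mu> bnd g = distr (path_measure G \<mu> g) borel bnd"

text \<open>
  Each map \<open>act g\<close> is determined by this condition up to null sets of the harmonic measures,
  and the group laws hold almost everywhere.
\<close>

definition descended_action ::
    "('a, 'b) monoid_scheme \<Rightarrow> 'a pmf \<Rightarrow> ((nat \<Rightarrow> 'a) \<Rightarrow> real) \<Rightarrow> ('a \<Rightarrow> real \<Rightarrow> real) \<Rightarrow> bool" where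
  "descended_action G \<mu> bnd act \<longleftrightarrow>
     (\<forall>g \<in> carrier G. act g \<in> borel \<rightarrow>\<^sub>M borel \<and>
        almost_all_paths G \<mu> (\<lambda>y. act g (bnd y) = bnd (path_translate G g y)))"

definition poisson_boundary ::
    "('a, 'b) monoid_scheme \<Rightarrow> 'a pmf \<Rightarrow> ((nat \<Rightarrow> 'a) \<Rightarrow> real) \<Rightarrow> ('a \<Rightarrow> real \<Rightarrow> real) \<Rightarrow> bool" where
  "poisson_boundary G \<mu> bnd act \<longleftrightarrow> exit_quotient_map G \<mu> bnd \<and> descended_action G \<mu> bnd act"

definition free_mod_0 ::
    "('a, 'b) monoid_scheme \<Rightarrow> 'a pmf \<Rightarrow> ((nat \<Rightarrow> 'a) \<Rightarrow> real) \<Rightarrow> ('a \<Rightarrow> real \<Rightarrow> real) \<Rightarrow> bool" where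
  "free_mod_0 G \<mu> bnd act \<longleftrightarrow>
     (\<forall>h \<in> carrier G. AE x in harmonic_measure G \<mu> bnd h.
        {g \<in> carrier G. act g x = x} = {\<one>\<^bsub>G\<^esub>})"


section \<open>Forests and their boundaries\<close>

text \<open>Graphs are simple and undirected; the edge set is a symmetric irreflexive relation.\<close>

definition simple_graph :: "'v set \<Rightarrow> ('v \<times> 'v) set \<Rightarrow> bool" where
  "simple_graph V E \<longleftrightarrow> E \<subseteq> V \<times> V \<and> sym E \<and> irrefl E"

definition graph_cycle :: "('v \<times> 'v) set \<Rightarrow> 'v list \<Rightarrow> bool" where
  "graph_cycle E p \<longleftrightarrow>
     3 \<le> length p \<and> distinct p \<and> successively (\<lambda>v w. (v, w) \<in> E) p \<and> (last p, hd p) \<in> E"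

definition forest :: "'v set \<Rightarrow> ('v \<times> 'v) set \<Rightarrow> bool" where
  "forest V E \<longleftrightarrow> simple_graph V E \<and> (\<nexists>p. graph_cycle E p)"

definition locally_finite_graph :: "'v set \<Rightarrow> ('v \<times> 'v) set \<Rightarrow> bool" where
  "locally_finite_graph V E \<longleftrightarrow> (\<forall>v \<in> V. finite {w. (v, w) \<in> E})"

text \<open>Meaningful only for vertices in the same connected component.\<close>

definition graph_dist :: "('v \<times> 'v) set \<Rightarrow> 'v \<Rightarrow> 'v \<Rightarrow> nat" where
  "graph_dist E v w = (LEAST n. (v, w) \<in> E ^^ n)"

definition geodesic_segment :: "('v \<times> 'v) set \<Rightarrow> 'v \<Rightarrow> 'v \<Rightarrow> 'v list \<Rightarrow> bool" where
  "geodesic_segment E v w p \<longleftrightarrow>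
     p \<noteq> [] \<and> hd p = v \<and> last p = w \<and> successively (\<lambda>a b. (a, b) \<in> E) p \<and>
     length p = Suc (graph_dist E v w)"

definition geodesic_rays :: "'v set \<Rightarrow> ('v \<times> 'v) set \<Rightarrow> (nat \<Rightarrow> 'v) set" where
  "geodesic_rays V E =
     {r. (\<forall>i. r i \<in> V \<and> (r i, r (Suc i)) \<in> E) \<and> (\<forall>i j. i \<le> j \<longrightarrow> graph_dist E (r i) (r j) = j - i)}"

definition ray_equiv :: "'v set \<Rightarrow> ('v \<times> 'v) set \<Rightarrow> ((nat \<Rightarrow> 'v) \<times> (nat \<Rightarrow> 'v)) set" where
  "ray_equiv V E =
     {(r, s). r \<in> geodesic_rays V E \<and> s \<in> geodesic_rays V E \<and> (\<exists>n m. \<forall>i. r (n + i) = s (m + i))}"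

text \<open>
  Every ray lies in a single tree, and equivalent rays lie in the same tree, so that the set of
  classes of rays is the disjoint union of the boundaries of the trees.
\<close>

definition forest_boundary :: "'v set \<Rightarrow> ('v \<times> 'v) set \<Rightarrow> (nat \<Rightarrow> 'v) set set" where
  "forest_boundary V E = geodesic_rays V E // ray_equiv V E"

definition rays_from :: "'v set \<Rightarrow> ('v \<times> 'v) set \<Rightarrow> 'v \<Rightarrow> (nat \<Rightarrow> 'v) set" where
  "rays_from V E v = {r \<in> geodesic_rays V E. r 0 = v}"

text \<open>
  For every root \<open>v\<close> the boundary of its tree carries the topology of pointwise convergence of
  the rays issued from \<open>v\<close>, and the boundary of the forest is the topological disjoint union.
\<close>

definition boundary_topology :: "'v set \<Rightarrow> ('v \<times> 'v) set \<Rightarrow> (nat \<Rightarrow> 'v) set topology" where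
  "boundary_topology V E = topology (\<lambda>U. U \<subseteq> forest_boundary V E \<and>
     (\<forall>v \<in> V. openin
        (subtopology (product_topology (\<lambda>_. discrete_topology V) UNIV) (rays_from V E v))
        {r \<in> rays_from V E v. ray_equiv V E `` {r} \<in> U}))"

lemma openin_boundary_topology:
  "openin (boundary_topology V E) U \<longleftrightarrow> U \<subseteq> forest_boundary V E \<and>
     (\<forall>v \<in> V. openin
        (subtopology (product_topology (\<lambda>_. discrete_topology V) UNIV) (rays_from V E v))
        {r \<in> rays_from V E v. ray_equiv V E `` {r} \<in> U})"
proof -
  let ?X = "\<lambda>v. subtopology (product_topology (\<lambda>_. discrete_topology V) UNIV) (rays_from V E v)"
  let ?R = "\<lambda>v U. {r \<in> rays_from V E v. ray_equiv V E `` {r} \<in> U}"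
  have "istopology (\<lambda>U. U \<subseteq> forest_boundary V E \<and> (\<forall>v \<in> V. openin (?X v) (?R v U)))"
    unfolding istopology_def
  proof (intro conjI allI impI ballI)
    fix S T v
    assume S: "S \<subseteq> forest_boundary V E \<and> (\<forall>v \<in> V. openin (?X v) (?R v S))"
      and T: "T \<subseteq> forest_boundary V E \<and> (\<forall>v \<in> V. openin (?X v) (?R v T))"
    show "S \<inter> T \<subseteq> forest_boundary V E"
      using S by blast
    assume "v \<in> V"
    then have "openin (?X v) (?R v S \<inter> ?R v T)"
      using S T by (intro openin_Int) auto
    also have "?R v S \<inter> ?R v T = ?R v (S \<inter> T)"
      by blast
    finally show "openin (?X v) (?R v (S \<inter> T))" .
  next
    fix K v
    assume K: "\<forall>S \<in> K. S \<subseteq> forest_boundary V E \<and> (\<forall>v \<in> V. openin (?X v) (?R v S))"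
    show "\<Union>K \<subseteq> forest_boundary V E"
      using K by blast
    assume "v \<in> V"
    then have "openin (?X v) (\<Union>(?R v ` K))"
      using K by (intro openin_Union) auto
    also have "\<Union>(?R v ` K) = ?R v (\<Union>K)"
      by blast
    finally show "openin (?X v) (?R v (\<Union>K))" .
  qed
  then show ?thesis
    unfolding boundary_topology_def by simp
qed

definition boundary_borel :: "'v set \<Rightarrow> ('v \<times> 'v) set \<Rightarrow> (nat \<Rightarrow> 'v) set measure" where
  "boundary_borel V E = sigma (forest_boundary V E) {U. openin (boundary_topology V E) U}"

text \<open>
  The rays in the class \<open>\<xi>\<close> start at all the possible roots \<open>r 0\<close> of the tree of \<open>\<xi>\<close>.
  The segments converge pointwise if, for every \<open>k\<close>, their \<open>k\<close>-th vertices are eventually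
  defined and equal to the \<open>k\<close>-th vertex of the ray.
\<close>

definition converges_to ::
    "'v set \<Rightarrow> ('v \<times> 'v) set \<Rightarrow> (nat \<Rightarrow> 'v) \<Rightarrow> (nat \<Rightarrow> 'v) set \<Rightarrow> bool" where
  "converges_to V E \<tau> \<xi> \<longleftrightarrow> \<xi> \<in> forest_boundary V E \<and>
     (\<forall>r \<in> \<xi>.
        (\<forall>\<^sub>F n in sequentially. (r 0, \<tau> n) \<in> E\<^sup>*) \<and>
        (\<forall>k. \<forall>\<^sub>F n in sequentially.
           \<exists>p. geodesic_segment E (r 0) (\<tau> n) p \<and> k < length p \<and> p ! k = r k))"


section \<open>Hitting distributions and isomorphisms (mod 0)\<close>

text \<open>
  The distribution of the limit under \<open>path_measure G \<mu> g\<close>; limits are unique, and this is a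
  probability measure when almost all paths converge.
\<close>

definition hitting_distribution ::
    "('a, 'b) monoid_scheme \<Rightarrow> 'a pmf \<Rightarrow> ('a \<times> 'a) set \<Rightarrow> 'a \<Rightarrow> (nat \<Rightarrow> 'a) set measure" where
  "hitting_distribution G \<mu> E g =
     measure_of (forest_boundary (carrier G) E) (sets (boundary_borel (carrier G) E))
       (\<lambda>A. emeasure (path_measure G \<mu> g)
              {y \<in> space (path_space G). \<exists>\<xi> \<in> A. converges_to (carrier G) E y \<xi>})"

definition limit_quotient_map ::
    "('a, 'b) monoid_scheme \<Rightarrow> 'a pmf \<Rightarrow> ('a \<times> 'a) set \<Rightarrow> ((nat \<Rightarrow> 'a) \<Rightarrow> real) \<Rightarrow>
       (real \<Rightarrow> (nat \<Rightarrow> 'a) set) \<Rightarrow> bool" where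
  "limit_quotient_map G \<mu> E bnd \<pi> \<longleftrightarrow>
     \<pi> \<in> borel \<rightarrow>\<^sub>M boundary_borel (carrier G) E \<and>
     almost_all_paths G \<mu> (\<lambda>y. converges_to (carrier G) E y (\<pi> (bnd y)))"

text \<open>
  Isomorphism of two families of measures with a common index set \<open>I\<close>; each family is meant
  to live on a single measurable space. The conull sets \<open>X\<close> and \<open>Y\<close> do not depend on the index.
\<close>

definition isomorphism_mod_0 ::
    "'i set \<Rightarrow> ('i \<Rightarrow> 'x measure) \<Rightarrow> ('i \<Rightarrow> 'y measure) \<Rightarrow> ('x \<Rightarrow> 'y) \<Rightarrow> bool" where
  "isomorphism_mod_0 I M N f \<longleftrightarrow>
     (\<exists>X Y. bij_betw f X Y \<and>
        (\<forall>i \<in> I.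
           X \<in> sets (M i) \<and> space (M i) - X \<in> null_sets (M i) \<and>
           Y \<in> sets (N i) \<and> space (N i) - Y \<in> null_sets (N i) \<and>
           f \<in> restrict_space (M i) X \<rightarrow>\<^sub>M restrict_space (N i) Y \<and>
           inv_into X f \<in> restrict_space (N i) Y \<rightarrow>\<^sub>M restrict_space (M i) X \<and>
           (\<forall>B \<in> sets (N i). emeasure (N i) B = emeasure (M i) (f -` B \<inter> X))))"

end

theory Submission
  imports Defs
begin

text \<open>
  The step distribution is heavy-tailed. Group elements are sorted into levels, a step has level at
  least \<open>n\<close> with probability \<open>1 / (n + 1)\<close>, and almost all of the mass of level \<open>n\<close> sits on one
  element and its inverse, the spikes. A record is a step whose level exceeds all earlier levels.
  Level \<open>n\<close> is the level of a record with probability \<open>1 / (n + 2)\<close>, so the events of probability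
  \<open>1 / (n + 2)\<^sup>2\<close> that can spoil a record (it is not a spike, its level is repeated before it is
  exceeded, it stays in force too long, the next record is far too high) happen only finitely often
  (\<open>AE_tame\<close>). Eventually, then, while a record of level \<open>n\<close> is in force, the position is
  \<open>w \<otimes> a \<otimes> u\<close>, where \<open>w\<close> is the position before the record, \<open>a\<close> is a spike, and \<open>w\<close> and \<open>u\<close> lie in a
  finite set \<open>core n\<close> that was known before the spike was chosen.

  Since conjugacy classes are infinite, the spike can be chosen such that a product \<open>w \<otimes> a \<otimes> u\<close>
  determines \<open>w\<close> and \<open>n\<close> (\<open>super_switching_exists\<close>). Joining every such product to its \<open>w\<close>, provided
  that the level did not jump too high, gives a forest, because a vertex has at most one parent and
  the parent has a lower level; the bound on the jumps makes it locally finite. A path is eventually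
  always at a child of its position before the last record. These positions form a descending ray to
  which the path converges, and the path visits all of them. Everything about the limit is recorded
  in the stem of a path, the set of vertices that are eventually ancestors of its position
  (\<open>converges_to_iff\<close>).

  That the path returns to the ray identifies the Poisson boundary without any appeal to entropy. For
  an exit set \<open>A\<close> the probability of \<open>A\<close> from the current position is eventually large on \<open>A\<close> and
  eventually small off \<open>A\<close> (\<open>exit_prob_decides\<close>), which can be read off along the ray alone; hence every
  exit set is a function of the stem (\<open>exit_set_stem_test\<close>), and the stem is equivalent to the limit point.

  The action is free since a translated path has the same steps, hence the same records. If it had the
  same limit, the positions \<open>w\<close> and \<open>g \<otimes> w\<close> before a common late record would be two vertices of the
  same level on one ray, and so they would coincide (\<open>tame_moved\<close>).
\<close>

section \<open>Conjugation in groups with infinite conjugacy classes\<close>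

context group begin

lemma cancel_inv:
  assumes "x \<in> carrier G" "y \<in> carrier G"
  shows "inv x \<otimes> (x \<otimes> y) = y" "x \<otimes> (inv x \<otimes> y) = y"
  using assms by (simp_all add: m_assoc[symmetric])

lemmas group_arith = inv_mult_group m_assoc cancel_inv

text \<open>
  Thin sets are the subsets of finite unions of cosets of centralizers of non-identity elements: the
  conjugators from \<open>x\<close> to \<open>y\<close> are either none or a coset of the centralizer of \<open>x\<close>.
\<close>

definition thin :: "'a set \<Rightarrow> bool" where
  "thin S \<longleftrightarrow> (\<exists>P. finite P \<and> P \<subseteq> (carrier G - {\<one>}) \<times> carrier G \<and>
     (\<forall>g\<in>S. \<exists>(x, y)\<in>P. g \<otimes> x \<otimes> inv g = y))"

lemma thin_Un: "thin A \<Longrightarrow> thin B \<Longrightarrow> thin (A \<union> B)"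
  unfolding thin_def
  apply clarify
  subgoal for P Q by (rule exI[of _ "P \<union> Q"]) blast
  done

lemma thin_subset: "thin B \<Longrightarrow> A \<subseteq> B \<Longrightarrow> thin A"
  unfolding thin_def by (meson subsetD)

lemma thin_empty: "thin {}"
  unfolding thin_def by (rule exI[of _ "{}"]) auto

lemma thin_Union: "finite I \<Longrightarrow> (\<And>i. i \<in> I \<Longrightarrow> thin (A i)) \<Longrightarrow> thin (\<Union>i\<in>I. A i)"
  by (induction I rule: finite_induct) (auto intro: thin_empty thin_Un)

lemma thin_conjugators: "x \<in> carrier G - {\<one>} \<Longrightarrow> y \<in> carrier G \<Longrightarrow> thin {g. g \<otimes> x \<otimes> inv g = y}"
  unfolding thin_def by (rule exI[of _ "{(x, y)}"]) auto

text \<open>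
  If \<open>g \<otimes> d\<close> conjugates \<open>x\<close> to \<open>y\<close>, then \<open>g\<close> conjugates \<open>d \<otimes> x \<otimes> inv d\<close> to \<open>y\<close>.
\<close>

lemma thin_right_translate:
  assumes "thin S" "S \<subseteq> carrier G" "d \<in> carrier G"
  shows "thin {g \<in> carrier G. g \<otimes> d \<in> S}"
proof -
  from assms(1) obtain P where P: "finite P" "P \<subseteq> (carrier G - {\<one>}) \<times> carrier G"
    "\<And>g. g \<in> S \<Longrightarrow> \<exists>(x, y)\<in>P. g \<otimes> x \<otimes> inv g = y"
    unfolding thin_def by blast
  let ?P = "(\<lambda>(x, y). (d \<otimes> x \<otimes> inv d, y)) ` P"
  have "?P \<subseteq> (carrier G - {\<one>}) \<times> carrier G"
  proof clarsimp
    fix x y assume xy: "(x, y) \<in> P"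
    then have xc: "x \<in> carrier G" "x \<noteq> \<one>" "y \<in> carrier G" using P(2) by auto
    have "x = \<one>" if "d \<otimes> x \<otimes> inv d = \<one>"
    proof -
      have "x = inv d \<otimes> (d \<otimes> x \<otimes> inv d) \<otimes> d" using xc assms(3) by (simp add: group_arith)
      then show ?thesis using that assms(3) by simp
    qed
    then show "d \<otimes> x \<otimes> inv d \<in> carrier G \<and> d \<otimes> x \<otimes> inv d \<noteq> \<one> \<and> y \<in> carrier G"
      using xc assms(3) by auto
  qed
  moreover have "\<exists>(x, y)\<in>?P. g \<otimes> x \<otimes> inv g = y" if g: "g \<in> carrier G" "g \<otimes> d \<in> S" for g
  proof -
    from P(3)[OF g(2)] obtain x y where xy: "(x, y) \<in> P" "(g \<otimes> d) \<otimes> x \<otimes> inv (g \<otimes> d) = y" by blast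
    have "g \<otimes> (d \<otimes> x \<otimes> inv d) \<otimes> inv g = y"
      using xy P(2) g assms(3) by (auto simp: inv_mult_group m_assoc)
    with xy(1) show ?thesis by force
  qed
  ultimately show ?thesis
    using P(1) unfolding thin_def by (intro exI[of _ ?P]) auto
qed

text \<open>
  A square root of \<open>z\<close> commutes with \<open>z\<close>.
\<close>

lemma thin_roots:
  assumes "z \<in> carrier G" "z \<noteq> \<one>"
  shows "thin {k \<in> carrier G. k \<otimes> k = z}"
proof (rule thin_subset[OF thin_conjugators[of z z]])
  show "{k \<in> carrier G. k \<otimes> k = z} \<subseteq> {g. g \<otimes> z \<otimes> inv g = z}"
    by (auto simp: m_assoc)
qed (use assms in auto)

text \<open>
  This is B. H. Neumann's theorem that a group is not a finite union of cosets of subgroups of infinite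
  index, for centralizers: all of them have infinite index here. The induction is on the number of
  distinct centralizers that occur; finitely many cosets of one of them leave out some coset, which is
  therefore covered by cosets of the others.
\<close>

lemma carrier_not_thin:
  assumes icc: "icc_group G"
  shows "\<not> thin (carrier G)"
proof
  assume "thin (carrier G)"
  then obtain P0 where P0: "finite P0" "P0 \<subseteq> (carrier G - {\<one>}) \<times> carrier G"
    "\<forall>g\<in>carrier G. \<exists>(x, y)\<in>P0. g \<otimes> x \<otimes> inv g = y"
    unfolding thin_def by blast
  have *: "False" if "finite A" "finite P" "fst ` P \<subseteq> A" "A \<subseteq> carrier G - {\<one>}"
    "P \<subseteq> (carrier G - {\<one>}) \<times> carrier G"
    "\<forall>g\<in>carrier G. \<exists>(x, y)\<in>P. g \<otimes> x \<otimes> inv g = y" for A P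
    using that
  proof (induction A arbitrary: P rule: finite_induct)
    case empty
    then have "P = {}" by auto
    with empty.prems(5) one_closed show ?case by blast
  next
    case (insert a A)
    let ?cl = "(\<lambda>h. h \<otimes> a \<otimes> inv h) ` carrier G"
    have a: "a \<in> carrier G" "a \<noteq> \<one>" using insert.prems by auto
    have inf: "infinite ?cl" using icc a unfolding icc_group_def by auto
    have "finite (snd ` P)" using insert.prems(1) by auto
    then obtain y0 where y0: "y0 \<in> ?cl" "y0 \<notin> snd ` P" using inf by (meson finite_subset subsetI)
    then obtain c where c: "c \<in> carrier G" "y0 = c \<otimes> a \<otimes> inv c" by auto
    define P1 where "P1 = {p \<in> P. fst p \<noteq> a}"
    \<comment> \<open>Conjugators of \<open>a\<close> into \<open>y0\<close> form a coset that the remaining subgroups must cover; its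
      translates then cover every other coset of the centralizer of \<open>a\<close>.\<close>
    have cov: "\<exists>(x, y)\<in>P1. g \<otimes> x \<otimes> inv g = y" if "g \<in> carrier G" "g \<otimes> a \<otimes> inv g = y0" for g
    proof -
      obtain x y where "(x, y) \<in> P" "g \<otimes> x \<otimes> inv g = y"
        using bspec[OF insert.prems(5) \<open>g \<in> carrier G\<close>] by auto
      moreover have "x \<noteq> a" using calculation that(2) y0(2) by force
      ultimately show ?thesis unfolding P1_def by force
    qed
    define B where "B = {b \<in> (\<lambda>y. SOME b. b \<in> carrier G \<and> b \<otimes> a \<otimes> inv b = y) ` snd ` P. b \<in> carrier G}"
    define Q where "Q = P1 \<union> (\<lambda>(b, (x, y)). (x, b \<otimes> inv c \<otimes> y \<otimes> c \<otimes> inv b)) ` (B \<times> P1)"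
    have B: "finite B" "B \<subseteq> carrier G" using insert.prems(1) unfolding B_def by auto
    have P1: "finite P1" "fst ` P1 \<subseteq> A" "P1 \<subseteq> (carrier G - {\<one>}) \<times> carrier G"
      using insert.prems unfolding P1_def by auto
    show ?case
    proof (rule insert.IH)
      show "finite Q" using B P1 unfolding Q_def by auto
      show "fst ` Q \<subseteq> A" using P1(2) unfolding Q_def by force
      show "A \<subseteq> carrier G - {\<one>}" using insert.prems by auto
      show "Q \<subseteq> (carrier G - {\<one>}) \<times> carrier G"
        using P1(3) c(1) subsetD[OF B(2)] unfolding Q_def by auto
      show "\<forall>g\<in>carrier G. \<exists>(x, y)\<in>Q. g \<otimes> x \<otimes> inv g = y"
      proof
        fix g assume g: "g \<in> carrier G"
        obtain x y where xy: "(x, y) \<in> P" "g \<otimes> x \<otimes> inv g = y" using bspec[OF insert.prems(5) g] by auto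
        show "\<exists>(x, y)\<in>Q. g \<otimes> x \<otimes> inv g = y"
        proof (cases "x = a")
          case False
          then show ?thesis using xy unfolding Q_def P1_def by force
        next
          case True
          define b where "b = (SOME b. b \<in> carrier G \<and> b \<otimes> a \<otimes> inv b = y)"
          have b: "b \<in> carrier G \<and> b \<otimes> a \<otimes> inv b = y"
            unfolding b_def by (rule someI[of _ g]) (use xy g True in auto)
          have bB: "b \<in> B" using b xy(1) unfolding B_def b_def by force
          have "(c \<otimes> inv b \<otimes> g) \<otimes> a \<otimes> inv (c \<otimes> inv b \<otimes> g)
              = c \<otimes> inv b \<otimes> (g \<otimes> a \<otimes> inv g) \<otimes> b \<otimes> inv c"
            using b c g a by (simp add: inv_mult_group m_assoc)
          also have "g \<otimes> a \<otimes> inv g = b \<otimes> a \<otimes> inv b" using xy True b by simp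
          also have "c \<otimes> inv b \<otimes> (b \<otimes> a \<otimes> inv b) \<otimes> b \<otimes> inv c = y0"
            unfolding c(2) using conjunct1[OF b] c(1) a by (simp add: group_arith)
          finally have "(c \<otimes> inv b \<otimes> g) \<otimes> a \<otimes> inv (c \<otimes> inv b \<otimes> g) = y0" .
          then obtain x' y' where xy': "(x', y') \<in> P1"
            "(c \<otimes> inv b \<otimes> g) \<otimes> x' \<otimes> inv (c \<otimes> inv b \<otimes> g) = y'"
            using cov[of "c \<otimes> inv b \<otimes> g"] b c g by auto
          have x'c: "x' \<in> carrier G" using xy'(1) P1 by auto
          have "g \<otimes> x' \<otimes> inv g = b \<otimes> inv c \<otimes> y' \<otimes> c \<otimes> inv b"
            unfolding xy'(2)[symmetric] using conjunct1[OF b] c(1) g x'c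
            by (simp add: group_arith)
          then show ?thesis using xy'(1) bB unfolding Q_def by force
        qed
      qed
    qed
  qed
  have "finite (fst ` P0)" "fst ` P0 \<subseteq> carrier G - {\<one>}" using P0(1,2) by auto
  then show False
    using *[OF _ P0(1) subset_refl _ P0(2,3)] by simp
qed

lemma thin_finite:
  assumes "icc_group G" "finite F" "F \<subseteq> carrier G"
  shows "thin F"
proof -
  obtain x where x: "x \<in> carrier G" "x \<noteq> \<one>" using assms(1) unfolding icc_group_def by force
  have "thin (\<Union>a\<in>F. {a})"
  proof (rule thin_Union[OF assms(2)])
    fix a assume "a \<in> F"
    then have "a \<in> carrier G" using assms by auto
    then show "thin {a}"
      by (intro thin_subset[OF thin_conjugators[of x "a \<otimes> x \<otimes> inv a"]]) (use x in auto)
  qed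
  then show ?thesis by simp
qed

text \<open>
  The conditions with one \<open>g\<close> and one \<open>inv g\<close> exclude a thin set of \<open>g\<close>. The condition
  \<open>c = g \<otimes> d \<otimes> g\<close> says that \<open>g \<otimes> d\<close> is a square root of \<open>c \<otimes> d\<close>, which is thin again unless
  \<open>c \<otimes> d = \<one>\<close>. In the remaining case \<open>g \<otimes> d\<close> is an involution. If the involutions form a thin set, all
  excluded sets are thin; otherwise \<open>g\<close> can be taken to be an involution, and then
  \<open>g \<otimes> d \<otimes> g = g \<otimes> d \<otimes> inv g\<close> is one of the harmless conditions.
\<close>

lemma super_switching_exists:
  assumes icc: "icc_group G" and X: "finite X" "X \<subseteq> carrier G" and F: "finite F" "F \<subseteq> carrier G"
  obtains g where "g \<in> carrier G" "g \<notin> F"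
    "\<And>c d a b. c \<in> X \<Longrightarrow> d \<in> X \<Longrightarrow> a \<in> {g, inv g} \<Longrightarrow> b \<in> {g, inv g} \<Longrightarrow> c = a \<otimes> d \<otimes> b \<Longrightarrow> c = \<one>"
proof -
  define Lin where "Lin = (\<Union>(c, d)\<in>(X - {\<one>}) \<times> X. {g. g \<otimes> c \<otimes> inv g = d}) \<union> F"
  have Lin: "thin Lin" unfolding Lin_def
  proof (intro thin_Un thin_Union)
    show "finite ((X - {\<one>}) \<times> X)" using X by auto
    show "thin (case i of (c, d) \<Rightarrow> {g. g \<otimes> c \<otimes> inv g = d})" if "i \<in> (X - {\<one>}) \<times> X" for i
      using that X by (auto split: prod.splits intro!: thin_conjugators)
    show "thin F" by (rule thin_finite) (use icc F in auto)
  qed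
  define Inv where "Inv = {k \<in> carrier G. k \<otimes> k = \<one>}"
  define Roots where "Roots = (\<Union>(c, d)\<in>X \<times> X. {g \<in> carrier G. g \<otimes> d \<in> {k \<in> carrier G. k \<otimes> k = c \<otimes> d}})"
  have sep: "c = \<one>" if g: "g \<in> carrier G" "g \<notin> Lin" "g \<notin> Roots \<or> g \<in> Inv"
    and cd: "c \<in> X" "d \<in> X" "a \<in> {g, inv g}" "b \<in> {g, inv g}" "c = a \<otimes> d \<otimes> b" for g c d a b
  proof (rule ccontr)
    assume c1: "c \<noteq> \<one>"
    have cc: "c \<in> carrier G" "d \<in> carrier G" using cd X by auto
    have L: False if "g \<otimes> u \<otimes> inv g = v" "u \<in> X" "v \<in> X" "u \<noteq> \<one>" for u v
      using that g(2) unfolding Lin_def by blast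
    have A: False if "c = g \<otimes> d \<otimes> inv g"
    proof -
      have "d \<noteq> \<one>" using that c1 g(1) by auto
      then show False using L[of d c] that cd by auto
    qed
    have B: False if "c = inv g \<otimes> d \<otimes> g"
    proof -
      have "g \<otimes> c \<otimes> inv g = d" using that cc g by (simp add: group_arith)
      then show False using L[of c d] c1 cd by auto
    qed
    have D: False if "c = g \<otimes> d \<otimes> g" "g \<notin> Inv"
    proof -
      have "(g \<otimes> d) \<otimes> (g \<otimes> d) = c \<otimes> d" using that cc g by (simp add: m_assoc)
      then have "g \<in> Roots" using cd cc g unfolding Roots_def by auto
      then show False using g(3) that(2) by auto
    qed
    have E: "inv g = g" if "g \<in> Inv" using that g unfolding Inv_def by (auto intro: inv_equality)
    show False
    proof (cases "g \<in> Inv")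
      case True
      then have "a = g" "b = g" using cd E by auto
      then show False using B cd(5) E[OF True] by metis
    next
      case False
      have "d = g \<otimes> c \<otimes> g" if "c = inv g \<otimes> d \<otimes> inv g" using that cc g by (simp add: group_arith)
      moreover have False if "d = g \<otimes> c \<otimes> g"
      proof -
        have "(g \<otimes> c) \<otimes> (g \<otimes> c) = d \<otimes> c" using that cc g by (simp add: m_assoc)
        then have "g \<in> Roots" using cd cc g unfolding Roots_def by auto
        then show False using g(3) False by auto
      qed
      ultimately show False using A B D cd g False by auto
    qed
  qed
  have "\<exists>g. g \<in> carrier G \<and> g \<notin> Lin \<and> (g \<notin> Roots \<or> g \<in> Inv)"
  proof (cases "thin Inv")
    case False
    then have "\<not> Inv \<subseteq> Lin" using Lin thin_subset by blast
    then show ?thesis unfolding Inv_def by auto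
  next
    case True
    have "thin Roots" unfolding Roots_def
    proof (rule thin_Union)
      show "finite (X \<times> X)" using X by auto
      fix i assume i: "i \<in> X \<times> X"
      obtain c d where [simp]: "i = (c, d)" by fastforce
      have cd: "c \<in> carrier G" "d \<in> carrier G" using i X by auto
      have "thin {k \<in> carrier G. k \<otimes> k = c \<otimes> d}"
        using True thin_roots[of "c \<otimes> d"] cd unfolding Inv_def by (cases "c \<otimes> d = \<one>") auto
      then show "thin (case i of (c, d) \<Rightarrow> {g \<in> carrier G. g \<otimes> d \<in> {k \<in> carrier G. k \<otimes> k = c \<otimes> d}})"
        using thin_right_translate[of "{k \<in> carrier G. k \<otimes> k = c \<otimes> d}" d] cd by auto
    qed
    then have "thin (Lin \<union> Roots)" using Lin thin_Un by blast
    then have "\<not> carrier G \<subseteq> Lin \<union> Roots" using carrier_not_thin[OF icc] thin_subset by blast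
    then show ?thesis by auto
  qed
  then obtain g where g: "g \<in> carrier G" "g \<notin> Lin" "g \<notin> Roots \<or> g \<in> Inv" by blast
  show ?thesis
    by (rule that[of g]) (use g sep[OF g] in \<open>auto simp: Lin_def\<close>)
qed

end

section \<open>Rooted forests and their boundaries\<close>

text \<open>
  A forest is presented by the relation from parents to children; the rank, which increases from parent
  to child, makes sure that every vertex has finitely many ancestors.
\<close>

locale ranked_forest =
  fixes V :: "'v set" and C :: "('v \<times> 'v) set" and rk :: "'v \<Rightarrow> nat"
  assumes C_subset: "C \<subseteq> V \<times> V"
    and rk_less: "(p, c) \<in> C \<Longrightarrow> rk p < rk c"
    and parent_unique: "(p, c) \<in> C \<Longrightarrow> (p', c) \<in> C \<Longrightarrow> p = p'"
    and finite_children: "finite {c. (p, c) \<in> C}"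
begin

definition E :: "('v \<times> 'v) set" where "E = C \<union> C\<inverse>"

definition anc :: "'v \<Rightarrow> 'v set" where "anc w = {v. (v, w) \<in> C\<^sup>*}"

lemma C_E: "(v, w) \<in> C \<Longrightarrow> (v, w) \<in> E" "(v, w) \<in> C \<Longrightarrow> (w, v) \<in> E"
  by (auto simp: E_def)

lemma sym_E: "sym E"
  by (auto simp: E_def sym_def)

lemma E_cases: "(v, w) \<in> E \<Longrightarrow> (v, w) \<in> C \<or> (w, v) \<in> C"
  by (auto simp: E_def)

lemma E_V: "(v, w) \<in> E \<Longrightarrow> v \<in> V \<and> w \<in> V"
  using C_subset by (auto simp: E_def)

lemma self_anc [simp]: "v \<in> anc v"
  by (simp add: anc_def)

lemma anc_child: "(p, c) \<in> C \<Longrightarrow> anc c = insert c (anc p)"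
proof (intro equalityI subsetI)
  fix v assume pc: "(p, c) \<in> C" and "v \<in> anc c"
  then have "(v, c) \<in> C\<^sup>*" by (simp add: anc_def)
  then show "v \<in> insert c (anc p)"
  proof (cases rule: rtranclE)
    case (step u)
    then show ?thesis using parent_unique[OF pc step(2)] by (simp add: anc_def)
  qed simp
next
  fix v assume "(p, c) \<in> C" "v \<in> insert c (anc p)"
  then show "v \<in> anc c" by (auto simp: anc_def intro: rtrancl_into_rtrancl)
qed

lemma anc_trans: "u \<in> anc v \<Longrightarrow> v \<in> anc w \<Longrightarrow> u \<in> anc w"
  by (simp add: anc_def)

lemma rk_anc: "v \<in> anc w \<Longrightarrow> v = w \<or> rk v < rk w"
proof -
  have "(v, w) \<in> C\<^sup>* \<Longrightarrow> v = w \<or> rk v < rk w"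
    by (induction rule: rtrancl_induct) (auto dest: rk_less)
  then show "v \<in> anc w \<Longrightarrow> v = w \<or> rk v < rk w" by (simp add: anc_def)
qed

lemma not_anc_child: "(p, c) \<in> C \<Longrightarrow> c \<notin> anc p"
  using rk_anc rk_less by fastforce

text \<open>
  The ancestors of a vertex form a chain because parents are unique.
\<close>

lemma anc_chain:
  assumes "u \<in> anc w" "v \<in> anc w"
  shows "u \<in> anc v \<or> v \<in> anc u"
proof -
  have "(u, w) \<in> C\<^sup>* \<Longrightarrow> \<forall>v. v \<in> anc w \<longrightarrow> u \<in> anc v \<or> v \<in> anc u"
  proof (induction rule: rtrancl_induct)
    case (step y z)
    have "u \<in> anc z" using step.hyps by (simp add: anc_def)
    then show ?case using anc_child[OF step.hyps(2)] step.IH by auto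
  qed auto
  with assms show ?thesis by (auto simp: anc_def)
qed

lemma finite_anc: "finite (anc v)"
proof (induction "rk v" arbitrary: v rule: less_induct)
  case less
  show ?case
  proof (cases "\<exists>p. (p, v) \<in> C")
    case True
    then obtain p where "(p, v) \<in> C" ..
    with less rk_less anc_child show ?thesis by force
  next
    case False
    then have "anc v \<subseteq> {v}" by (auto simp: anc_def elim: rtranclE)
    then show ?thesis using finite_subset by blast
  qed
qed

lemma child_unique: "(v, c) \<in> C \<Longrightarrow> (v, c') \<in> C \<Longrightarrow> c \<in> anc c' \<Longrightarrow> c = c'"
  using anc_child not_anc_child by blast

lemma forest_E: "forest V E"
proof -
  have "\<not> graph_cycle E p" for p
  proof
    assume p: "graph_cycle E p"
    define n where "n = length p"
    have n: "3 \<le> n" "distinct p" using p by (auto simp: graph_cycle_def n_def)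
    have "p \<noteq> []" using n n_def by auto
    \<comment> \<open>Around the cycle, a vertex of maximal rank has its parent on both sides.\<close>
    have edge: "(p ! i, p ! (Suc i mod n)) \<in> E" if "i < n" for i
    proof (cases "Suc i < n")
      case True
      then show ?thesis using p by (auto simp: graph_cycle_def successively_conv_nth n_def)
    next
      case False
      then have "Suc i = n" using that by auto
      then have "p ! i = last p" "p ! (Suc i mod n) = hd p"
        using \<open>p \<noteq> []\<close> by (auto simp: last_conv_nth hd_conv_nth n_def dest: sym)
      then show ?thesis using p by (auto simp: graph_cycle_def)
    qed
    obtain i where i: "i < n" "\<And>j. j < n \<Longrightarrow> rk (p ! j) \<le> rk (p ! i)"
    proof -
      have "Max ((\<lambda>j. rk (p ! j)) ` {..<n}) \<in> (\<lambda>j. rk (p ! j)) ` {..<n}"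
        using n by (intro Max_in) (auto simp: lessThan_empty_iff)
      then obtain i where i: "i < n" "Max ((\<lambda>j. rk (p ! j)) ` {..<n}) = rk (p ! i)" by auto
      show ?thesis by (rule that[OF i(1)]) (simp flip: i(2))
    qed
    define k where "k = (if i = 0 then n - 1 else i - 1)"
    have k: "k < n" "Suc k mod n = i" using i n by (auto simp: k_def)
    define l where "l = Suc i mod n"
    have l: "l < n" using n by (auto simp: l_def)
    have "(p ! k, p ! i) \<in> C" using edge[OF k(1)] k i(2)[OF k(1)] by (auto simp: E_def dest: rk_less)
    moreover have "(p ! l, p ! i) \<in> C"
      using edge[OF i(1)] i(2)[OF l] by (auto simp: E_def l_def dest: rk_less)
    ultimately have "p ! k = p ! l" by (rule parent_unique)
    then have "k = l" using n k l by (simp add: n_def nth_eq_iff_index_eq)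
    then show False using n i(1) by (auto simp: k_def l_def mod_Suc split: if_splits)
  qed
  moreover have "simple_graph V E"
    using sym_E E_V by (auto simp: simple_graph_def irrefl_def E_def dest: rk_less)
  ultimately show ?thesis by (auto simp: forest_def)
qed

lemma locally_finite_E: "locally_finite_graph V E"
proof -
  have "finite {w. (v, w) \<in> E}" for v
  proof -
    have "finite {p. (p, v) \<in> C}"
      by (rule finite_subset[OF _ finite_anc[of v]]) (auto simp: anc_def)
    moreover have "{w. (v, w) \<in> E} = {p. (p, v) \<in> C} \<union> {c. (v, c) \<in> C}" by (auto simp: E_def)
    ultimately show ?thesis using finite_children by auto
  qed
  then show ?thesis by (simp add: locally_finite_graph_def)
qed


definition non_backtracking :: "(nat \<Rightarrow> 'v) \<Rightarrow> nat \<Rightarrow> bool" where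
  "non_backtracking w n \<longleftrightarrow> (\<forall>i<n. (w i, w (Suc i)) \<in> E) \<and> (\<forall>i. Suc i < n \<longrightarrow> w (Suc (Suc i)) \<noteq> w i)"

lemma card_sym_diff_edge:
  assumes "(v, w) \<in> E" "finite A"
  shows "card ((A - anc w) \<union> (anc w - A)) \<le> Suc (card ((A - anc v) \<union> (anc v - A)))"
proof -
  obtain x where "(A - anc w) \<union> (anc w - A) \<subseteq> insert x ((A - anc v) \<union> (anc v - A))"
  proof (cases "(v, w) \<in> C")
    case True
    show ?thesis by (rule that[of w]) (use anc_child[OF True] in auto)
  next
    case False
    then have "(w, v) \<in> C" using assms E_cases by blast
    show ?thesis by (rule that[of v]) (use anc_child[OF \<open>(w, v) \<in> C\<close>] in auto)
  qed
  then have "card ((A - anc w) \<union> (anc w - A)) \<le> card (insert x ((A - anc v) \<union> (anc v - A)))"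
    by (intro card_mono) (use \<open>finite A\<close> finite_anc in auto)
  also have "\<dots> \<le> Suc (card ((A - anc v) \<union> (anc v - A)))" by (rule card_insert_le_m1) auto
  finally show ?thesis .
qed

text \<open>
  The path between two vertices of one tree climbs to their last common ancestor and descends again, so
  that the ancestors of exactly one of the two vertices count its edges. This gives a lower bound for the
  length of any walk that needs no analysis of the walk.
\<close>

definition anc_dist :: "'v \<Rightarrow> 'v \<Rightarrow> nat" where
  "anc_dist v w = card ((anc v - anc w) \<union> (anc w - anc v))"

lemma anc_dist_le: "(v, w) \<in> E ^^ k \<Longrightarrow> anc_dist v w \<le> k"
proof (induction k arbitrary: w)
  case 0
  then show ?case by (simp add: anc_dist_def)
next
  case (Suc k)
  then obtain u where u: "(v, u) \<in> E ^^ k" "(u, w) \<in> E" by auto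
  show ?case
    using card_sym_diff_edge[OF u(2) finite_anc[of v]] Suc.IH[OF u(1)] by (simp add: anc_dist_def)
qed

text \<open>
  A walk that never turns back first climbs and then descends. In each step the set of ancestors that
  the current vertex does not share with the initial one grows by one element.
\<close>

lemma non_backtracking_anc_dist:
  assumes nb: "non_backtracking w n" and "i \<le> n"
  shows "anc_dist (w 0) (w i) = i \<and>
    (w i \<in> anc (w 0) \<and> (i > 0 \<longrightarrow> (w i, w (i - 1)) \<in> C \<and> w (i - 1) \<in> anc (w 0)) \<or>
     i > 0 \<and> (w (i - 1), w i) \<in> C \<and> w i \<notin> anc (w 0))"
  using \<open>i \<le> n\<close>
proof (induction i)
  case 0
  then show ?case by (simp add: anc_dist_def)
next
  case (Suc i)
  let ?A = "anc (w 0)"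
  have e: "(w i, w (Suc i)) \<in> E" using nb Suc.prems by (auto simp: non_backtracking_def)
  have turn: "w (Suc i) \<noteq> w (i - 1)" if "i > 0"
    using nb Suc.prems that by (cases i) (auto simp: non_backtracking_def)
  have IH: "anc_dist (w 0) (w i) = i"
    "w i \<in> ?A \<and> (i > 0 \<longrightarrow> (w i, w (i - 1)) \<in> C \<and> w (i - 1) \<in> ?A) \<or>
     i > 0 \<and> (w (i - 1), w i) \<in> C \<and> w i \<notin> ?A"
    using Suc.IH[OF Suc_leD[OF Suc.prems]] by (rule conjunct1, rule conjunct2)
  show ?case
  proof (cases "(w i, w (Suc i)) \<in> C")
    case True
    have new: "w (Suc i) \<notin> ?A"
    proof
      assume a: "w (Suc i) \<in> ?A"
      have wi: "w i \<in> ?A" by (rule anc_trans[OF _ a]) (simp add: anc_child[OF True])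
      show False
      proof (cases "i = 0")
        case True
        then show ?thesis using a \<open>(w i, w (Suc i)) \<in> C\<close> not_anc_child by auto
      next
        case False
        then have "(w i, w (i - 1)) \<in> C" "w (i - 1) \<in> ?A" using IH(2) wi by simp_all
        then show False using turn anc_chain[OF a \<open>w (i - 1) \<in> ?A\<close>]
            child_unique[OF True \<open>(w i, w (i - 1)) \<in> C\<close>] child_unique[OF \<open>(w i, w (i - 1)) \<in> C\<close> True] False
          by auto
      qed
    qed
    have "anc_dist (w 0) (w (Suc i)) = card (insert (w (Suc i)) ((?A - anc (w i)) \<union> (anc (w i) - ?A)))"
      unfolding anc_dist_def anc_child[OF True] using new by (intro arg_cong[of _ _ card]) auto
    also have "\<dots> = Suc (anc_dist (w 0) (w i))"
      unfolding anc_dist_def using finite_anc new not_anc_child[OF True] by (subst card_insert_disjoint) auto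
    finally show ?thesis using IH(1) new True by simp
  next
    case False
    then have up: "(w (Suc i), w i) \<in> C" using e E_cases by blast
    have wi: "w i \<in> ?A"
    proof (rule ccontr)
      assume "w i \<notin> ?A"
      then have "i > 0" "(w (i - 1), w i) \<in> C" using IH(2) by simp_all
      then show False using parent_unique[OF up] turn by simp
    qed
    have s: "w (Suc i) \<in> ?A" by (rule anc_trans[OF _ wi]) (simp add: anc_child[OF up])
    have "anc_dist (w 0) (w (Suc i)) = card (insert (w i) ((?A - anc (w i)) \<union> (anc (w i) - ?A)))"
      unfolding anc_dist_def anc_child[OF up] using wi not_anc_child[OF up]
      by (intro arg_cong[of _ _ card]) (auto intro: anc_trans)
    also have "\<dots> = Suc (anc_dist (w 0) (w i))"
      unfolding anc_dist_def using finite_anc wi by (subst card_insert_disjoint) auto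
    finally show ?thesis using IH(1) s wi up by simp
  qed
qed

lemma non_backtracking_dist:
  assumes "non_backtracking w n"
  shows "graph_dist E (w 0) (w n) = n"
  unfolding graph_dist_def
proof (rule Least_equality)
  show "(w 0, w n) \<in> E ^^ n"
    using assms unfolding relpow_fun_conv non_backtracking_def by blast
  show "n \<le> k" if "(w 0, w n) \<in> E ^^ k" for k
    using anc_dist_le[OF that] non_backtracking_anc_dist[OF assms, of n] by simp
qed

text \<open>
  After a descending edge the only way up is back to where the walk came from.
\<close>

lemma non_backtracking_down:
  assumes "non_backtracking w n" "(w m, w (Suc m)) \<in> C" "m \<le> i" "i < n"
  shows "(w i, w (Suc i)) \<in> C"
  using assms(3,4)
proof (induction i rule: dec_induct)
  case base
  then show ?case using assms(2) by simp
next
  case (step i)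
  then have "(w (Suc i), w (Suc (Suc i))) \<in> E" "w (Suc (Suc i)) \<noteq> w i" "(w i, w (Suc i)) \<in> C"
    using assms(1) by (auto simp: non_backtracking_def)
  then show ?case using E_cases parent_unique by blast
qed

lemma chain_anc:
  assumes "\<And>i. m \<le> i \<Longrightarrow> i < n \<Longrightarrow> (w i, w (Suc i)) \<in> C" "m \<le> n"
  shows "w m \<in> anc (w n)"
  using assms(2,1)
proof (induction n rule: dec_induct)
  case (step n)
  then have "(w n, w (Suc n)) \<in> C" by auto
  then show ?case using step anc_child by auto
qed simp


abbreviation "rays \<equiv> geodesic_rays V E"

lemma rays_iff:
  "r \<in> rays \<longleftrightarrow> (\<forall>i. (r i, r (Suc i)) \<in> E) \<and> (\<forall>i. r (Suc (Suc i)) \<noteq> r i)"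
proof (intro iffI conjI allI)
  assume r: "r \<in> rays"
  then show "(r i, r (Suc i)) \<in> E" for i by (auto simp: geodesic_rays_def)
  show "r (Suc (Suc i)) \<noteq> r i" for i
  proof
    assume *: "r (Suc (Suc i)) = r i"
    have "graph_dist E (r i) (r (Suc (Suc i))) = Suc (Suc i) - i"
      using r by (auto simp: geodesic_rays_def)
    moreover have "graph_dist E (r i) (r i) = 0"
      using non_backtracking_dist[of "\<lambda>_. r i" 0] by (simp add: non_backtracking_def)
    ultimately show False using * by simp
  qed
next
  assume r: "(\<forall>i. (r i, r (Suc i)) \<in> E) \<and> (\<forall>i. r (Suc (Suc i)) \<noteq> r i)"
  have "graph_dist E (r i) (r j) = j - i" if "i \<le> j" for i j
    using non_backtracking_dist[of "\<lambda>k. r (i + k)" "j - i"] r that by (auto simp: non_backtracking_def)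
  moreover have "r i \<in> V" for i using r E_V[of "r i" "r (Suc i)"] by blast
  ultimately show "r \<in> rays" using r by (auto simp: geodesic_rays_def)
qed

lemma ray_non_backtracking: "r \<in> rays \<Longrightarrow> non_backtracking r n"
  by (auto simp: rays_iff non_backtracking_def)

lemma ray_shift: "r \<in> rays \<Longrightarrow> (\<lambda>i. r (k + i)) \<in> rays"
  by (auto simp: rays_iff)

lemma descending_ray: "(\<And>i. (r i, r (Suc i)) \<in> C) \<Longrightarrow> r \<in> rays"
  unfolding rays_iff by (metis C_E(1) less_asym rk_less)

lemma ray_down_from:
  assumes "r \<in> rays" "(r m, r (Suc m)) \<in> C" "m \<le> i"
  shows "(r i, r (Suc i)) \<in> C"
  using non_backtracking_down[OF ray_non_backtracking[OF assms(1), of "Suc i"] assms(2,3)] by simp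

lemma ray_eventually_down:
  assumes "r \<in> rays"
  shows "\<exists>m. \<forall>i\<ge>m. (r i, r (Suc i)) \<in> C"
proof -
  have "\<exists>m. (r m, r (Suc m)) \<in> C"
  proof (rule ccontr)
    assume "\<nexists>m. (r m, r (Suc m)) \<in> C"
    then have "(r (Suc m), r m) \<in> C" for m using assms E_cases by (auto simp: rays_iff)
    then have "rk (r m) + m \<le> rk (r 0)" for m
    proof (induction m)
      case (Suc m)
      then show ?case using rk_less[OF \<open>\<And>m. (r (Suc m), r m) \<in> C\<close>, of m] by simp
    qed simp
    from this[of "Suc (rk (r 0))"] show False by simp
  qed
  then obtain m where "(r m, r (Suc m)) \<in> C" ..
  then show ?thesis by (intro exI[of _ m] allI impI) (rule ray_down_from[OF assms])
qed


text \<open>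
  The stem of a path that converges to the boundary consists of the vertices of the ray to its limit
  that starts at the root of the tree; it does not depend on finitely many positions of the path.
\<close>

definition stem :: "(nat \<Rightarrow> 'v) \<Rightarrow> 'v set" where
  "stem y = {v. \<forall>\<^sub>F n in sequentially. v \<in> anc (y n)}"

lemma stem_chain:
  assumes "u \<in> stem y" "v \<in> stem y"
  shows "u \<in> anc v \<or> v \<in> anc u"
proof -
  have "\<forall>\<^sub>F n in sequentially. u \<in> anc (y n) \<and> v \<in> anc (y n)"
    using assms by (auto simp: stem_def intro: eventually_conj)
  then obtain n where "u \<in> anc (y n) \<and> v \<in> anc (y n)" by (auto simp: eventually_sequentially)
  then show ?thesis using anc_chain by blast
qed

lemma stem_rk_less: "u \<in> stem y \<Longrightarrow> v \<in> stem y \<Longrightarrow> rk u \<le> rk v \<Longrightarrow> u \<in> anc v"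
  using stem_chain[of u y v] rk_anc[of v u] by auto

lemma stem_rk_inj: "u \<in> stem y \<Longrightarrow> v \<in> stem y \<Longrightarrow> rk u = rk v \<Longrightarrow> u = v"
  using stem_rk_less[of u y v] rk_anc[of u v] by auto

lemma stem_closed: "v \<in> stem y \<Longrightarrow> u \<in> anc v \<Longrightarrow> u \<in> stem y"
  unfolding stem_def by (auto elim!: eventually_mono intro: anc_trans)

lemma stem_shift: "stem (\<lambda>i. y (k + i)) = stem y"
proof -
  have "eventually (\<lambda>i. P (k + i)) sequentially \<longleftrightarrow> eventually P sequentially" for P
    using eventually_sequentially_seg[of P k] by (simp add: add.commute)
  from this[of "\<lambda>i. v \<in> anc (y i)" for v] show ?thesis by (auto simp: stem_def)
qed

lemma stem_unbounded:
  assumes "infinite (stem y)"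
  obtains v where "v \<in> stem y" "n < rk v"
proof -
  have "finite (stem y)" if "\<forall>v\<in>stem y. rk v \<le> n"
    by (rule inj_on_finite[of rk _ "{..n}"]) (use that stem_rk_inj in \<open>auto simp: inj_on_def\<close>)
  then show ?thesis using assms that by force
qed

lemma stem_child:
  assumes "infinite (stem y)" "v \<in> stem y"
  obtains c where "c \<in> stem y" "(v, c) \<in> C"
proof -
  obtain w where w: "w \<in> stem y" "rk v < rk w" using stem_unbounded[OF assms(1)] .
  then have "v \<in> anc w" "v \<noteq> w" using stem_rk_less assms(2) by auto
  then obtain c where "(v, c) \<in> C" "(c, w) \<in> C\<^sup>*"
    unfolding anc_def by (auto elim: converse_rtranclE)
  moreover have "c \<in> stem y" using stem_closed[OF w(1)] calculation by (simp add: anc_def)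
  ultimately show ?thesis using that by blast
qed

lemma stem_descending_ray:
  assumes "infinite (stem y)" "v \<in> stem y"
  obtains r where "r 0 = v" "\<And>i. (r i, r (Suc i)) \<in> C" "\<And>i. r i \<in> stem y"
proof -
  have "\<exists>r. \<forall>n. (r n \<in> stem y \<and> (n = 0 \<longrightarrow> r n = v)) \<and> (r n, r (Suc n)) \<in> C"
  proof (rule dependent_nat_choice)
    show "\<exists>x. x \<in> stem y \<and> (0 = 0 \<longrightarrow> x = v)" using assms by auto
    show "\<exists>z. (z \<in> stem y \<and> (Suc n = 0 \<longrightarrow> z = v)) \<and> (x, z) \<in> C" if "x \<in> stem y \<and> (n = 0 \<longrightarrow> x = v)" for x n
      using stem_child[OF assms(1), of x] that by auto
  qed
  then show ?thesis using that by blast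
qed

lemma descending_rk:
  assumes "\<And>i. m \<le> i \<Longrightarrow> (r i, r (Suc i)) \<in> C"
  shows "k \<le> rk (r (m + k))"
proof (induction k)
  case (Suc k)
  have "rk (r (m + k)) < rk (r (Suc (m + k)))" by (rule rk_less) (rule assms, simp)
  then show ?case using Suc by simp
qed simp

lemma descending_stem:
  assumes "\<And>i. m \<le> i \<Longrightarrow> (r i, r (Suc i)) \<in> C" "m \<le> k"
  shows "r k \<in> stem r"
proof -
  have "r k \<in> anc (r n)" if "k \<le> n" for n
    by (rule chain_anc) (use assms that in auto)
  then show ?thesis by (auto simp: stem_def eventually_sequentially)
qed

lemma infinite_ray_stem:
  assumes "r \<in> rays"
  shows "infinite (stem r)"
proof
  assume fin: "finite (stem r)"
  obtain m where m: "\<And>i. m \<le> i \<Longrightarrow> (r i, r (Suc i)) \<in> C" using ray_eventually_down[OF assms] by metis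
  have "Suc (Max (rk ` stem r)) \<le> rk (r (m + Suc (Max (rk ` stem r))))" by (rule descending_rk[of m r, OF m])
  also have "\<dots> \<le> Max (rk ` stem r)"
    by (rule Max_ge) (use fin descending_stem[of m r, OF m] in auto)
  finally show False by simp
qed

text \<open>
  Both stems are closed under ancestors and totally ordered, so an unbounded common part determines them.
\<close>

lemma stem_eqI:
  assumes m: "\<And>i. m \<le> i \<Longrightarrow> (r i, r (Suc i)) \<in> C" and y: "\<And>k. m \<le> k \<Longrightarrow> r k \<in> stem y"
  shows "stem r = stem y"
proof (intro equalityI subsetI)
  fix v assume "v \<in> stem r"
  then obtain N where "\<forall>n\<ge>N. v \<in> anc (r n)" by (auto simp: stem_def eventually_sequentially)
  then have "max m N \<ge> m" "v \<in> anc (r (max m N))" by auto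
  then obtain k where "k \<ge> m" "v \<in> anc (r k)" by blast
  then show "v \<in> stem y" using stem_closed y by blast
next
  fix v assume "v \<in> stem y"
  moreover have "rk v \<le> rk (r (m + rk v))" by (rule descending_rk[of m r, OF m])
  ultimately have "v \<in> anc (r (m + rk v))" using stem_rk_less y by simp
  then show "v \<in> stem r" by (rule stem_closed[rotated]) (rule descending_stem[of m r, OF m], simp_all)
qed

text \<open>
  Rays with the same stem merge: the descending parts of both lie in the stem, which has at most one
  vertex among the children of each vertex.
\<close>

lemma ray_equiv_iff:
  "(r, s) \<in> ray_equiv V E \<longleftrightarrow> r \<in> rays \<and> s \<in> rays \<and> stem r = stem s"
proof
  assume "(r, s) \<in> ray_equiv V E"
  then obtain n m where rs: "r \<in> rays" "s \<in> rays" "\<forall>i. r (n + i) = s (m + i)"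
    by (auto simp: ray_equiv_def)
  have "stem r = stem (\<lambda>i. r (n + i))" by (simp only: stem_shift)
  also have "\<dots> = stem s" using rs(3) stem_shift[of s m] by simp
  finally show "r \<in> rays \<and> s \<in> rays \<and> stem r = stem s" using rs by simp
next
  assume *: "r \<in> rays \<and> s \<in> rays \<and> stem r = stem s"
  then have rs: "r \<in> rays" "s \<in> rays" by auto
  obtain a where a: "\<And>i. a \<le> i \<Longrightarrow> (r i, r (Suc i)) \<in> C" using ray_eventually_down[OF rs(1)] by metis
  obtain b where b: "\<And>i. b \<le> i \<Longrightarrow> (s i, s (Suc i)) \<in> C" using ray_eventually_down[OF rs(2)] by metis
  \<comment> \<open>A vertex of \<open>r\<close> of rank above \<open>s b\<close> lies on the descending part of \<open>s\<close>.\<close>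
  define k where "k = a + Suc (rk (s b))"
  have k: "Suc (rk (s b)) \<le> rk (r k)" unfolding k_def by (rule descending_rk[of a r, OF a])
  have rk_s: "r k \<in> stem s" using descending_stem[of a r, OF a, of k] * by (simp add: k_def)
  then obtain N where "\<forall>n\<ge>N. r k \<in> anc (s n)" by (auto simp: stem_def eventually_sequentially)
  then have "max b N \<ge> b" "r k \<in> anc (s (max b N))" by auto
  then obtain j where j: "j \<ge> b" "r k \<in> anc (s j)" by blast
  have "\<And>v. v \<in> anc (s j) \<Longrightarrow> v \<in> anc (s b) \<or> (\<exists>i\<ge>b. v = s i)"
    using j(1)
  proof (induction j rule: dec_induct)
    case (step j)
    show ?case
    proof (cases "v = s (Suc j)")
      case True
      then show ?thesis using step.hyps(1) by (intro disjI2 exI[of _ "Suc j"]) simp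
    next
      case False
      then show ?thesis using step.prems step.IH anc_child[OF b[OF step.hyps(1)]] by simp
    qed
  qed auto
  with j(2) obtain l where l: "l \<ge> b" "r k = s l" using rk_anc[of "r k" "s b"] k by force
  have "r (k + t) = s (l + t)" for t
  proof (induction t)
    case (Suc t)
    have "(r (k + t), r (Suc (k + t))) \<in> C" by (rule a) (simp add: k_def)
    moreover have "(s (l + t), s (Suc (l + t))) \<in> C" by (rule b) (use l(1) in simp)
    moreover have "r (Suc (k + t)) \<in> stem s" "s (Suc (l + t)) \<in> stem s"
      using descending_stem[of a r "Suc (k + t)", OF a] descending_stem[of b s "Suc (l + t)", OF b] * l
      by (auto simp: k_def)
    ultimately show ?case using stem_chain child_unique Suc.IH by (metis add_Suc_right)
  qed (use l in simp)
  then show "(r, s) \<in> ray_equiv V E" using rs by (auto simp: ray_equiv_def)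
qed


abbreviation "bd \<equiv> forest_boundary V E"

lemma ray_class_bd: "r \<in> rays \<Longrightarrow> ray_equiv V E `` {r} \<in> bd"
  by (simp add: forest_boundary_def quotientI)

text \<open>
  By \<open>ray_equiv_iff\<close> the choice of the ray is irrelevant. Thus boundary points can be handled as sets of
  vertices.
\<close>

definition bstem :: "(nat \<Rightarrow> 'v) set \<Rightarrow> 'v set" where "bstem \<xi> = stem (SOME r. r \<in> \<xi>)"

lemma bd_iff: "\<xi> \<in> bd \<longleftrightarrow> (\<exists>r\<in>rays. \<xi> = {s \<in> rays. stem s = stem r})"
  unfolding forest_boundary_def quotient_def Image_def by (auto simp: ray_equiv_iff)

lemma bstem_eq: "\<xi> \<in> bd \<Longrightarrow> r \<in> \<xi> \<Longrightarrow> bstem \<xi> = stem r"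
proof -
  assume "\<xi> \<in> bd" and r: "r \<in> \<xi>"
  then obtain s where s: "\<xi> = {t \<in> rays. stem t = stem s}" by (auto simp: bd_iff)
  have "(SOME r. r \<in> \<xi>) \<in> \<xi>" using someI[of "\<lambda>r. r \<in> \<xi>", OF r] .
  then show "bstem \<xi> = stem r" using r s by (simp add: bstem_def)
qed

lemma mem_bd_iff: "\<xi> \<in> bd \<Longrightarrow> r \<in> \<xi> \<longleftrightarrow> r \<in> rays \<and> stem r = bstem \<xi>"
proof -
  assume \<xi>: "\<xi> \<in> bd"
  then obtain s where s: "s \<in> rays" "\<xi> = {t \<in> rays. stem t = stem s}" by (auto simp: bd_iff)
  then have "bstem \<xi> = stem s" by (intro bstem_eq[OF \<xi>]) auto
  with s show ?thesis by auto
qed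

lemma bd_ray: "\<xi> \<in> bd \<Longrightarrow> \<exists>r. r \<in> \<xi>"
  by (auto simp: bd_iff)

lemma bstem_inj: "\<xi> \<in> bd \<Longrightarrow> \<eta> \<in> bd \<Longrightarrow> bstem \<xi> = bstem \<eta> \<Longrightarrow> \<xi> = \<eta>"
proof -
  assume *: "\<xi> \<in> bd" "\<eta> \<in> bd" "bstem \<xi> = bstem \<eta>"
  have "r \<in> \<xi> \<longleftrightarrow> r \<in> \<eta>" for r using mem_bd_iff[of \<xi> r] mem_bd_iff[of \<eta> r] * by simp
  then show "\<xi> = \<eta>" by blast
qed

lemma bstem_class: "r \<in> rays \<Longrightarrow> bstem (ray_equiv V E `` {r}) = stem r"
  by (rule bstem_eq[OF ray_class_bd]) (auto simp: ray_equiv_iff)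

lemma class_eq: "\<xi> \<in> bd \<Longrightarrow> r \<in> rays \<Longrightarrow> stem r = bstem \<xi> \<Longrightarrow> ray_equiv V E `` {r} = \<xi>"
  by (rule bstem_inj) (simp_all add: ray_class_bd bstem_class)

lemma infinite_bstem: "\<xi> \<in> bd \<Longrightarrow> infinite (bstem \<xi>)"
  using bd_ray[of \<xi>] mem_bd_iff[of \<xi>] infinite_ray_stem by force

lemma infinite_stem_bd:
  assumes "infinite (stem y)"
  obtains \<xi> where "\<xi> \<in> bd" "bstem \<xi> = stem y"
proof -
  obtain v where "v \<in> stem y" using stem_unbounded[OF assms] .
  then obtain r where r: "\<And>i. (r i, r (Suc i)) \<in> C" "\<And>i. r i \<in> stem y"
    using stem_descending_ray[OF assms] by metis
  have "r \<in> rays" by (rule descending_ray) (rule r)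
  moreover have "stem r = stem y" by (rule stem_eqI[of 0]) (auto intro: r)
  ultimately show ?thesis using that[of "ray_equiv V E `` {r}"] ray_class_bd bstem_class by simp
qed

text \<open>
  Cutting out a step and its reversal would leave a walk that is shorter by two.
\<close>

lemma geodesic_non_backtracking:
  assumes "geodesic_segment E v w p"
  shows "non_backtracking ((!) p) (length p - 1)"
proof -
  have e: "(p ! i, p ! Suc i) \<in> E" if "Suc i < length p" for i
    using assms that by (auto simp: geodesic_segment_def successively_conv_nth)
  have ends: "p ! 0 = v" "p ! (length p - 1) = w" "length p = Suc (graph_dist E v w)"
    using assms hd_conv_nth[of p] last_conv_nth[of p] unfolding geodesic_segment_def by metis+
  have "p ! Suc (Suc i) \<noteq> p ! i" if i: "Suc (Suc i) < length p" for i
  proof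
    assume eq: "p ! Suc (Suc i) = p ! i"
    define n where "n = length p - 3"
    define f where "f j = (if j \<le> i then p ! j else p ! (j + 2))" for j
    have "(f 0, f n) \<in> E ^^ n" unfolding relpow_fun_conv
    proof (intro exI[of _ f] conjI allI impI refl)
      fix j assume j: "j < n"
      consider "Suc j \<le> i" | "j = i" | "j > i" by linarith
      then show "(f j, f (Suc j)) \<in> E"
      proof cases
        case 2
        then show ?thesis using e[of "Suc (Suc i)"] eq j by (auto simp: f_def n_def)
      qed (use e[of j] e[of "j + 2"] j in \<open>auto simp: f_def n_def\<close>)
    qed
    moreover have "f 0 = v" using ends by (simp add: f_def)
    moreover have "f n = w"
    proof (cases "n \<le> i")
      case True
      then have "n = i" "length p - 1 = Suc (Suc i)" using i by (auto simp: n_def)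
      then show ?thesis using ends eq by (simp add: f_def)
    next
      case False
      moreover have "n + 2 = length p - 1" using i by (auto simp: n_def)
      ultimately show ?thesis using ends by (simp add: f_def)
    qed
    ultimately have "graph_dist E v w \<le> n" unfolding graph_dist_def by (auto intro: Least_le)
    then show False using ends(3) i by (simp add: n_def)
  qed
  then show ?thesis using e by (auto simp: non_backtracking_def)
qed

text \<open>
  From a vertex on the descending part of the limit ray, the segments to late positions start downwards
  with the ray, hence they descend all the way, which makes that vertex an ancestor. Conversely, a ray to
  the limit, continued by a descent to the current position, never turns back and so is geodesic.
\<close>

lemma converges_to_iff:
  assumes "\<xi> \<in> bd"
  shows "converges_to V E y \<xi> \<longleftrightarrow> stem y = bstem \<xi>"
proof
  assume conv: "converges_to V E y \<xi>"
  obtain r where r: "r \<in> \<xi>" using bd_ray[OF assms] ..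
  then have ray: "r \<in> rays" "stem r = bstem \<xi>" using mem_bd_iff[OF assms] by auto
  obtain m where m: "\<And>i. m \<le> i \<Longrightarrow> (r i, r (Suc i)) \<in> C" using ray_eventually_down[OF ray(1)] by metis
  have "r k \<in> stem y" if "m \<le> k" for k
  proof -
    \<comment> \<open>Seen from \<open>r k\<close> the limit ray descends at once, and so must the segments.\<close>
    have "(\<lambda>i. r (k + i)) \<in> \<xi>"
      unfolding mem_bd_iff[OF assms] stem_shift using ray ray_shift by simp
    then have "\<forall>\<^sub>F n in sequentially. \<exists>p. geodesic_segment E (r (k + 0)) (y n) p \<and> 1 < length p \<and> p ! 1 = r (k + 1)"
      using conjunct2[OF bspec[OF conjunct2[OF conv[unfolded converges_to_def]], of "\<lambda>i. r (k + i)"]]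
      by (auto dest: spec[of _ 1])
    then have "\<forall>\<^sub>F n in sequentially. r k \<in> anc (y n)"
    proof (rule eventually_mono)
      fix n assume "\<exists>p. geodesic_segment E (r (k + 0)) (y n) p \<and> 1 < length p \<and> p ! 1 = r (k + 1)"
      then obtain p where p: "geodesic_segment E (r k) (y n) p" "1 < length p" "p ! 1 = r (Suc k)" by auto
      have ends: "p ! 0 = r k" "p ! (length p - 1) = y n"
        using p hd_conv_nth[of p] last_conv_nth[of p] unfolding geodesic_segment_def by metis+
      have "(p ! i, p ! Suc i) \<in> C" if "i < length p - 1" for i
        by (rule non_backtracking_down[OF geodesic_non_backtracking[OF p(1)], of 0])
          (use p ends m[OF \<open>m \<le> k\<close>] that in auto)
      then have "p ! 0 \<in> anc (p ! (length p - 1))"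
        by (intro chain_anc) auto
      then show "r k \<in> anc (y n)" using ends by simp
    qed
    then show ?thesis by (simp add: stem_def)
  qed
  then show "stem y = bstem \<xi>" using stem_eqI[of m r y, OF m] ray by auto
next
  assume y: "stem y = bstem \<xi>"
  show "converges_to V E y \<xi>" unfolding converges_to_def
  proof (intro conjI ballI allI assms)
    fix r assume r: "r \<in> \<xi>"
    then have ray: "r \<in> rays" "stem r = stem y" using mem_bd_iff[OF assms] y by auto
    obtain m where m: "\<And>i. m \<le> i \<Longrightarrow> (r i, r (Suc i)) \<in> C" using ray_eventually_down[OF ray(1)] by metis
    have seg: "\<forall>\<^sub>F n in sequentially. \<exists>p. geodesic_segment E (r 0) (y n) p \<and> k < length p \<and> p ! k = r k" for k
    proof -
      define K where "K = Suc (max m k)"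
      have "r K \<in> stem y" using descending_stem[of m r K, OF m] ray by (simp add: K_def)
      then have "\<forall>\<^sub>F n in sequentially. r K \<in> anc (y n)" by (simp add: stem_def)
      then show ?thesis
      proof (rule eventually_mono)
        fix n assume "r K \<in> anc (y n)"
        then obtain d f where f: "f 0 = r K" "f d = y n" "\<forall>i<d. (f i, f (Suc i)) \<in> C"
          unfolding anc_def rtrancl_power relpow_fun_conv by auto
        define w where "w i = (if i \<le> K then r i else f (i - K))" for i
        have w_f: "w (K + i) = f i" for i using f by (simp add: w_def)
        have w0: "w 0 = r 0" by (simp add: w_def)
        have nb: "non_backtracking w (K + d)" unfolding non_backtracking_def
        proof (intro conjI allI impI)
          have down: "(w i, w (Suc i)) \<in> C" if "i \<ge> m" "i < K + d" for i
          proof (cases "i < K")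
            case True
            then show ?thesis using m that by (simp add: w_def)
          next
            case False
            then show ?thesis using f(3) w_f[of "i - K"] w_f[of "Suc (i - K)"] that by simp
          qed
          show "(w i, w (Suc i)) \<in> E" if "i < K + d" for i
          proof (cases "i < m")
            case True
            then show ?thesis using ray(1) by (auto simp: w_def K_def rays_iff)
          next
            case False
            then show ?thesis using down that C_E by simp
          qed
          show "w (Suc (Suc i)) \<noteq> w i" if "Suc i < K + d" for i
          proof (cases "i < m")
            case True
            then show ?thesis using ray(1) by (auto simp: w_def K_def rays_iff)
          next
            case False
            then have "rk (w i) < rk (w (Suc i))" "rk (w (Suc i)) < rk (w (Suc (Suc i)))"
              using down that by (auto intro!: rk_less)
            then show ?thesis by auto
          qed
        qed
        have dist: "graph_dist E (r 0) (y n) = K + d"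
          using non_backtracking_dist[OF nb] w_f[of d] w0 f(2) by simp
        define p where "p = map w [0..<Suc (K + d)]"
        have "geodesic_segment E (r 0) (y n) p"
          unfolding geodesic_segment_def
        proof (intro conjI)
          show "hd p = r 0" using w0 by (simp add: p_def hd_map del: upt_Suc)
          show "last p = y n" using w_f[of d] f(2) by (simp add: p_def)
          show "successively (\<lambda>a b. (a, b) \<in> E) p"
            using nb by (auto simp: successively_conv_nth p_def non_backtracking_def simp del: upt_Suc)
        qed (auto simp: p_def dist)
        moreover have "k < length p" "p ! k = r k"
          by (auto simp: p_def K_def w_def simp del: upt_Suc)
        ultimately show "\<exists>p. geodesic_segment E (r 0) (y n) p \<and> k < length p \<and> p ! k = r k" by blast
      qed
    qed
    then show "\<forall>\<^sub>F n in sequentially. \<exists>p. geodesic_segment E (r 0) (y n) p \<and> k < length p \<and> p ! k = r k" for k .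
    from seg[of 0] show "\<forall>\<^sub>F n in sequentially. (r 0, y n) \<in> E\<^sup>*"
    proof (rule eventually_mono)
      fix n assume "\<exists>p. geodesic_segment E (r 0) (y n) p \<and> 0 < length p \<and> p ! 0 = r 0"
      then obtain p where p: "geodesic_segment E (r 0) (y n) p" by blast
      then have "p ! 0 = r 0" "p ! (length p - 1) = y n"
        "(p ! 0, p ! (length p - 1)) \<in> E ^^ (length p - 1)"
        using geodesic_non_backtracking[OF p] unfolding relpow_fun_conv
        by (auto simp: geodesic_segment_def hd_conv_nth last_conv_nth non_backtracking_def)
      then show "(r 0, y n) \<in> E\<^sup>*" by (metis relpow_imp_rtrancl)
    qed
  qed
qed

lemma converges_iff_infinite_stem: "(\<exists>\<xi>. converges_to V E y \<xi>) \<longleftrightarrow> infinite (stem y)"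
proof
  assume "\<exists>\<xi>. converges_to V E y \<xi>"
  then obtain \<xi> where conv: "converges_to V E y \<xi>" ..
  then have "\<xi> \<in> bd" by (simp add: converges_to_def)
  then show "infinite (stem y)" using conv converges_to_iff[of \<xi> y] infinite_bstem[of \<xi>] by simp
next
  assume "infinite (stem y)"
  then obtain \<xi> where "\<xi> \<in> bd" "bstem \<xi> = stem y" by (rule infinite_stem_bd)
  then show "\<exists>\<xi>. converges_to V E y \<xi>" using converges_to_iff[of \<xi> y] by auto
qed

lemma limit_ray_stem:
  assumes "converges_to V E y \<xi>" "r \<in> \<xi>"
  shows "finite (range r - stem y)"
proof -
  have \<xi>: "\<xi> \<in> bd" using assms by (simp add: converges_to_def)
  then have r: "r \<in> rays" "stem r = stem y"
    using assms converges_to_iff[OF \<xi>] mem_bd_iff[OF \<xi>] by simp_all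
  obtain m where m: "\<And>i. m \<le> i \<Longrightarrow> (r i, r (Suc i)) \<in> C" using ray_eventually_down[OF r(1)] by metis
  have "range r - stem y \<subseteq> r ` {..<m}"
    using descending_stem[of m r, OF m] r(2) not_le by blast
  then show ?thesis using finite_subset by blast
qed


lemma anc_V: "w \<in> V \<Longrightarrow> anc w \<subseteq> V"
proof
  fix v assume "w \<in> V" "v \<in> anc w"
  then have "(v, w) \<in> C\<^sup>*" by (simp add: anc_def)
  then show "v \<in> V" using \<open>w \<in> V\<close> C_subset by (cases rule: converse_rtranclE) auto
qed

lemma stem_V:
  assumes "\<And>n. y n \<in> V"
  shows "stem y \<subseteq> V"
proof
  fix v assume "v \<in> stem y"
  then obtain n where "v \<in> anc (y n)" by (auto simp: stem_def eventually_sequentially)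
  then show "v \<in> V" using anc_V assms by blast
qed

lemma ray_V: "r \<in> rays \<Longrightarrow> r i \<in> V"
  by (simp add: geodesic_rays_def)

lemma bstem_V: "\<xi> \<in> bd \<Longrightarrow> bstem \<xi> \<subseteq> V"
proof -
  assume \<xi>: "\<xi> \<in> bd"
  obtain r where "r \<in> \<xi>" using bd_ray[OF \<xi>] ..
  then have "r \<in> rays" "stem r = bstem \<xi>" using mem_bd_iff[OF \<xi>] by simp_all
  then show "bstem \<xi> \<subseteq> V" using stem_V[of r] ray_V by simp
qed


text \<open>
  The boundary points beyond a vertex. These sets form a countable base of the topology of the boundary,
  so they generate its Borel sets.
\<close>

definition cyl :: "'v \<Rightarrow> (nat \<Rightarrow> 'v) set set" where "cyl v = {\<xi> \<in> bd. v \<in> bstem \<xi>}"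

abbreviation "vertex_seqs \<equiv> product_topology (\<lambda>_::nat. discrete_topology V) UNIV"

lemma rays_from_class:
  "r \<in> rays_from V E u \<Longrightarrow> ray_equiv V E `` {r} \<in> cyl v \<longleftrightarrow> v \<in> stem r"
  by (simp add: rays_from_def cyl_def bstem_class ray_class_bd)

lemma openin_coordinate:
  "openin vertex_seqs {s \<in> UNIV \<rightarrow>\<^sub>E V. s k = a}" if "a \<in> V"
proof -
  have "openin vertex_seqs {s \<in> topspace vertex_seqs. s k \<in> {a}}"
    by (rule openin_continuous_map_preimage[of _ "discrete_topology V"])
      (use that in \<open>auto intro: continuous_map_product_projection\<close>)
  then show ?thesis by simp
qed

text \<open>
  That \<open>v\<close> belongs to the stem of a ray is certain as soon as the ray descends from a vertex with ancestor \<open>v\<close>.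
\<close>

lemma openin_cyl: "openin (boundary_topology V E) (cyl v)"
  unfolding openin_boundary_topology
proof (intro conjI ballI)
  show "cyl v \<subseteq> bd" by (auto simp: cyl_def)
  fix u assume "u \<in> V"
  show "openin (subtopology vertex_seqs (rays_from V E u))
      {r \<in> rays_from V E u. ray_equiv V E `` {r} \<in> cyl v}"
  proof (subst openin_subopen, intro ballI)
    fix r assume "r \<in> {r \<in> rays_from V E u. ray_equiv V E `` {r} \<in> cyl v}"
    then have r: "r \<in> rays_from V E u" "v \<in> stem r" using rays_from_class by auto
    then have ray: "r \<in> rays" by (simp add: rays_from_def)
    obtain m where m: "\<And>i. m \<le> i \<Longrightarrow> (r i, r (Suc i)) \<in> C"
      using ray_eventually_down[OF ray] by metis
    obtain N where N: "\<forall>n\<ge>N. v \<in> anc (r n)"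
      using r(2) by (auto simp: stem_def eventually_sequentially)
    define k where "k = max m N"
    have k: "(r k, r (Suc k)) \<in> C" "v \<in> anc (r k)" using m[of k] N[rule_format, of k] by (simp_all add: k_def)
    \<comment> \<open>A ray that agrees with \<open>r\<close> on a descending edge has to descend from there on.\<close>
    define T :: "(nat \<Rightarrow> 'v) set" where "T = {s \<in> UNIV \<rightarrow>\<^sub>E V. s k = r k} \<inter> {s \<in> UNIV \<rightarrow>\<^sub>E V. s (Suc k) = r (Suc k)} \<inter> rays_from V E u"
    have "openin (subtopology vertex_seqs (rays_from V E u)) T"
      unfolding T_def openin_subtopology
      by (rule exI[of _ "{s \<in> UNIV \<rightarrow>\<^sub>E V. s k = r k} \<inter> {s \<in> UNIV \<rightarrow>\<^sub>E V. s (Suc k) = r (Suc k)}"])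
        (intro conjI openin_Int openin_coordinate ray_V[OF ray] refl)
    moreover have "r \<in> T" using r ray_V[OF ray] by (auto simp: T_def)
    moreover have "T \<subseteq> {r \<in> rays_from V E u. ray_equiv V E `` {r} \<in> cyl v}"
    proof
      fix s assume "s \<in> T"
      then have s: "s \<in> rays_from V E u" "s k = r k" "s (Suc k) = r (Suc k)" by (auto simp: T_def)
      then have "s \<in> rays" by (simp add: rays_from_def)
      then have "(s i, s (Suc i)) \<in> C" if "k \<le> i" for i
        using ray_down_from[of s k i] k s that by simp
      then have "s k \<in> stem s" using descending_stem[of k s k] by simp
      then have "v \<in> stem s" using stem_closed k s by simp
      then show "s \<in> {r \<in> rays_from V E u. ray_equiv V E `` {r} \<in> cyl v}"
        using s rays_from_class by simp
    qed
    ultimately show "\<exists>T. openin (subtopology vertex_seqs (rays_from V E u)) T \<and> r \<in> T \<and>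
        T \<subseteq> {r \<in> rays_from V E u. ray_equiv V E `` {r} \<in> cyl v}" by blast
  qed
qed

text \<open>
  Among the rays with the same origin, a neighbourhood of a descending ray restricts finitely many vertices
  only, and every boundary point beyond a later vertex is the end of a ray that agrees with the given one up to
  this vertex.
\<close>

lemma cyl_base:
  assumes U: "openin (boundary_topology V E) U" and "\<xi> \<in> U"
  shows "\<exists>v\<in>V. \<xi> \<in> cyl v \<and> cyl v \<subseteq> U"
proof -
  have \<xi>: "\<xi> \<in> bd" using assms unfolding openin_boundary_topology by blast
  obtain r0 where "r0 \<in> \<xi>" using bd_ray[OF \<xi>] ..
  then have r0: "stem r0 = bstem \<xi>" using mem_bd_iff[OF \<xi>] by simp
  have inf: "infinite (stem r0)" using infinite_bstem[OF \<xi>] r0 by simp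
  obtain u where "u \<in> stem r0" using stem_unbounded[OF inf] by metis
  then obtain r where r: "r 0 = u" "\<And>i. (r i, r (Suc i)) \<in> C" "\<And>i. r i \<in> stem r0"
    using stem_descending_ray[OF inf] by metis
  have ray: "r \<in> rays" by (rule descending_ray) (rule r)
  have stem_r: "stem r = bstem \<xi>" using stem_eqI[of 0 r r0] r r0 by simp
  have u: "u \<in> V" using ray_V[OF ray, of 0] r by simp
  let ?R = "{s \<in> rays_from V E u. ray_equiv V E `` {s} \<in> U}"
  have "openin (subtopology vertex_seqs (rays_from V E u)) ?R"
    using U u unfolding openin_boundary_topology by blast
  then obtain W where W: "openin vertex_seqs W" "?R = W \<inter> rays_from V E u"
    unfolding openin_subtopology by auto
  have "r \<in> ?R" using ray r class_eq[OF \<xi> ray stem_r] \<open>\<xi> \<in> U\<close> by (simp add: rays_from_def)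
  then have "r \<in> W" using W by blast
  then obtain X where X: "finite {i. X i \<noteq> V}" "r \<in> Pi\<^sub>E UNIV X" "Pi\<^sub>E UNIV X \<subseteq> W"
    using W(1) unfolding openin_product_topology_alt by (auto )
  obtain K where K: "\<And>i. X i \<noteq> V \<Longrightarrow> i \<le> K" using X(1) finite_nat_set_iff_bounded_le by auto
  have "cyl (r K) \<subseteq> U"
  proof
    fix \<eta> assume "\<eta> \<in> cyl (r K)"
    then have \<eta>: "\<eta> \<in> bd" "r K \<in> bstem \<eta>" by (auto simp: cyl_def)
    obtain s0 where "s0 \<in> \<eta>" using bd_ray[OF \<eta>(1)] ..
    then have s0: "stem s0 = bstem \<eta>" using mem_bd_iff[OF \<eta>(1)] by simp
    have inf': "infinite (stem s0)" using infinite_bstem[OF \<eta>(1)] s0 by simp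
    obtain t where t: "t 0 = r K" "\<And>i. (t i, t (Suc i)) \<in> C" "\<And>i. t i \<in> stem s0"
      using stem_descending_ray[OF inf', of "r K"] \<eta>(2) s0 by metis
    define s where "s i = (if i \<le> K then r i else t (i - K))" for i
    have sC: "(s i, s (Suc i)) \<in> C" for i
    proof -
      consider "i < K" | "i = K" | "i > K" by linarith
      then show ?thesis
      proof cases
        case 2
        then show ?thesis using t(2)[of 0] t(1) by (simp add: s_def)
      next
        case 3
        then show ?thesis using t(2)[of "i - K"] by (simp add: s_def Suc_diff_le)
      qed (simp add: s_def r)
    qed
    then have s: "s \<in> rays" by (rule descending_ray)
    have "s k \<in> stem s0" if "K \<le> k" for k
      using t(3)[of "k - K"] t(1) that by (auto simp: s_def)
    then have stem_s: "stem s = bstem \<eta>" using stem_eqI[of K s s0] sC s0 by simp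
    have "s i \<in> X i" for i
    proof (cases "i \<le> K")
      case True
      then show ?thesis using X(2) by (auto simp: s_def)
    next
      case False
      then show ?thesis using K[of i] ray_V[OF s, of i] by auto
    qed
    then have "s \<in> W" using X(3) by (auto simp: PiE_def extensional_def)
    moreover have "s \<in> rays_from V E u" using s r by (simp add: rays_from_def s_def)
    ultimately have "ray_equiv V E `` {s} \<in> U" using W(2) by blast
    then show "\<eta> \<in> U" using class_eq[OF \<eta>(1) s stem_s] by simp
  qed
  moreover have "\<xi> \<in> cyl (r K)" using \<xi> r(3) r0 by (simp add: cyl_def)
  ultimately show ?thesis using ray_V[OF ray] by blast
qed

abbreviation "BB \<equiv> boundary_borel V E"

lemma opens_subset: "{U. openin (boundary_topology V E) U} \<subseteq> Pow bd"
  by (auto simp: openin_boundary_topology)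

lemma space_BB [simp]: "space BB = bd"
  unfolding boundary_borel_def by (simp add: space_measure_of[OF opens_subset])

lemma cyl_sets [measurable]: "cyl v \<in> sets BB"
  unfolding boundary_borel_def using openin_cyl by (simp add: sets_measure_of[OF opens_subset])

lemma measurable_boundaryI:
  assumes V: "countable V" and f: "\<And>x. x \<in> space M \<Longrightarrow> f x \<in> bd"
    and cyl: "\<And>v. v \<in> V \<Longrightarrow> {x \<in> space M. v \<in> bstem (f x)} \<in> sets M"
  shows "f \<in> M \<rightarrow>\<^sub>M BB"
  unfolding boundary_borel_def
proof (rule measurable_measure_of[OF opens_subset])
  show "f \<in> space M \<rightarrow> bd" using f by auto
  fix U assume "U \<in> {U. openin (boundary_topology V E) U}"
  then have U: "openin (boundary_topology V E) U" by simp
  have "f -` U \<inter> space M = (\<Union>v\<in>{v \<in> V. cyl v \<subseteq> U}. {x \<in> space M. v \<in> bstem (f x)})"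
    using cyl_base[OF U] f by (auto simp: cyl_def) blast+
  also have "\<dots> \<in> sets M"
    by (rule sets.countable_UN') (use V cyl in \<open>auto intro: countable_subset\<close>)
  finally show "f -` U \<inter> space M \<in> sets M" .
qed

end

section \<open>Random walks and exit probabilities\<close>

context sequence_space begin

text \<open>
  The events that depend on the first \<open>n\<close> coordinates only.
\<close>

definition determined_by :: "nat \<Rightarrow> (nat \<Rightarrow> 'a) set \<Rightarrow> bool" where
  "determined_by n C \<longleftrightarrow> C \<in> sets S \<and>
     (\<forall>\<omega>\<in>space S. \<forall>\<omega>'\<in>space S. (\<forall>i<n. \<omega> i = \<omega>' i) \<longrightarrow> (\<omega> \<in> C \<longleftrightarrow> \<omega>' \<in> C))"

lemma determined_byD:
  assumes "determined_by n C" "\<omega> \<in> space S" "\<omega>' \<in> space S" "\<And>i. i < n \<Longrightarrow> \<omega> i = \<omega>' i"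
  shows "\<omega> \<in> C \<longleftrightarrow> \<omega>' \<in> C"
  by (rule bspec[OF bspec[OF conjunct2[OF assms(1)[unfolded determined_by_def]] assms(2)] assms(3), THEN mp])
    (intro allI impI assms(4))

lemma determined_by_sets: "determined_by n C \<Longrightarrow> C \<in> sets S"
  by (simp add: determined_by_def)

lemma determined_byI:
  assumes "C \<in> sets S"
    "\<And>\<omega> \<omega>'. \<omega> \<in> space S \<Longrightarrow> \<omega>' \<in> space S \<Longrightarrow> (\<And>i. i < n \<Longrightarrow> \<omega> i = \<omega>' i) \<Longrightarrow> \<omega> \<in> C \<longleftrightarrow> \<omega>' \<in> C"
  shows "determined_by n C"
  unfolding determined_by_def using assms by (intro conjI ballI impI) blast+

lemma determined_by_mono: "determined_by n C \<Longrightarrow> n \<le> m \<Longrightarrow> determined_by m C"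
proof (rule determined_byI)
  assume D: "determined_by n C" and "n \<le> m"
  show "C \<in> sets S" by (rule determined_by_sets[OF D])
  fix \<omega> \<omega>' assume "\<omega> \<in> space S" "\<omega>' \<in> space S" "\<And>i. i < m \<Longrightarrow> \<omega> i = \<omega>' i"
  then show "\<omega> \<in> C \<longleftrightarrow> \<omega>' \<in> C"
    by (intro determined_byD[OF D]) (use \<open>n \<le> m\<close> in auto)
qed

lemma determined_by_UN:
  assumes "\<And>i. i < (N::nat) \<Longrightarrow> determined_by (n i) (C i)"
  shows "\<exists>m. determined_by m (\<Union>i<N. C i)"
proof -
  obtain m where m: "\<And>i. i < N \<Longrightarrow> n i \<le> m"
    using finite_nat_set_iff_bounded_le[of "n ` {..<N}"] by auto
  have d: "determined_by m (C i)" if "i < N" for i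
    by (rule determined_by_mono[OF assms[OF that] m[OF that]])
  have "determined_by m (\<Union>i<N. C i)"
  proof (rule determined_byI)
    show "(\<Union>i<N. C i) \<in> sets S" using determined_by_sets[OF d] by (intro sets.finite_UN) auto
    fix \<omega> \<omega>' assume "\<omega> \<in> space S" "\<omega>' \<in> space S" "\<And>i. i < m \<Longrightarrow> \<omega> i = \<omega>' i"
    then have "\<omega> \<in> C i \<longleftrightarrow> \<omega>' \<in> C i" if "i < N" for i by (intro determined_byD[OF d[OF that]])
    then show "\<omega> \<in> (\<Union>i<N. C i) \<longleftrightarrow> \<omega>' \<in> (\<Union>i<N. C i)" by auto
  qed
  then show ?thesis ..
qed

text \<open>
  The events that have such approximations form a \<open>\<sigma>\<close>-algebra: a countable union is approximated by a finite one, to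
  which finitely many approximations are united.
\<close>

lemma determined_approximation:
  assumes "B \<in> sets S" "0 < e"
  shows "\<exists>n C. determined_by n C \<and> measure S ((B - C) \<union> (C - B)) < e"
proof -
  let ?\<Omega> = "\<Pi>\<^sub>E i\<in>(UNIV :: nat set). space M"
  have \<Omega>: "?\<Omega> = space S" by (simp add: space_PiM)
  let ?gen = "{{f \<in> ?\<Omega>. f i \<in> A} | i A. i \<in> (UNIV :: nat set) \<and> A \<in> sets M}"
  have gen: "sets S = sigma_sets ?\<Omega> ?gen" by (rule sets_PiM_single)
  have "B \<in> sigma_sets ?\<Omega> ?gen" using assms(1) gen by simp
  then show ?thesis using assms(2)
  proof (induction arbitrary: e rule: sigma_sets.induct)
    case (Basic a)
    then obtain i A where a: "a = {f \<in> ?\<Omega>. f i \<in> A}" "A \<in> sets M" by blast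
    have "a \<in> sets S" unfolding gen using a by (intro sigma_sets.Basic) blast
    then have "determined_by (Suc i) a"
      by (rule determined_byI) (simp add: a \<Omega>)
    then show ?case using Basic.prems by (intro exI[of _ "Suc i"] exI[of _ a]) simp
  next
    case Empty
    then show ?case by (intro exI[of _ 0] exI[of _ "{}"]) (simp add: determined_by_def)
  next
    case (Compl a)
    obtain n C where C: "determined_by n C" "measure S ((a - C) \<union> (C - a)) < e"
      using Compl.IH[OF Compl.prems] by blast
    have "a \<subseteq> space S" using sets.sets_into_space[of a S] Compl.hyps gen by simp
    moreover have "C \<subseteq> space S" using sets.sets_into_space[OF determined_by_sets[OF C(1)]] .
    ultimately have "((space S - a) - (space S - C)) \<union> ((space S - C) - (space S - a)) = (a - C) \<union> (C - a)"
      by blast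
    moreover have "determined_by n (space S - C)"
    proof (rule determined_byI)
      show "space S - C \<in> sets S" using determined_by_sets[OF C(1)] by auto
      fix \<omega> \<omega>' assume "\<omega> \<in> space S" "\<omega>' \<in> space S" "\<And>i. i < n \<Longrightarrow> \<omega> i = \<omega>' i"
      then show "\<omega> \<in> space S - C \<longleftrightarrow> \<omega>' \<in> space S - C" using determined_byD[OF C(1), of \<omega> \<omega>'] by simp
    qed
    ultimately show ?case using C(2) unfolding \<Omega> by (intro exI[of _ n] exI[of _ "space S - C"]) simp
  next
    case (Union a)
    have a: "a i \<in> sets S" for i using Union.hyps gen by simp
    have "(\<lambda>N. measure S (\<Union>i<N. a i)) \<longlonglongrightarrow> measure S (\<Union>N. \<Union>i<N. a i)"
      by (rule finite_Lim_measure_incseq) (use a in \<open>auto simp: incseq_def intro!: sets.finite_UN\<close>, meson lessThan_iff less_le_trans)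
    moreover have "(\<Union>N. \<Union>i<N. a i) = (\<Union>i. a i)" by auto
    ultimately have "\<forall>\<^sub>F N in sequentially. measure S (\<Union>i. a i) - e / 2 < measure S (\<Union>i<N. a i)"
      using Union.prems by (intro order_tendstoD) auto
    then obtain N where N: "measure S (\<Union>i. a i) - e / 2 < measure S (\<Union>i<N. a i)"
      by (auto simp: eventually_sequentially)
    have tail: "measure S ((\<Union>i. a i) - (\<Union>i<N. a i)) < e / 2"
      using N a by (subst finite_measure_Diff) (auto intro!: sets.finite_UN)
    define d where "d = e / 2 / (real N + 1)"
    have d: "d > 0" using Union.prems by (simp add: d_def)
    have "\<forall>i. \<exists>n C. determined_by n C \<and> measure S ((a i - C) \<union> (C - a i)) < d"
      using Union.IH d by blast
    then obtain n C where C: "\<And>i. determined_by (n i) (C i)"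
      "\<And>i. measure S ((a i - C i) \<union> (C i - a i)) < d" by metis
    have C_sets: "C i \<in> sets S" for i using C(1) by (simp add: determined_by_def)
    let ?C = "\<Union>i<N. C i" and ?A = "\<Union>i. a i"
    obtain m where "determined_by m ?C" using determined_by_UN[of N n C] C(1) by auto
    moreover have "measure S ((?A - ?C) \<union> (?C - ?A)) < e"
    proof -
      have "measure S ((?A - ?C) \<union> (?C - ?A))
          \<le> measure S ((?A - (\<Union>i<N. a i)) \<union> (\<Union>i<N. (a i - C i) \<union> (C i - a i)))"
        by (rule finite_measure_mono) (use a C_sets in \<open>auto intro!: sets.Un sets.Diff sets.finite_UN\<close>)
      also have "\<dots> \<le> measure S (?A - (\<Union>i<N. a i)) + measure S (\<Union>i<N. (a i - C i) \<union> (C i - a i))"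
        by (rule measure_Un_le) (use a C_sets in \<open>auto intro!: sets.Un sets.Diff sets.finite_UN\<close>)
      also have "measure S (\<Union>i<N. (a i - C i) \<union> (C i - a i)) \<le> (\<Sum>i<N. measure S ((a i - C i) \<union> (C i - a i)))"
        by (rule finite_measure_subadditive_finite) (use a C_sets in auto)
      also have "\<dots> \<le> (\<Sum>i<N. d)" by (intro sum_mono less_imp_le C(2))
      also have "\<dots> = real N * d" by simp
      also have "\<dots> \<le> e / 2" using Union.prems by (simp add: d_def field_simps)
      finally show ?thesis using tail by simp
    qed
    ultimately show ?case by blast
  qed
qed

end


locale random_walk = group G for G :: "('a, 'b) monoid_scheme" (structure) +
  fixes \<mu> :: "'a pmf"
  assumes countable_carrier: "countable (carrier G)"
    and step_in_group: "pmf_on_group G \<mu>"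
begin

abbreviation "step \<equiv> restrict_space (measure_pmf \<mu>) (carrier G)"
abbreviation "PS \<equiv> path_space G"
abbreviation "P g \<equiv> path_measure G \<mu> g"

lemma sets_step: "sets step = Pow (carrier G)"
  by (auto simp: sets_restrict_space)

lemma space_step: "space step = carrier G"
  by (simp add: space_restrict_space)

lemma prob_space_step: "prob_space step"
proof (rule prob_space_restrict_space)
  have "emeasure \<mu> (set_pmf \<mu>) = 1" using measure_pmf.emeasure_eq_1_AE[of "set_pmf \<mu>" \<mu>] by (simp add: AE_measure_pmf)
  then show "emeasure \<mu> (carrier G) = 1"
    using step_in_group unfolding pmf_on_group_def
    by (metis emeasure_mono measure_pmf.emeasure_le_1 order_antisym sets_measure_pmf UNIV_I)
qed simp

end

sublocale random_walk \<subseteq> inc: sequence_space step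
proof -
  interpret prob_space step by (rule prob_space_step)
  show "sequence_space step" by unfold_locales
qed

context random_walk begin

abbreviation "W \<equiv> increments G \<mu>"

lemma W_eq: "W = inc.S"
  by (simp add: increments_def)

lemma prob_space_W: "prob_space W"
  unfolding W_eq by unfold_locales

lemma space_W: "space W = {x. \<forall>i. x i \<in> carrier G}"
  by (auto simp: increments_def space_PiM space_step)

lemma space_PS: "space PS = {y. \<forall>i. y i \<in> carrier G}"
  by (auto simp: path_space_def space_PiM)

lemma measurable_letter: "(\<lambda>x. x n) \<in> W \<rightarrow>\<^sub>M count_space (carrier G)"
proof -
  have "(\<lambda>x. x n) \<in> W \<rightarrow>\<^sub>M step" unfolding W_eq by measurable
  then show ?thesis using measurable_cong_sets[of W W step "count_space (carrier G)"] by (simp add: sets_step)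
qed

lemma measurable_position: "(\<lambda>y. y n) \<in> PS \<rightarrow>\<^sub>M count_space (carrier G)"
  unfolding path_space_def by measurable

lemma measurable_mult:
  assumes "f \<in> N \<rightarrow>\<^sub>M count_space (carrier G)" "h \<in> N \<rightarrow>\<^sub>M count_space (carrier G)"
  shows "(\<lambda>x. f x \<otimes> h x) \<in> N \<rightarrow>\<^sub>M count_space (carrier G)"
proof -
  have "(\<lambda>x. (f x, h x)) \<in> N \<rightarrow>\<^sub>M count_space (carrier G) \<Otimes>\<^sub>M count_space (carrier G)"
    using assms by measurable
  then have "(\<lambda>x. (f x, h x)) \<in> N \<rightarrow>\<^sub>M count_space (carrier G \<times> carrier G)"
    by (simp add: pair_measure_countable countable_carrier)
  moreover have "(\<lambda>(a, b). a \<otimes> b) \<in> count_space (carrier G \<times> carrier G) \<rightarrow>\<^sub>M count_space (carrier G)"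
    by auto
  ultimately have "(\<lambda>x. (\<lambda>(a, b). a \<otimes> b) (f x, h x)) \<in> N \<rightarrow>\<^sub>M count_space (carrier G)"
    by (rule measurable_compose)
  then show ?thesis by simp
qed

lemma measurable_PS_iff:
  "f \<in> N \<rightarrow>\<^sub>M PS \<longleftrightarrow> (\<forall>n. (\<lambda>x. f x n) \<in> N \<rightarrow>\<^sub>M count_space (carrier G))"
proof (intro iffI allI)
  fix n assume "f \<in> N \<rightarrow>\<^sub>M PS"
  then show "(\<lambda>x. f x n) \<in> N \<rightarrow>\<^sub>M count_space (carrier G)" by (rule measurable_compose[OF _ measurable_position])
next
  assume "\<forall>n. (\<lambda>x. f x n) \<in> N \<rightarrow>\<^sub>M count_space (carrier G)"
  then show "f \<in> N \<rightarrow>\<^sub>M PS" unfolding path_space_def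
    using measurable_space[of "\<lambda>x. f x n" N "count_space (carrier G)" for n]
    by (intro measurable_PiM_single') auto
qed

lemma measurable_walk [measurable]:
  assumes "g \<in> carrier G"
  shows "walk G g \<in> W \<rightarrow>\<^sub>M PS"
  unfolding measurable_PS_iff
proof
  fix n
  show "(\<lambda>x. walk G g x n) \<in> W \<rightarrow>\<^sub>M count_space (carrier G)"
  proof (induction n)
    case 0
    then show ?case using assms by simp
  next
    case (Suc n)
    then show ?case using measurable_mult[OF Suc measurable_letter[of n]] by simp
  qed
qed

lemma measurable_path_shift: "(\<lambda>y k. y (n + k)) \<in> PS \<rightarrow>\<^sub>M PS"
  unfolding measurable_PS_iff using measurable_position by auto

lemma sets_P [simp]: "sets (P g) = sets PS"
  by (simp add: path_measure_def)

lemma space_P [simp]: "space (P g) = space PS"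
  by (simp add: path_measure_def)

lemma prob_space_P: "g \<in> carrier G \<Longrightarrow> prob_space (P g)"
  unfolding path_measure_def by (rule prob_space.prob_space_distr[OF prob_space_W measurable_walk])

lemma walk_event:
  "g \<in> carrier G \<Longrightarrow> A \<in> sets PS \<Longrightarrow> {x \<in> space W. walk G g x \<in> A} \<in> sets W"
  using measurable_sets[OF measurable_walk] by (simp add: vimage_def Int_def conj_commute)

lemma emeasure_P:
  "g \<in> carrier G \<Longrightarrow> A \<in> sets PS \<Longrightarrow> emeasure (P g) A = emeasure W {x \<in> space W. walk G g x \<in> A}"
  unfolding path_measure_def using emeasure_distr[OF measurable_walk] by (simp add: vimage_def Int_def conj_commute)

lemma AE_P:
  "g \<in> carrier G \<Longrightarrow> {y \<in> space PS. Q y} \<in> sets PS \<Longrightarrow> (AE y in P g. Q y) \<longleftrightarrow> (AE x in W. Q (walk G g x))"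
  unfolding path_measure_def by (rule AE_distr_iff[OF measurable_walk])

lemma AE_W_of_P: "g \<in> carrier G \<Longrightarrow> (AE y in P g. Q y) \<Longrightarrow> (AE x in W. Q (walk G g x))"
  unfolding path_measure_def by (rule AE_distrD[OF measurable_walk])

lemma walk_closed: "g \<in> carrier G \<Longrightarrow> x \<in> space W \<Longrightarrow> walk G g x n \<in> carrier G"
  by (induction n) (auto simp: space_W)

lemma walk_add: "walk G g x (n + k) = walk G (walk G g x n) (\<lambda>i. x (n + i)) k"
  by (induction k) auto

lemma walk_cong: "(\<And>i. i < n \<Longrightarrow> x i = x' i) \<Longrightarrow> walk G g x n = walk G g x' n"
  by (induction n) auto

lemma walk_comb_seq:
  "(\<lambda>k. walk G g (comb_seq n \<omega> \<omega>') (n + k)) = walk G (walk G g \<omega> n) \<omega>'"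
proof
  fix k
  have "walk G g (comb_seq n \<omega> \<omega>') n = walk G g \<omega> n" by (rule walk_cong) (simp add: comb_seq_def)
  then show "walk G g (comb_seq n \<omega> \<omega>') (n + k) = walk G (walk G g \<omega> n) \<omega>' k"
    by (simp add: walk_add comb_seq_def)
qed

text \<open>
  Splice two independent sequences of steps at time \<open>n\<close>: the event \<open>C\<close> depends on the first sequence, and
  given it, the walk after time \<open>n\<close> is a walk from its current position that is driven by the second one.
\<close>

lemma markov_property:
  assumes g: "g \<in> carrier G" and C: "inc.determined_by n C" and A: "A \<in> sets PS"
  shows "emeasure W {x \<in> C. (\<lambda>k. walk G g x (n + k)) \<in> A}
    = (\<integral>\<^sup>+ x. indicator C x * emeasure (P (walk G g x n)) A \<partial>W)"
proof -
  have Cs: "C \<in> sets W" using inc.determined_by_sets[OF C] by (simp add: W_eq)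
  let ?X = "{x \<in> C. (\<lambda>k. walk G g x (n + k)) \<in> A}"
  have "?X = C \<inter> ((\<lambda>x k. walk G g x (n + k)) -` A \<inter> space W)"
    using sets.sets_into_space[OF Cs] by auto
  also have "(\<lambda>x k. walk G g x (n + k)) \<in> W \<rightarrow>\<^sub>M PS"
    using measurable_compose[OF measurable_walk[OF g] measurable_path_shift] .
  then have "C \<inter> ((\<lambda>x k. walk G g x (n + k)) -` A \<inter> space W) \<in> sets W"
    using Cs A by (intro sets.Int measurable_sets)
  finally have X: "?X \<in> sets W" .
  let ?f = "\<lambda>(\<omega>, \<omega>'). comb_seq n \<omega> \<omega>'"
  have meas: "?f \<in> W \<Otimes>\<^sub>M W \<rightarrow>\<^sub>M W" unfolding W_eq by (rule measurable_comb_seq)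
  interpret WW: prob_space W by (rule prob_space_W)
  have "emeasure W ?X = emeasure (distr (W \<Otimes>\<^sub>M W) W ?f) ?X"
    unfolding W_eq inc.PiM_comb_seq ..
  also have "\<dots> = emeasure (W \<Otimes>\<^sub>M W) (?f -` ?X \<inter> space (W \<Otimes>\<^sub>M W))"
    by (rule emeasure_distr[OF meas X])
  also have "\<dots> = (\<integral>\<^sup>+ \<omega>. emeasure W (Pair \<omega> -` (?f -` ?X \<inter> space (W \<Otimes>\<^sub>M W))) \<partial>W)"
    by (rule WW.emeasure_pair_measure_alt) (rule measurable_sets[OF meas X])
  also have "\<dots> = (\<integral>\<^sup>+ \<omega>. indicator C \<omega> * emeasure (P (walk G g \<omega> n)) A \<partial>W)"
  proof (rule nn_integral_cong)
    fix \<omega> assume \<omega>: "\<omega> \<in> space W"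
    have "comb_seq n \<omega> \<omega>' \<in> C \<longleftrightarrow> \<omega> \<in> C" if "\<omega>' \<in> space W" for \<omega>'
    proof -
      have "comb_seq n \<omega> \<omega>' \<in> space W" using \<omega> that by (simp add: space_W comb_seq_def)
      then show ?thesis
        using inc.determined_byD[OF C, folded W_eq, of "comb_seq n \<omega> \<omega>'" \<omega>] \<omega> by (simp add: comb_seq_def)
    qed
    then have "Pair \<omega> -` (?f -` ?X \<inter> space (W \<Otimes>\<^sub>M W)) =
        (if \<omega> \<in> C then {\<omega>' \<in> space W. walk G (walk G g \<omega> n) \<omega>' \<in> A} else {})"
      using \<omega> by (auto simp: space_pair_measure walk_comb_seq)
    then show "emeasure W (Pair \<omega> -` (?f -` ?X \<inter> space (W \<Otimes>\<^sub>M W)))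
        = indicator C \<omega> * emeasure (P (walk G g \<omega> n)) A"
      using walk_closed[OF g \<omega>] A by (simp add: emeasure_P)
  qed
  finally show ?thesis .
qed

lemma almost_all_pathsI:
  assumes "{y \<in> space PS. Q y} \<in> sets PS" "\<And>g. g \<in> carrier G \<Longrightarrow> AE x in W. Q (walk G g x)"
  shows "almost_all_paths G \<mu> Q"
  using assms AE_P unfolding almost_all_paths_def by blast

lemma almost_all_paths_mono:
  assumes "almost_all_paths G \<mu> Q" "\<And>y. y \<in> space PS \<Longrightarrow> Q y \<Longrightarrow> R y"
  shows "almost_all_paths G \<mu> R"
  unfolding almost_all_paths_def
proof
  fix g assume "g \<in> carrier G"
  then have "AE y in P g. Q y" using assms(1) by (simp add: almost_all_paths_def)
  moreover have "AE y in P g. y \<in> space PS" using AE_space[of "P g"] by simp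
  ultimately show "AE y in P g. R y" by eventually_elim (rule assms(2))
qed

lemma almost_all_paths_conj:
  "almost_all_paths G \<mu> Q \<Longrightarrow> almost_all_paths G \<mu> R \<Longrightarrow> almost_all_paths G \<mu> (\<lambda>y. Q y \<and> R y)"
  unfolding almost_all_paths_def by auto

lemma almost_all_paths_all_countable:
  assumes "countable I" "\<And>i. i \<in> I \<Longrightarrow> almost_all_paths G \<mu> (Q i)"
  shows "almost_all_paths G \<mu> (\<lambda>y. \<forall>i\<in>I. Q i y)"
  using assms unfolding almost_all_paths_def by (auto simp: AE_ball_countable)

lemma almost_all_paths_shift:
  assumes Q: "almost_all_paths G \<mu> Q" and meas: "{y \<in> space PS. Q y} \<in> sets PS"
  shows "almost_all_paths G \<mu> (\<lambda>y. Q (\<lambda>k. y (n + k)))"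
proof (rule almost_all_pathsI)
  show "{y \<in> space PS. Q (\<lambda>k. y (n + k))} \<in> sets PS"
  proof -
    have "{y \<in> space PS. Q (\<lambda>k. y (n + k))} = (\<lambda>y k. y (n + k)) -` {y \<in> space PS. Q y} \<inter> space PS"
      by (auto simp: space_PS)
    then show ?thesis using measurable_sets[OF measurable_path_shift[of n] meas] by simp
  qed
  fix g assume g: "g \<in> carrier G"
  let ?A = "space PS - {y \<in> space PS. Q y}"
  have A: "?A \<in> sets PS" using meas by auto
  have "inc.determined_by n (space W)" by (rule inc.determined_byI) (simp_all add: W_eq)
  from markov_property[OF g this A]
  have "emeasure W {x \<in> space W. (\<lambda>k. walk G g x (n + k)) \<in> ?A}
    = (\<integral>\<^sup>+ x. indicator (space W) x * emeasure (P (walk G g x n)) ?A \<partial>W)" .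
  also have "\<dots> = (\<integral>\<^sup>+ x. 0 \<partial>W)"
  proof (rule nn_integral_cong)
    fix x assume "x \<in> space W"
    then have h: "walk G g x n \<in> carrier G" using walk_closed[OF g] by simp
    then have "AE y in P (walk G g x n). Q y" using Q by (simp add: almost_all_paths_def)
    then have "emeasure (P (walk G g x n)) ?A = 0"
      using AE_iff_measurable[of ?A "P (walk G g x n)" Q] A by auto
    then show "indicator (space W) x * emeasure (P (walk G g x n)) ?A = 0" by simp
  qed
  finally have "emeasure W {x \<in> space W. (\<lambda>k. walk G g x (n + k)) \<in> ?A} = 0" by simp
  moreover have "{x \<in> space W. (\<lambda>k. walk G g x (n + k)) \<in> ?A} \<in> sets W"
    using measurable_sets[OF measurable_compose[OF measurable_walk[OF g] measurable_path_shift[of n]] A]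
    by (simp add: vimage_def Int_def conj_commute)
  ultimately have "AE x in W. x \<notin> {x \<in> space W. (\<lambda>k. walk G g x (n + k)) \<in> ?A}"
    by (intro AE_not_in null_setsI)
  with AE_space[of W] show "AE x in W. Q (\<lambda>k. walk G g x (n + k))"
  proof eventually_elim
    case (elim x)
    have "(\<lambda>k. walk G g x (n + k)) \<in> space PS" using walk_closed[OF g elim(1)] by (simp add: space_PS)
    then show ?case using elim by simp
  qed
qed

lemma exit_sets_sets: "A \<in> exit_sets G \<mu> \<Longrightarrow> A \<in> sets PS"
  by (simp add: exit_sets_def)

text \<open>
  Invariance under one step holds almost surely from every starting point, so it also holds from the
  random position at time \<open>n\<close>.
\<close>

lemma exit_set_shift:
  assumes A: "A \<in> exit_sets G \<mu>"
  shows "almost_all_paths G \<mu> (\<lambda>y. (\<lambda>k. y (n + k)) \<in> A \<longleftrightarrow> y \<in> A)"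
proof (induction n)
  case 0
  show ?case by (simp add: almost_all_paths_def)
next
  case (Suc n)
  let ?Q = "\<lambda>y. path_shift y \<in> A \<longleftrightarrow> y \<in> A"
  have As: "A \<in> sets PS" using A by (rule exit_sets_sets)
  have sh: "path_shift \<in> PS \<rightarrow>\<^sub>M PS" using measurable_path_shift[of 1] by (simp add: path_shift_def[abs_def])
  have "path_shift -` A \<inter> space PS \<in> sets PS" using measurable_sets[OF sh As] .
  moreover have "{y \<in> space PS. ?Q y} = space PS - (((path_shift -` A \<inter> space PS) - A) \<union> (A - (path_shift -` A \<inter> space PS)))"
    using sets.sets_into_space[OF As] by auto
  ultimately have "{y \<in> space PS. ?Q y} \<in> sets PS" using As by auto
  moreover have "almost_all_paths G \<mu> ?Q" using A by (simp add: exit_sets_def)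
  ultimately have "almost_all_paths G \<mu> (\<lambda>y. ?Q (\<lambda>k. y (n + k)))" by (rule almost_all_paths_shift[rotated])
  from almost_all_paths_conj[OF this Suc] show ?case
    by (rule almost_all_paths_mono) (auto simp: path_shift_def)
qed


definition exit_prob :: "(nat \<Rightarrow> 'a) set \<Rightarrow> 'a \<Rightarrow> real" where
  "exit_prob A g = measure (P g) A"

lemma emeasure_P_exit_prob: "g \<in> carrier G \<Longrightarrow> emeasure (P g) A = ennreal (exit_prob A g)"
proof -
  assume "g \<in> carrier G"
  then interpret prob_space "P g" by (rule prob_space_P)
  show ?thesis by (simp add: exit_prob_def emeasure_eq_measure)
qed

text \<open>
  The walk up to time \<open>n\<close> takes only countably many values, so every predicate \<open>R\<close> of it gives an event.
  To be a function on all times it is continued by a constant.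
\<close>

lemma determined_position:
  assumes g: "g \<in> carrier G" and C: "inc.determined_by n C" and "m \<le> n"
  shows "inc.determined_by n {x \<in> C. R (\<lambda>j. if j \<le> n then walk G g x j else g)}"
proof (rule inc.determined_byI)
  have Cs: "C \<in> sets W" using inc.determined_by_sets[OF C] by (simp add: W_eq)
  let ?f = "\<lambda>x j. if j \<le> n then walk G g x j else g"
  let ?Z = "PiE {..n} (\<lambda>_. carrier G)"
  have pos: "{x \<in> space W. walk G g x j = a} \<in> sets W" for j a
  proof (cases "a \<in> carrier G")
    case True
    have "(\<lambda>x. walk G g x j) \<in> W \<rightarrow>\<^sub>M count_space (carrier G)"
      using measurable_compose[OF measurable_walk[OF g] measurable_position] .
    from measurable_sets[OF this, of "{a}"] True show ?thesis by (simp add: vimage_def Int_def conj_commute)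
  next
    case False
    then have none: "{x \<in> space W. walk G g x j = a} = {}" using walk_closed[OF g] by auto
    show ?thesis unfolding none by simp
  qed
  have eq: "{x \<in> C. R (?f x)} = C \<inter> (\<Union>z\<in>{z \<in> ?Z. R (\<lambda>j. if j \<le> n then z j else g)}.
      {x \<in> space W. \<forall>j\<in>{..n}. walk G g x j = z j})" (is "?L = ?R")
  proof (intro equalityI subsetI)
    fix x assume x: "x \<in> ?L"
    then have xs: "x \<in> space W" using sets.sets_into_space[OF Cs] by auto
    define z where "z = restrict (walk G g x) {..n}"
    have "(\<lambda>j. if j \<le> n then z j else g) = ?f x" by (auto simp: z_def)
    moreover have "z \<in> ?Z" using walk_closed[OF g xs] by (auto simp: z_def)
    ultimately have "z \<in> {z \<in> ?Z. R (\<lambda>j. if j \<le> n then z j else g)}" using x by simp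
    moreover have "x \<in> {x \<in> space W. \<forall>j\<in>{..n}. walk G g x j = z j}" using xs by (simp add: z_def)
    ultimately show "x \<in> ?R" using x by blast
  next
    fix x assume "x \<in> ?R"
    then obtain z where z: "R (\<lambda>j. if j \<le> n then z j else g)" "\<forall>j\<in>{..n}. walk G g x j = z j" "x \<in> C" by auto
    have "(\<lambda>j. if j \<le> n then z j else g) = ?f x" using z(2) by auto
    then show "x \<in> ?L" using z by simp
  qed
  have "countable ?Z" by (intro countable_PiE countable_carrier) auto
  then have "?R \<in> sets W"
    by (intro sets.Int Cs sets.countable_UN') (auto intro: countable_subset sets.sets_Collect_finite_All pos)
  then show "{x \<in> C. R (?f x)} \<in> sets inc.S" unfolding eq W_eq .
  fix \<omega> \<omega>' assume w: "\<omega> \<in> space inc.S" "\<omega>' \<in> space inc.S" "\<And>i. i < n \<Longrightarrow> \<omega> i = \<omega>' i"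
  have "?f \<omega> = ?f \<omega>'" using walk_cong[of _ \<omega> \<omega>' g] w(3) by (intro ext) auto
  moreover have "\<omega> \<in> C \<longleftrightarrow> \<omega>' \<in> C" by (rule inc.determined_byD[OF C w])
  ultimately show "\<omega> \<in> {x \<in> C. R (?f x)} \<longleftrightarrow> \<omega>' \<in> {x \<in> C. R (?f x)}" by simp
qed

text \<open>
  Almost surely the walk lies in the exit set if and only if its shift by \<open>n\<close> does, so the Markov property
  turns the exit probability from the current position into a conditional probability.
\<close>

lemma exit_prob_on_determined:
  assumes g: "g \<in> carrier G" and A: "A \<in> exit_sets G \<mu>" and C: "inc.determined_by n C"
  shows "emeasure W {x \<in> C. walk G g x \<in> A} = (\<integral>\<^sup>+ x. indicator C x * ennreal (exit_prob A (walk G g x n)) \<partial>W)"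
proof -
  have Cs: "C \<in> sets W" using inc.determined_by_sets[OF C] by (simp add: W_eq)
  have As: "A \<in> sets PS" using A by (rule exit_sets_sets)
  have walkA: "{x \<in> space W. walk G g x \<in> A} \<in> sets W"
    by (rule walk_event[OF g As])
  have shA: "{x \<in> space W. (\<lambda>k. walk G g x (n + k)) \<in> A} \<in> sets W"
    using measurable_sets[OF measurable_compose[OF measurable_walk[OF g] measurable_path_shift[of n]] As]
    by (simp add: vimage_def Int_def conj_commute)
  have "AE x in W. (\<lambda>k. walk G g x (n + k)) \<in> A \<longleftrightarrow> walk G g x \<in> A"
    using AE_W_of_P[OF g] exit_set_shift[OF A, of n] g unfolding almost_all_paths_def by auto
  then have "emeasure W {x \<in> C. walk G g x \<in> A} = emeasure W {x \<in> C. (\<lambda>k. walk G g x (n + k)) \<in> A}"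
  proof (rule emeasure_eq_AE[OF AE_mp])
    show "AE x in W. ((\<lambda>k. walk G g x (n + k)) \<in> A \<longleftrightarrow> walk G g x \<in> A) \<longrightarrow>
        (x \<in> {x \<in> C. walk G g x \<in> A} \<longleftrightarrow> x \<in> {x \<in> C. (\<lambda>k. walk G g x (n + k)) \<in> A})" by auto
    have "{x \<in> C. walk G g x \<in> A} = C \<inter> {x \<in> space W. walk G g x \<in> A}"
      using sets.sets_into_space[OF Cs] by auto
    then show "{x \<in> C. walk G g x \<in> A} \<in> sets W" using Cs walkA by auto
    have "{x \<in> C. (\<lambda>k. walk G g x (n + k)) \<in> A} = C \<inter> {x \<in> space W. (\<lambda>k. walk G g x (n + k)) \<in> A}"
      using sets.sets_into_space[OF Cs] by auto
    then show "{x \<in> C. (\<lambda>k. walk G g x (n + k)) \<in> A} \<in> sets W" using Cs shA by auto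
  qed
  also have "\<dots> = (\<integral>\<^sup>+ x. indicator C x * emeasure (P (walk G g x n)) A \<partial>W)"
    by (rule markov_property[OF g C As])
  also have "\<dots> = (\<integral>\<^sup>+ x. indicator C x * ennreal (exit_prob A (walk G g x n)) \<partial>W)"
    by (intro nn_integral_cong) (simp add: emeasure_P_exit_prob walk_closed[OF g])
  finally show ?thesis .
qed

text \<open>
  On \<open>C\<close> the conditional probability of missing the exit set is at least one third.
\<close>

lemma exit_prob_low_event:
  assumes g: "g \<in> carrier G" and A: "A \<in> exit_sets G \<mu>" and C: "inc.determined_by n C"
    and low: "\<And>x. x \<in> C \<Longrightarrow> exit_prob A (walk G g x n) < 2 / 3"
  shows "measure W C \<le> 3 * measure W {x \<in> C. walk G g x \<notin> A}"
proof -
  interpret prob_space W by (rule prob_space_W)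
  have Cs: "C \<in> sets W" using inc.determined_by_sets[OF C] by (simp add: W_eq)
  have As: "A \<in> sets PS" using A by (rule exit_sets_sets)
  have walkA: "{x \<in> space W. walk G g x \<in> A} \<in> sets W"
    by (rule walk_event[OF g As])
  have eqs: "{x \<in> C. walk G g x \<in> A} = C \<inter> {x \<in> space W. walk G g x \<in> A}"
    "{x \<in> C. walk G g x \<notin> A} = C - {x \<in> space W. walk G g x \<in> A}"
    using sets.sets_into_space[OF Cs] by auto
  have "emeasure W {x \<in> C. walk G g x \<in> A} \<le> (\<integral>\<^sup>+ x. ennreal (2 / 3) * indicator C x \<partial>W)"
    unfolding exit_prob_on_determined[OF g A C]
    using low by (intro nn_integral_mono) (auto simp: indicator_def intro!: ennreal_leI less_imp_le)
  also have "\<dots> = ennreal (2 / 3) * emeasure W C" using Cs by (rule nn_integral_cmult_indicator)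
  also have "\<dots> = ennreal (2 / 3 * measure W C)" by (subst ennreal_mult) (simp_all add: emeasure_eq_measure)
  finally have "measure W {x \<in> C. walk G g x \<in> A} \<le> 2 / 3 * measure W C"
    by (simp add: emeasure_eq_measure)
  moreover have "measure W C = measure W {x \<in> C. walk G g x \<in> A} + measure W {x \<in> C. walk G g x \<notin> A}"
    unfolding eqs using finite_measure_Union[of "C \<inter> {x \<in> space W. walk G g x \<in> A}" "C - {x \<in> space W. walk G g x \<in> A}"] Cs walkA
    unfolding Int_Diff_Un by auto
  ultimately show ?thesis by simp
qed

text \<open>
  This is the maximal inequality for the martingale of exit probabilities. Approximate the event that the
  walk lies in \<open>A\<close> by an event \<open>C\<close> determined by time \<open>m\<close>, up to an error \<open>e\<close>, and split \<open>C\<close> according to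
  the first time after \<open>m\<close> at which the exit probability falls below \<open>2 / 3\<close>. Each piece misses \<open>A\<close> with
  conditional probability at least one third, while all pieces together miss \<open>A\<close> with probability at most
  \<open>e\<close>; so the pieces have total probability at most \<open>3 * e\<close>.
\<close>

lemma exit_prob_high:
  assumes A: "A \<in> exit_sets G \<mu>"
  shows "almost_all_paths G \<mu> (\<lambda>y. y \<in> A \<longrightarrow> (\<forall>\<^sub>F n in sequentially. 2 / 3 \<le> exit_prob A (y n)))"
proof (rule almost_all_pathsI)
  have As: "A \<in> sets PS" using A by (rule exit_sets_sets)
  have hm: "{y \<in> space PS. exit_prob A (y n) < 2 / 3} \<in> sets PS" for n
    using measurable_sets[OF measurable_position[of n], of "{a \<in> carrier G. exit_prob A a < 2 / 3}"]
      measurable_space[OF measurable_position[of n]]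
    by (simp add: vimage_def Int_def conj_commute cong: conj_cong)
  let ?bad = "{y \<in> space PS. \<forall>N. \<exists>n\<ge>N. exit_prob A (y n) < 2 / 3}"
  have bad: "?bad \<in> sets PS"
    using hm by (intro sets.sets_Collect_countable_All sets.sets_Collect_countable_Ex)
      (auto intro!: sets.sets_Collect_conj)
  have eq: "{y \<in> space PS. y \<in> A \<longrightarrow> (\<forall>\<^sub>F n in sequentially. 2 / 3 \<le> exit_prob A (y n))} = space PS - (A \<inter> ?bad)"
  proof -
    have "(\<forall>\<^sub>F n in sequentially. 2 / 3 \<le> f n) \<longleftrightarrow> \<not> (\<forall>N. \<exists>n\<ge>N. f n < 2 / 3)" for f :: "nat \<Rightarrow> real"
      unfolding eventually_sequentially by (meson not_le)
    then show ?thesis by auto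
  qed
  show "{y \<in> space PS. y \<in> A \<longrightarrow> (\<forall>\<^sub>F n in sequentially. 2 / 3 \<le> exit_prob A (y n))} \<in> sets PS"
    unfolding eq by (intro sets.Diff sets.Int sets.top As bad)
  fix g assume g: "g \<in> carrier G"
  interpret prob_space W by (rule prob_space_W)
  let ?B = "{x \<in> space W. walk G g x \<in> A}"
  have B: "?B \<in> sets W"
    by (rule walk_event[OF g As])
  let ?D = "{x \<in> space W. walk G g x \<in> A \<inter> ?bad}"
  have D: "?D \<in> sets W"
    by (rule walk_event[OF g]) (intro sets.Int As bad)
  have D_le: "measure W ?D \<le> 4 * e" if e: "e > 0" for e :: real
  proof -
    obtain m C where C: "inc.determined_by m C" "measure W ((?B - C) \<union> (C - ?B)) < e"
      using inc.determined_approximation[of ?B e] B e unfolding W_eq by auto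
    have Cs: "C \<in> sets W" using inc.determined_by_sets[OF C(1)] by (simp add: W_eq)
    \<comment> \<open>The first time after \<open>m\<close> at which the exit probability is low.\<close>
    define F where "F n = {x \<in> C. exit_prob A (walk G g x (m + n)) < 2 / 3 \<and>
      (\<forall>j<n. \<not> exit_prob A (walk G g x (m + j)) < 2 / 3)}" for n
    have F: "inc.determined_by (m + n) (F n)" for n
      using determined_position[OF g inc.determined_by_mono[OF C(1), of "m + n"], of 0
          "\<lambda>p. exit_prob A (p (m + n)) < 2 / 3 \<and> (\<forall>j<n. \<not> exit_prob A (p (m + j)) < 2 / 3)"]
      by (simp add: F_def)
    have Fs: "F n \<in> sets W" for n using inc.determined_by_sets[OF F] by (simp add: W_eq)
    have disj: "disjoint_family F"
    unfolding disjoint_family_on_def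
    proof (intro ballI impI)
      fix i j :: nat assume "i \<noteq> j"
      then consider "i < j" | "j < i" by linarith
      then show "F i \<inter> F j = {}" by cases (auto simp: F_def)
    qed
    let ?G = "\<lambda>n. {x \<in> F n. walk G g x \<notin> A}"
    have Gs: "?G n \<in> sets W" for n
    proof -
      have "?G n = F n - ?B" using sets.sets_into_space[OF Fs[of n]] by auto
      then show ?thesis using Fs B by auto
    qed
    have disjG: "disjoint_family ?G" using disj by (auto simp: disjoint_family_on_def)
    have sF: "(\<lambda>n. measure W (F n)) sums measure W (\<Union>n. F n)"
      by (rule finite_measure_UNION) (use Fs disj in auto)
    have sG: "(\<lambda>n. measure W (?G n)) sums measure W (\<Union>n. ?G n)"
      by (rule finite_measure_UNION) (use Gs disjG in auto)
    have "measure W (\<Union>n. F n) \<le> 3 * measure W (\<Union>n. ?G n)"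
      by (rule sums_le[OF exit_prob_low_event[OF g A F] sF sums_mult[OF sG]]) (simp add: F_def)
    also have "measure W (\<Union>n. ?G n) \<le> measure W ((?B - C) \<union> (C - ?B))"
      by (rule finite_measure_mono) (use B Cs in \<open>auto simp: F_def\<close>)
    finally have uF: "measure W (\<Union>n. F n) \<le> 3 * e" using C(2) by simp
    have "?D \<subseteq> ((?B - C) \<union> (C - ?B)) \<union> (\<Union>n. F n)"
    proof
      fix x assume x: "x \<in> ?D"
      show "x \<in> ((?B - C) \<union> (C - ?B)) \<union> (\<Union>n. F n)"
      proof (cases "x \<in> C")
        case True
        obtain n where "n \<ge> m" "exit_prob A (walk G g x n) < 2 / 3" using x by blast
        then have "\<exists>n. exit_prob A (walk G g x (m + n)) < 2 / 3" by (intro exI[of _ "n - m"]) simp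
        then have "\<exists>n. exit_prob A (walk G g x (m + n)) < 2 / 3 \<and> (\<forall>j<n. \<not> exit_prob A (walk G g x (m + j)) < 2 / 3)"
          using exists_least_iff[of "\<lambda>n. exit_prob A (walk G g x (m + n)) < 2 / 3"] by blast
        then show ?thesis using True by (auto simp: F_def)
      qed (use x in auto)
    qed
    then have "measure W ?D \<le> measure W (((?B - C) \<union> (C - ?B)) \<union> (\<Union>n. F n))"
      by (rule finite_measure_mono) (use B Cs Fs in auto)
    also have "\<dots> \<le> measure W ((?B - C) \<union> (C - ?B)) + measure W (\<Union>n. F n)"
      by (rule measure_Un_le) (use B Cs Fs in auto)
    finally show ?thesis using uF C(2) by simp
  qed
  have "measure W ?D \<le> 0"
  proof (rule field_le_epsilon)
    fix e :: real assume "e > 0"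
    then show "measure W ?D \<le> 0 + e" using D_le[of "e / 4"] by simp
  qed
  then have "?D \<in> null_sets W" using D by (intro null_setsI) (simp_all add: emeasure_eq_measure measure_le_0_iff)
  then have "AE x in W. x \<notin> ?D" by (rule AE_not_in)
  with AE_space[of W] show "AE x in W. walk G g x \<in> A \<longrightarrow> (\<forall>\<^sub>F n in sequentially. 2 / 3 \<le> exit_prob A (walk G g x n))"
  proof eventually_elim
    case (elim x)
    then have "walk G g x \<notin> A \<inter> ?bad" by simp
    moreover have "walk G g x \<in> space PS" using measurable_space[OF measurable_walk[OF g] elim(1)] .
    ultimately show ?case using eq by blast
  qed
qed

lemma exit_sets_compl:
  assumes "A \<in> exit_sets G \<mu>"
  shows "space PS - A \<in> exit_sets G \<mu>"
proof -
  have "almost_all_paths G \<mu> (\<lambda>y. path_shift y \<in> A \<longleftrightarrow> y \<in> A)" using assms by (simp add: exit_sets_def)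
  then have "almost_all_paths G \<mu> (\<lambda>y. path_shift y \<in> space PS - A \<longleftrightarrow> y \<in> space PS - A)"
    by (rule almost_all_paths_mono) (auto simp: space_PS path_shift_def)
  then show ?thesis using assms by (auto simp: exit_sets_def)
qed

text \<open>
  A form of Levy's zero-one law: any two bounds on different sides of one half would do for telling the
  paths in an exit set from the others.
\<close>

theorem exit_prob_decides:
  assumes A: "A \<in> exit_sets G \<mu>"
  shows "almost_all_paths G \<mu> (\<lambda>y.
    (y \<in> A \<longrightarrow> (\<forall>\<^sub>F n in sequentially. 2 / 3 \<le> exit_prob A (y n))) \<and>
    (y \<notin> A \<longrightarrow> (\<forall>\<^sub>F n in sequentially. exit_prob A (y n) \<le> 1 / 3)))"
proof -
  have "exit_prob (space PS - A) g = 1 - exit_prob A g" if "g \<in> carrier G" for g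
  proof -
    interpret prob_space "P g" by (rule prob_space_P[OF that])
    show ?thesis using prob_compl[of A] exit_sets_sets[OF A] by (simp add: exit_prob_def)
  qed
  then show ?thesis
    using almost_all_paths_conj[OF exit_prob_high[OF A] exit_prob_high[OF exit_sets_compl[OF A]]]
    by (elim almost_all_paths_mono) (auto simp: space_PS elim!: eventually_mono)
qed

end

section \<open>Walks that follow a forest\<close>

text \<open>
  Sets of natural numbers are coded by ternary expansions with digits 0 and 1, which are unique and can
  be read off by Borel functions.
\<close>

definition ternary_code :: "nat set \<Rightarrow> real" where
  "ternary_code N = (\<Sum>n. (if n \<in> N then 1 else 0) * (1 / 3) ^ Suc n)"

lemma ternary_digit: "\<lfloor>3 ^ Suc n * ternary_code N\<rfloor> mod 3 = 1 \<longleftrightarrow> n \<in> N"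
proof -
  define d :: "nat \<Rightarrow> int" where "d n = (if n \<in> N then 1 else 0)" for n
  define t :: "nat \<Rightarrow> real" where "t n = (\<Sum>k. of_int (d (n + k)) * (1 / 3) ^ Suc k)" for n
  have geo: "summable (\<lambda>k. (1 / 3 :: real) ^ Suc k)" "(\<Sum>k. (1 / 3 :: real) ^ Suc k) = 1 / 2"
    using sums_mult[OF geometric_sums[of "1 / 3 :: real"], of "1 / 3"]
    by (auto simp: sums_iff)
  have le: "0 \<le> of_int (d (n + k)) * (1 / 3 :: real) ^ Suc k" "of_int (d (n + k)) * (1 / 3 :: real) ^ Suc k \<le> (1 / 3) ^ Suc k" for n k
    by (auto simp: d_def)
  have sm: "summable (\<lambda>k. of_int (d (n + k)) * (1 / 3 :: real) ^ Suc k)" for n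
    by (rule summable_comparison_test'[OF geo(1), of 0]) (use le[of n] in auto)
  have t0: "0 \<le> t n" for n unfolding t_def by (rule suminf_nonneg[OF sm]) (rule le)
  have t1: "t n \<le> 1 / 2" for n
    unfolding t_def geo(2)[symmetric] by (rule suminf_le[OF _ sm geo(1)]) (rule le)
  have rec: "3 * t n = of_int (d n) + t (Suc n)" for n
  proof -
    have "t n = (\<Sum>k. of_int (d (n + Suc k)) * (1 / 3) ^ Suc (Suc k)) + of_int (d n) * (1 / 3)"
      unfolding t_def using suminf_split_head[OF sm[of n]] by simp
    also have "(\<Sum>k. of_int (d (n + Suc k)) * (1 / 3 :: real) ^ Suc (Suc k)) = (\<Sum>k. (1 / 3) * (of_int (d (Suc n + k)) * (1 / 3) ^ Suc k))"
      by (simp add: mult.assoc mult.left_commute)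
    also have "\<dots> = (1 / 3) * t (Suc n)" unfolding t_def by (rule suminf_mult[OF sm])
    finally show ?thesis by simp
  qed
  have "\<exists>I :: int. 3 ^ n * t 0 = of_int I + t n" for n
  proof (induction n)
    case 0
    then show ?case by (intro exI[of _ 0]) simp
  next
    case (Suc n)
    then obtain I :: int where "3 ^ n * t 0 = of_int I + t n" by blast
    then have "3 ^ Suc n * t 0 = of_int (3 * I + d n) + t (Suc n)" using rec[of n] by simp
    then show ?case by blast
  qed
  then obtain I :: int where "3 ^ n * t 0 = of_int I + t n" by blast
  then have *: "3 ^ Suc n * t 0 = of_int (3 * I + d n) + t (Suc n)" using rec[of n] by simp
  have "\<lfloor>3 ^ Suc n * t 0\<rfloor> = 3 * I + d n"
    unfolding * using t0[of "Suc n"] t1[of "Suc n"] by (intro floor_unique) auto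
  moreover have "ternary_code N = t 0"
    unfolding ternary_code_def t_def d_def by (intro suminf_cong) simp
  ultimately show ?thesis by (auto simp: d_def)
qed


text \<open>
  The four properties of almost all paths on which the identification of the Poisson boundary and the
  freeness of the action rest.
\<close>

locale walk_on_forest = random_walk G \<mu> + ranked_forest "carrier G" C rk
  for G :: "('a, 'b) monoid_scheme" (structure) and \<mu> C rk +
  assumes stem_infinite: "almost_all_paths G \<mu> (\<lambda>y. infinite (stem y))"
    and stem_visited: "almost_all_paths G \<mu> (\<lambda>y. finite (stem y - range y))"
    and stem_translate: "g \<in> carrier G \<Longrightarrow>
      almost_all_paths G \<mu> (\<lambda>y. infinite {w \<in> stem y. g \<otimes> w \<in> stem (path_translate G g y)})"
    and stem_moved: "g \<in> carrier G \<Longrightarrow> g \<noteq> \<one> \<Longrightarrow>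
      almost_all_paths G \<mu> (\<lambda>y. stem (path_translate G g y) \<noteq> stem y)"
begin

lemma measurable_P: "f \<in> PS \<rightarrow>\<^sub>M N \<Longrightarrow> f \<in> P h \<rightarrow>\<^sub>M N"
  unfolding measurable_cong_sets[OF sets_P refl] .

lemma paths_converge: "almost_all_paths G \<mu> (\<lambda>y. \<exists>\<xi>. converges_to (carrier G) E y \<xi>)"
  using stem_infinite by (simp add: converges_iff_infinite_stem)

lemma paths_visit_rays:
  "almost_all_paths G \<mu> (\<lambda>y. \<forall>\<xi>. converges_to (carrier G) E y \<xi> \<longrightarrow>
      (\<forall>r \<in> \<xi>. finite (range r - range y)))"
  using stem_visited
proof (rule almost_all_paths_mono, intro allI impI ballI)
  fix y \<xi> r assume fin: "finite (stem y - range y)" and conv: "converges_to (carrier G) E y \<xi>" "r \<in> \<xi>"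
  have "range r - range y \<subseteq> (range r - stem y) \<union> (stem y - range y)" by auto
  then show "finite (range r - range y)"
    by (rule finite_subset) (use limit_ray_stem[OF conv] fin in auto)
qed

text \<open>
  All but finitely many vertices of the stem are visited after time \<open>N\<close>, and ranks are injective on a stem.
\<close>

lemma stem_late:
  assumes "infinite (stem y)" "finite (stem y - range y)"
  obtains n where "\<And>v. v \<in> stem y \<Longrightarrow> n < rk v \<Longrightarrow> \<exists>i\<ge>N. v = y i"
proof -
  let ?X = "(stem y - range y) \<union> y ` {..<N}"
  have fin: "finite (rk ` ?X)" using assms(2) by auto
  define n where "n = Max (insert 0 (rk ` ?X))"
  have "\<exists>i\<ge>N. v = y i" if v: "v \<in> stem y" "n < rk v" for v
  proof -
    have "rk v \<le> n" if "v \<in> ?X" unfolding n_def by (rule Max_ge) (use fin that in auto)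
    then have "v \<notin> ?X" using v(2) by auto
    then obtain i where i: "v = y i" using v(1) by blast
    then have "\<not> i < N" using \<open>v \<notin> ?X\<close> by blast
    then show ?thesis using i by (intro exI[of _ i]) simp
  qed
  then show ?thesis using that by blast
qed

text \<open>
  The rank is unbounded on a stem, so this asks whether the exit probability is above one half infinitely
  often along the stem.
\<close>

definition stem_test :: "(nat \<Rightarrow> 'a) set \<Rightarrow> 'a set \<Rightarrow> bool" where
  "stem_test A S \<longleftrightarrow> (\<forall>n. \<exists>v\<in>carrier G. v \<in> S \<and> n < rk v \<and> 1 / 2 < exit_prob A v)"

text \<open>
  The exit probability from the current position is eventually away from one half, and the path visits almost all vertices
  of its stem, so its values on the high vertices of the stem decide.
\<close>

lemma exit_set_stem_test:
  assumes A: "A \<in> exit_sets G \<mu>"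
  shows "almost_all_paths G \<mu> (\<lambda>y. y \<in> A \<longleftrightarrow> stem_test A (stem y))"
  using almost_all_paths_conj[OF exit_prob_decides[OF A] almost_all_paths_conj[OF stem_infinite stem_visited]]
proof (rule almost_all_paths_mono, elim conjE)
  fix y assume y: "y \<in> space PS" and inf: "infinite (stem y)" and fin: "finite (stem y - range y)"
    and high: "y \<in> A \<longrightarrow> (\<forall>\<^sub>F n in sequentially. 2 / 3 \<le> exit_prob A (y n))"
    and low: "y \<notin> A \<longrightarrow> (\<forall>\<^sub>F n in sequentially. exit_prob A (y n) \<le> 1 / 3)"
  show "y \<in> A \<longleftrightarrow> stem_test A (stem y)"
  proof
    assume "y \<in> A"
    then obtain N where N: "\<forall>n\<ge>N. 2 / 3 \<le> exit_prob A (y n)" using high by (auto simp: eventually_sequentially)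
    obtain m where m: "\<And>v. v \<in> stem y \<Longrightarrow> m < rk v \<Longrightarrow> \<exists>i\<ge>N. v = y i" using stem_late[OF inf fin] by blast
    show "stem_test A (stem y)" unfolding stem_test_def
    proof
      fix n
      obtain v where v: "v \<in> stem y" "max n m < rk v" using stem_unbounded[OF inf] by blast
      then obtain i where "i \<ge> N" "v = y i" using m[of v] by auto
      then have "2 / 3 \<le> exit_prob A v" using N by simp
      moreover have "v \<in> carrier G" using \<open>v = y i\<close> y by (simp add: space_PS)
      ultimately show "\<exists>v\<in>carrier G. v \<in> stem y \<and> n < rk v \<and> 1 / 2 < exit_prob A v"
        using v by (intro bexI[of _ v]) auto
    qed
  next
    assume test: "stem_test A (stem y)"
    show "y \<in> A"
    proof (rule ccontr)
      assume "y \<notin> A"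
      then obtain N where N: "\<forall>n\<ge>N. exit_prob A (y n) \<le> 1 / 3" using low by (auto simp: eventually_sequentially)
      obtain m where m: "\<And>v. v \<in> stem y \<Longrightarrow> m < rk v \<Longrightarrow> \<exists>i\<ge>N. v = y i" using stem_late[OF inf fin] by blast
      obtain v where v: "v \<in> stem y" "m < rk v" "1 / 2 < exit_prob A v"
        using test unfolding stem_test_def by blast
      then obtain i where "i \<ge> N" "v = y i" using m[of v] by auto
      then show False using N v(3) by force
    qed
  qed
qed

text \<open>
  Measurable maps into the sets of vertices, with the \<open>\<sigma>\<close>-algebra generated by the sets that contain a
  given vertex.
\<close>

definition vertex_family :: "'x measure \<Rightarrow> ('x \<Rightarrow> 'a set) \<Rightarrow> bool" where
  "vertex_family M D \<longleftrightarrow> (\<forall>x\<in>space M. D x \<subseteq> carrier G) \<and> (\<forall>v\<in>carrier G. {x \<in> space M. v \<in> D x} \<in> sets M)"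

lemma vertex_family_mem: "vertex_family M D \<Longrightarrow> v \<in> carrier G \<Longrightarrow> {x \<in> space M. v \<in> D x} \<in> sets M"
  by (simp add: vertex_family_def)

lemma vertex_family_stem: "vertex_family PS stem"
  unfolding vertex_family_def
proof (intro conjI ballI)
  show "stem y \<subseteq> carrier G" if "y \<in> space PS" for y
    using stem_V that by (simp add: space_PS)
  fix v
  have pos: "{y \<in> space PS. v \<in> anc (y n)} \<in> sets PS" for n
    using measurable_sets[OF measurable_position[of n], of "{a \<in> carrier G. v \<in> anc a}"]
      measurable_space[OF measurable_position[of n]]
    by (simp add: vimage_def Int_def conj_commute cong: conj_cong)
  have "{y \<in> space PS. v \<in> stem y} = {y \<in> space PS. \<exists>N. \<forall>n\<in>{N..}. v \<in> anc (y n)}"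
    by (auto simp: stem_def eventually_sequentially)
  also have "\<dots> \<in> sets PS"
    by (intro sets.sets_Collect_countable_Ex sets.sets_Collect_countable_Ball pos)
  finally show "{y \<in> space PS. v \<in> stem y} \<in> sets PS" .
qed

lemma vertex_family_bstem: "vertex_family BB bstem"
  unfolding vertex_family_def using bstem_V cyl_sets by (simp add: cyl_def)

lemma sets_carrier_Ex:
  assumes "\<And>v. v \<in> carrier G \<Longrightarrow> {x \<in> space M. Q v x} \<in> sets M"
  shows "{x \<in> space M. \<exists>v\<in>carrier G. Q v x} \<in> sets M"
proof -
  have eq: "{x \<in> space M. \<exists>v\<in>carrier G. Q v x} = (\<Union>v\<in>carrier G. {x \<in> space M. Q v x})" by auto
  show ?thesis unfolding eq by (rule sets.countable_UN'[OF countable_carrier]) (use assms in auto)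
qed

lemma sets_carrier_All:
  assumes "\<And>v. v \<in> carrier G \<Longrightarrow> {x \<in> space M. Q v x} \<in> sets M"
  shows "{x \<in> space M. \<forall>v\<in>carrier G. Q v x} \<in> sets M"
proof -
  have eq: "{x \<in> space M. \<forall>v\<in>carrier G. Q v x} = {x \<in> space M. \<not> (\<exists>v\<in>carrier G. \<not> Q v x)}" by auto
  show ?thesis unfolding eq by (intro sets.sets_Collect_neg sets_carrier_Ex assms)
qed

lemma stem_test_sets:
  assumes "vertex_family M D"
  shows "{x \<in> space M. stem_test A (D x)} \<in> sets M"
  unfolding stem_test_def
  by (intro sets.sets_Collect_countable_All sets_carrier_Ex sets.sets_Collect_conj vertex_family_mem[OF assms]
      sets.sets_Collect_const)

definition end_set :: "'a set \<Rightarrow> bool" where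
  "end_set S \<longleftrightarrow> (\<exists>\<xi>\<in>bd. bstem \<xi> = S)"

text \<open>
  The countable quantifiers of this description make it measurable to have a stem that belongs to a
  boundary point.
\<close>

lemma end_set_iff:
  assumes S: "S \<subseteq> carrier G"
  shows "end_set S \<longleftrightarrow> (\<forall>n. \<exists>v\<in>carrier G. v \<in> S \<and> n < rk v) \<and>
    (\<forall>v\<in>carrier G. \<forall>u\<in>carrier G. v \<in> S \<longrightarrow> u \<in> anc v \<longrightarrow> u \<in> S) \<and>
    (\<forall>v\<in>carrier G. \<forall>u\<in>carrier G. v \<in> S \<longrightarrow> u \<in> S \<longrightarrow> u \<in> anc v \<or> v \<in> anc u)" (is "_ \<longleftrightarrow> ?R")
proof
  assume "end_set S"
  then obtain \<xi> where \<xi>: "\<xi> \<in> bd" "bstem \<xi> = S" by (auto simp: end_set_def)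
  obtain r where r: "r \<in> \<xi>" using bd_ray[OF \<xi>(1)] ..
  then have Sr: "S = stem r" using mem_bd_iff[OF \<xi>(1)] \<xi>(2) by simp
  have inf: "infinite (stem r)" using infinite_bstem[OF \<xi>(1)] \<xi>(2) Sr by simp
  have "\<exists>v\<in>carrier G. v \<in> S \<and> n < rk v" for n
    using stem_unbounded[OF inf, of n] Sr S by blast
  then show ?R using stem_closed stem_chain unfolding Sr by blast
next
  assume R: ?R
  then have "\<exists>v. v \<in> S \<and> n < rk v" for n by blast
  then obtain y where y: "\<And>n. y n \<in> S" "\<And>n. n < rk (y n)" by metis
  have "stem y = S"
  proof (intro equalityI subsetI)
    fix v assume "v \<in> stem y"
    then obtain n where n: "v \<in> anc (y n)" by (auto simp: stem_def eventually_sequentially)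
    have "y n \<in> carrier G" using y(1) S by auto
    then show "v \<in> S" using n R y(1) anc_V by blast
  next
    fix v assume v: "v \<in> S"
    have "v \<in> anc (y n)" if "rk v \<le> n" for n
    proof -
      have "v \<in> anc (y n) \<or> y n \<in> anc v" using R v y(1) S by blast
      then show ?thesis using rk_anc[of "y n" v] y(2)[of n] that by auto
    qed
    then show "v \<in> stem y" by (auto simp: stem_def eventually_sequentially)
  qed
  moreover have "infinite S"
  proof
    assume "finite S"
    then have "rk (y n) \<le> Max (rk ` S)" for n using y(1) by (intro Max_ge) auto
    from this[of "Max (rk ` S)"] y(2)[of "Max (rk ` S)"] show False by simp
  qed
  ultimately show "end_set S" unfolding end_set_def using infinite_stem_bd by metis
qed

lemma end_set_sets:
  assumes D: "vertex_family M D"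
  shows "{x \<in> space M. end_set (D x)} \<in> sets M"
proof -
  have "{x \<in> space M. end_set (D x)} = {x \<in> space M. (\<forall>n. \<exists>v\<in>carrier G. v \<in> D x \<and> n < rk v) \<and>
    (\<forall>v\<in>carrier G. \<forall>u\<in>carrier G. v \<in> D x \<longrightarrow> u \<in> anc v \<longrightarrow> u \<in> D x) \<and>
    (\<forall>v\<in>carrier G. \<forall>u\<in>carrier G. v \<in> D x \<longrightarrow> u \<in> D x \<longrightarrow> u \<in> anc v \<or> v \<in> anc u)}"
    using D unfolding vertex_family_def by (intro Collect_cong conj_cong refl end_set_iff) simp
  also have "\<dots> \<in> sets M"
    by (intro sets.sets_Collect_countable_All sets_carrier_Ex sets_carrier_All sets.sets_Collect_conj
        sets.sets_Collect_imp vertex_family_mem[OF D] sets.sets_Collect_const)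
  finally show ?thesis .
qed

definition some_end :: "(nat \<Rightarrow> 'a) set" where "some_end = (SOME \<xi>. \<xi> \<in> bd)"

lemma some_end: "some_end \<in> bd"
proof -
  interpret prob_space "P \<one>" by (rule prob_space_P) simp
  have "AE y in P \<one>. \<exists>\<xi>. converges_to (carrier G) E y \<xi>"
    using paths_converge by (simp add: almost_all_paths_def)
  then have "\<exists>y. \<exists>\<xi>. converges_to (carrier G) E y \<xi>"
    using AE_const[of False] by (auto elim: AE_mp intro: ccontr)
  then obtain \<xi> where "\<xi> \<in> bd" by (auto simp: converges_to_def)
  then show ?thesis unfolding some_end_def by (rule someI[of "\<lambda>\<xi>. \<xi> \<in> bd"])
qed

definition end_of :: "'a set \<Rightarrow> (nat \<Rightarrow> 'a) set" where
  "end_of S = (if end_set S then (SOME \<xi>. \<xi> \<in> bd \<and> bstem \<xi> = S) else some_end)"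

lemma end_of: "end_set S \<Longrightarrow> end_of S \<in> bd \<and> bstem (end_of S) = S"
  unfolding end_of_def end_set_def by (simp, rule someI_ex, blast)

lemma end_of_bd: "end_of S \<in> bd"
  using end_of some_end by (cases "end_set S") (auto simp: end_of_def)

lemma end_of_bstem: "\<xi> \<in> bd \<Longrightarrow> end_of (bstem \<xi>) = \<xi>"
  using end_of[of "bstem \<xi>"] bstem_inj by (auto simp: end_set_def)

lemma measurable_end_of:
  assumes D: "vertex_family M D"
  shows "(\<lambda>x. end_of (D x)) \<in> M \<rightarrow>\<^sub>M BB"
proof (rule measurable_boundaryI[OF countable_carrier end_of_bd])
  fix v assume v: "v \<in> carrier G"
  have "{x \<in> space M. v \<in> bstem (end_of (D x))} =
     {x \<in> space M. (end_set (D x) \<and> v \<in> D x) \<or> (\<not> end_set (D x) \<and> v \<in> bstem some_end)}"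
    using end_of by (intro Collect_cong) (auto simp: end_of_def)
  also have "\<dots> \<in> sets M"
    by (intro sets.sets_Collect_disj sets.sets_Collect_conj sets.sets_Collect_neg end_set_sets[OF D]
        vertex_family_mem[OF D v] sets.sets_Collect_const)
  finally show "{x \<in> space M. v \<in> bstem (end_of (D x))} \<in> sets M" .
qed

lemma converges_end_of: "end_set (stem y) \<Longrightarrow> converges_to (carrier G) E y (end_of (stem y))"
  using end_of converges_to_iff by simp

lemma converges_iff_end_of:
  "\<xi> \<in> bd \<Longrightarrow> converges_to (carrier G) E y \<xi> \<longleftrightarrow> end_set (stem y) \<and> \<xi> = end_of (stem y)"
  using converges_to_iff[of \<xi> y] end_of_bstem[of \<xi>] end_of[of "stem y"] by (auto simp: end_set_def)

lemma end_set_stem: "almost_all_paths G \<mu> (\<lambda>y. end_set (stem y))"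
  using stem_infinite by (rule almost_all_paths_mono) (use infinite_stem_bd end_set_def in metis)


subsection \<open>A model of the Poisson boundary\<close>

definition code :: "'a set \<Rightarrow> real" where
  "code S = ternary_code (to_nat_on (carrier G) ` S)"

definition decode :: "real \<Rightarrow> 'a set" where
  "decode x = {v \<in> carrier G. \<lfloor>3 ^ Suc (to_nat_on (carrier G) v) * x\<rfloor> mod 3 = 1}"

lemma decode_code: "S \<subseteq> carrier G \<Longrightarrow> decode (code S) = S"
proof -
  assume S: "S \<subseteq> carrier G"
  have "to_nat_on (carrier G) v \<in> to_nat_on (carrier G) ` S \<longleftrightarrow> v \<in> S" if "v \<in> carrier G" for v
    using inj_on_image_mem_iff[OF inj_on_to_nat_on[OF countable_carrier] that S] .
  then show ?thesis using S unfolding decode_def code_def ternary_digit by auto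
qed

lemma vertex_family_decode: "vertex_family borel decode"
  unfolding vertex_family_def
proof (intro conjI ballI)
  show "decode x \<subseteq> carrier G" for x by (auto simp: decode_def)
  fix v assume v: "v \<in> carrier G"
  have "(\<lambda>x :: real. \<lfloor>3 ^ Suc (to_nat_on (carrier G) v) * x\<rfloor>) \<in> borel \<rightarrow>\<^sub>M count_space UNIV" by measurable
  from measurable_sets[OF this, of "{k. k mod 3 = 1}"]
  show "{x \<in> space borel. v \<in> decode x} \<in> sets borel" using v by (simp add: decode_def vimage_def)
qed

lemma measurable_code:
  assumes D: "vertex_family M D"
  shows "(\<lambda>x. code (D x)) \<in> M \<rightarrow>\<^sub>M borel"
  unfolding code_def ternary_code_def
proof (intro borel_measurable_suminf borel_measurable_times borel_measurable_const measurable_If)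
  fix n
  have "{x \<in> space M. n \<in> to_nat_on (carrier G) ` D x} =
      {x \<in> space M. \<exists>v\<in>carrier G. v \<in> D x \<and> n = to_nat_on (carrier G) v}"
    using D unfolding vertex_family_def by blast
  also have "\<dots> \<in> sets M"
    by (intro sets_carrier_Ex sets.sets_Collect_conj vertex_family_mem[OF D] sets.sets_Collect_const)
  finally show "{x \<in> space M. n \<in> to_nat_on (carrier G) ` D x} \<in> sets M" .
qed

text \<open>
  The stem of a translated path, computed from the stem of the path: the translates of the high vertices
  of the stem are late positions of the translated path. The rank serves only to say that finitely many
  vertices are left out, in a form that is visibly measurable.
\<close>

definition translate_stem :: "'a \<Rightarrow> 'a set \<Rightarrow> 'a set" where
  "translate_stem g S = {v \<in> carrier G. \<exists>n. \<forall>w\<in>carrier G. w \<in> S \<and> n < rk w \<longrightarrow> v \<in> anc (g \<otimes> w)}"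

lemma vertex_family_translate_stem:
  assumes D: "vertex_family M D"
  shows "vertex_family M (\<lambda>x. translate_stem g (D x))"
  unfolding vertex_family_def
proof (intro conjI ballI)
  show "translate_stem g (D x) \<subseteq> carrier G" for x by (auto simp: translate_stem_def)
  fix v assume v: "v \<in> carrier G"
  have "{x \<in> space M. v \<in> translate_stem g (D x)} =
      {x \<in> space M. \<exists>n. \<forall>w\<in>carrier G. w \<in> D x \<and> n < rk w \<longrightarrow> v \<in> anc (g \<otimes> w)}"
    using v by (simp add: translate_stem_def)
  also have "\<dots> \<in> sets M"
    by (intro sets.sets_Collect_countable_Ex sets_carrier_All sets.sets_Collect_imp sets.sets_Collect_conj
        vertex_family_mem[OF D] sets.sets_Collect_const)
  finally show "{x \<in> space M. v \<in> translate_stem g (D x)} \<in> sets M" .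
qed

lemma path_translate_space: "g \<in> carrier G \<Longrightarrow> y \<in> space PS \<Longrightarrow> path_translate G g y \<in> space PS"
  by (simp add: space_PS path_translate_def)

text \<open>
  A common ancestor of almost all translated vertices of the stem is an ancestor of one that belongs to the
  stem of the translated path; conversely, almost all vertices of the stem are late positions of the path.
\<close>

lemma stem_path_translate:
  assumes g: "g \<in> carrier G"
  shows "almost_all_paths G \<mu> (\<lambda>y. stem (path_translate G g y) = translate_stem g (stem y))"
  using almost_all_paths_conj[OF stem_translate[OF g] almost_all_paths_conj[OF stem_infinite stem_visited]]
proof (rule almost_all_paths_mono, elim conjE)
  fix y assume y: "y \<in> space PS" and inf: "infinite (stem y)" and fin: "finite (stem y - range y)"
    and tr: "infinite {w \<in> stem y. g \<otimes> w \<in> stem (path_translate G g y)}"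
  have sub: "stem (path_translate G g y) \<subseteq> carrier G" "stem y \<subseteq> carrier G"
    using vertex_family_stem y path_translate_space[OF g y] unfolding vertex_family_def by auto
  show "stem (path_translate G g y) = translate_stem g (stem y)"
  proof (intro equalityI subsetI)
    fix v assume v: "v \<in> stem (path_translate G g y)"
    then obtain N where N: "\<forall>i\<ge>N. v \<in> anc (g \<otimes> y i)"
      by (auto simp: stem_def eventually_sequentially path_translate_def)
    obtain m where m: "\<And>w. w \<in> stem y \<Longrightarrow> m < rk w \<Longrightarrow> \<exists>i\<ge>N. w = y i" using stem_late[OF inf fin] by blast
    have "v \<in> anc (g \<otimes> w)" if "w \<in> stem y" "m < rk w" for w using m[OF that] N by auto
    then show "v \<in> translate_stem g (stem y)" using v sub by (auto simp: translate_stem_def)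
  next
    fix v assume "v \<in> translate_stem g (stem y)"
    then obtain n where n: "\<And>w. w \<in> stem y \<Longrightarrow> n < rk w \<Longrightarrow> v \<in> anc (g \<otimes> w)"
      using sub(2) by (auto simp: translate_stem_def)
    have "finite {w \<in> stem y. rk w \<le> n}"
      by (rule inj_on_finite[of rk _ "{..n}"]) (use stem_rk_inj in \<open>auto simp: inj_on_def\<close>)
    then obtain w where "w \<in> stem y" "g \<otimes> w \<in> stem (path_translate G g y)" "n < rk w"
      using tr by (metis (no_types, lifting) finite_subset mem_Collect_eq not_le subsetI)
    then show "v \<in> stem (path_translate G g y)" using stem_closed n by blast
  qed
qed

lemma stem_shift_path: "stem (path_shift y) = stem y"
  using stem_shift[of y 1] by (simp add: path_shift_def)

lemma stem_event_exit:
  assumes "B \<in> sets PS" "\<And>y. y \<in> space PS \<Longrightarrow> y \<in> B \<longleftrightarrow> Q (stem y)"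
  shows "B \<in> exit_sets G \<mu>"
proof -
  have *: "path_shift y \<in> B \<longleftrightarrow> y \<in> B" if "y \<in> space PS" for y
  proof -
    have "path_shift y \<in> space PS" using that by (simp add: space_PS path_shift_def)
    then show ?thesis using assms(2) that by (simp add: stem_shift_path)
  qed
  have "almost_all_paths G \<mu> (\<lambda>_. True)" by (simp add: almost_all_paths_def)
  then have "almost_all_paths G \<mu> (\<lambda>y. path_shift y \<in> B \<longleftrightarrow> y \<in> B)"
    by (rule almost_all_paths_mono) (rule *)
  then show ?thesis using assms(1) by (simp add: exit_sets_def)
qed

text \<open>
  The coded stem generates the exit \<open>\<sigma>\<close>-algebra, because it decides every exit set through \<open>stem_test\<close>.
\<close>

theorem poisson_boundary_exists: "\<exists>bnd act. poisson_boundary G \<mu> bnd act"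
proof (intro exI)
  let ?bnd = "\<lambda>y. code (stem y)"
  let ?act = "\<lambda>g x. code (translate_stem g (decode x))"
  have sub: "stem y \<subseteq> carrier G" if "y \<in> space PS" for y
    using vertex_family_stem that unfolding vertex_family_def by auto
  have bnd: "?bnd \<in> PS \<rightarrow>\<^sub>M borel" by (rule measurable_code[OF vertex_family_stem])
  have "exit_quotient_map G \<mu> ?bnd"
    unfolding exit_quotient_map_def
  proof (intro conjI ballI bnd)
    fix T :: "real set" assume T: "T \<in> sets borel"
    show "?bnd -` T \<inter> space PS \<in> exit_sets G \<mu>"
      by (rule stem_event_exit[where Q = "\<lambda>S. code S \<in> T"]) (use measurable_sets[OF bnd T] in auto)
  next
    fix A assume A: "A \<in> exit_sets G \<mu>"
    show "\<exists>T\<in>sets borel. almost_all_paths G \<mu> (\<lambda>y. y \<in> A \<longleftrightarrow> ?bnd y \<in> T)"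
    proof (rule bexI)
      show "{x. stem_test A (decode x)} \<in> sets borel" using stem_test_sets[OF vertex_family_decode] by simp
      show "almost_all_paths G \<mu> (\<lambda>y. y \<in> A \<longleftrightarrow> ?bnd y \<in> {x. stem_test A (decode x)})"
        using exit_set_stem_test[OF A] by (rule almost_all_paths_mono) (simp add: decode_code sub)
    qed
  qed
  moreover have "descended_action G \<mu> ?bnd ?act"
    unfolding descended_action_def
  proof (intro ballI conjI)
    fix g assume g: "g \<in> carrier G"
    show "?act g \<in> borel \<rightarrow>\<^sub>M borel"
      by (rule measurable_code[OF vertex_family_translate_stem[OF vertex_family_decode]])
    show "almost_all_paths G \<mu> (\<lambda>y. ?act g (?bnd y) = ?bnd (path_translate G g y))"
      using stem_path_translate[OF g] by (rule almost_all_paths_mono) (simp add: decode_code sub)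
  qed
  ultimately show "poisson_boundary G \<mu> ?bnd ?act" by (simp add: poisson_boundary_def)
qed


subsection \<open>Identification with the boundary of the forest\<close>

text \<open>
  The events that the stem contains a given vertex are exit sets, so they are seen by any other version of
  the quotient.
\<close>

lemma stem_from_quotient:
  assumes bnd: "exit_quotient_map G \<mu> bnd"
  obtains D where "vertex_family borel D" "almost_all_paths G \<mu> (\<lambda>y. D (bnd y) = stem y)"
proof -
  have "\<forall>v\<in>carrier G. \<exists>T. T \<in> sets borel \<and>
      almost_all_paths G \<mu> (\<lambda>y. y \<in> {y \<in> space PS. v \<in> stem y} \<longleftrightarrow> bnd y \<in> T)"
  proof
    fix v assume v: "v \<in> carrier G"
    have "{y \<in> space PS. v \<in> stem y} \<in> exit_sets G \<mu>"
      by (rule stem_event_exit[where Q = "\<lambda>S. v \<in> S"]) (use vertex_family_mem[OF vertex_family_stem v] in auto)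
    then show "\<exists>T. T \<in> sets borel \<and> almost_all_paths G \<mu> (\<lambda>y. y \<in> {y \<in> space PS. v \<in> stem y} \<longleftrightarrow> bnd y \<in> T)"
      using bnd unfolding exit_quotient_map_def by blast
  qed
  from bchoice[OF this] obtain T where T: "\<forall>v\<in>carrier G. T v \<in> sets borel \<and>
      almost_all_paths G \<mu> (\<lambda>y. y \<in> {y \<in> space PS. v \<in> stem y} \<longleftrightarrow> bnd y \<in> T v)" ..
  define D where "D x = {v \<in> carrier G. x \<in> T v}" for x
  have "vertex_family borel D"
    using T by (simp add: vertex_family_def D_def)
  moreover have "almost_all_paths G \<mu> (\<lambda>y. \<forall>v\<in>carrier G. y \<in> {y \<in> space PS. v \<in> stem y} \<longleftrightarrow> bnd y \<in> T v)"
    by (rule almost_all_paths_all_countable[OF countable_carrier]) (use T in blast)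
  then have "almost_all_paths G \<mu> (\<lambda>y. D (bnd y) = stem y)"
  proof (rule almost_all_paths_mono)
    fix y assume y: "y \<in> space PS" and *: "\<forall>v\<in>carrier G. y \<in> {y \<in> space PS. v \<in> stem y} \<longleftrightarrow> bnd y \<in> T v"
    have "stem y \<subseteq> carrier G" using vertex_family_stem y unfolding vertex_family_def by auto
    then show "D (bnd y) = stem y" using y * by (auto simp: D_def)
  qed
  ultimately show ?thesis using that by blast
qed

text \<open>
  Conversely, the events \<open>bnd y < q\<close> for rational \<open>q\<close> are exit sets, so the stem decides them, and \<open>bnd y\<close> is
  the infimum of the rational numbers above it. The infimum is taken in the extended reals to be a measurable
  function at all boundary points.
\<close>

lemma quotient_from_stem:
  assumes bnd: "exit_quotient_map G \<mu> bnd"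
  obtains \<kappa> where "\<kappa> \<in> BB \<rightarrow>\<^sub>M borel" "almost_all_paths G \<mu> (\<lambda>y. \<kappa> (end_of (stem y)) = bnd y)"
proof -
  define A where "A q = bnd -` {..<real_of_rat q} \<inter> space PS" for q
  have A: "A q \<in> exit_sets G \<mu>" for q using bnd by (auto simp: exit_quotient_map_def A_def)
  define f where "f \<xi> q = (if stem_test (A q) (bstem \<xi>) then ereal (real_of_rat q) else \<infinity>)" for \<xi> q
  define \<kappa> where "\<kappa> \<xi> = real_of_ereal (INF q. f \<xi> q)" for \<xi>
  have "(\<lambda>\<xi>. f \<xi> q) \<in> BB \<rightarrow>\<^sub>M borel" for q
    unfolding f_def
    by (intro measurable_If measurable_const) (use stem_test_sets[OF vertex_family_bstem] in auto)
  then have "\<kappa> \<in> BB \<rightarrow>\<^sub>M borel"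
    unfolding \<kappa>_def by (intro borel_measurable_real_of_ereal borel_measurable_INF) auto
  moreover have "almost_all_paths G \<mu> (\<lambda>y. \<forall>q\<in>UNIV. y \<in> A q \<longleftrightarrow> stem_test (A q) (stem y))"
    by (rule almost_all_paths_all_countable) (auto intro: exit_set_stem_test[OF A])
  from almost_all_paths_conj[OF this end_set_stem]
  have "almost_all_paths G \<mu> (\<lambda>y. \<kappa> (end_of (stem y)) = bnd y)"
  proof (rule almost_all_paths_mono, elim conjE)
    fix y assume y: "y \<in> space PS" and *: "\<forall>q\<in>UNIV. y \<in> A q \<longleftrightarrow> stem_test (A q) (stem y)"
      and e: "end_set (stem y)"
    have f: "f (end_of (stem y)) q = (if bnd y < real_of_rat q then ereal (real_of_rat q) else \<infinity>)" for q
      using * y end_of[OF e] by (auto simp: f_def A_def)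
    have "(INF q. f (end_of (stem y)) q) = ereal (bnd y)"
    proof (rule antisym)
      show "ereal (bnd y) \<le> (INF q. f (end_of (stem y)) q)"
        by (rule INF_greatest) (auto simp: f)
      show "(INF q. f (end_of (stem y)) q) \<le> ereal (bnd y)"
      proof (rule ereal_le_epsilon2)
        fix e :: real assume "e > 0"
        then obtain q where q: "bnd y < real_of_rat q" "real_of_rat q < bnd y + e"
          using of_rat_dense[of "bnd y" "bnd y + e"] by auto
        have "(INF q. f (end_of (stem y)) q) \<le> f (end_of (stem y)) q" by (rule INF_lower) simp
        also have "\<dots> \<le> ereal (bnd y) + ereal e" using q by (simp add: f)
        finally show "(INF q. f (end_of (stem y)) q) \<le> ereal (bnd y) + ereal e" .
      qed
    qed
    then show "\<kappa> (end_of (stem y)) = bnd y" by (simp add: \<kappa>_def)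
  qed
  ultimately show ?thesis using that by blast
qed

text \<open>
  The limit is the measurable function \<open>end_of\<close> of the stem wherever it exists.
\<close>

lemma hitting_distribution_eq:
  assumes h: "h \<in> carrier G"
  shows "hitting_distribution G \<mu> E h = distr (P h) BB (\<lambda>y. end_of (stem y))"
proof -
  let ?L = "\<lambda>y. end_of (stem y)"
  have L: "?L \<in> P h \<rightarrow>\<^sub>M BB"
    by (rule measurable_P[OF measurable_end_of[OF vertex_family_stem]])
  have "emeasure (P h) {y \<in> space PS. \<exists>\<xi>\<in>A. converges_to (carrier G) E y \<xi>} = emeasure (distr (P h) BB ?L) A"
    if A: "A \<in> sets BB" for A
  proof -
    have Abd: "A \<subseteq> bd" using sets.sets_into_space[OF A] by simp
    have eq: "{y \<in> space PS. \<exists>\<xi>\<in>A. converges_to (carrier G) E y \<xi>}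
        = {y \<in> space PS. end_set (stem y)} \<inter> (?L -` A \<inter> space PS)"
      using converges_iff_end_of Abd by blast
    have LA: "?L -` A \<inter> space PS \<in> sets PS"
      by (rule measurable_sets[OF measurable_end_of[OF vertex_family_stem] A])
    have "emeasure (P h) {y \<in> space PS. \<exists>\<xi>\<in>A. converges_to (carrier G) E y \<xi>} = emeasure (P h) (?L -` A \<inter> space PS)"
      unfolding eq
    proof (rule emeasure_eq_AE)
      show "AE y in P h. y \<in> {y \<in> space PS. end_set (stem y)} \<inter> (?L -` A \<inter> space PS)
          \<longleftrightarrow> y \<in> ?L -` A \<inter> space PS"
        using end_set_stem h unfolding almost_all_paths_def by (auto elim!: AE_mp)
    qed (use LA end_set_sets[OF vertex_family_stem] in auto)
    also have "\<dots> = emeasure (distr (P h) BB ?L) A"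
      using emeasure_distr[OF L A] by simp
    finally show ?thesis .
  qed
  then have "hitting_distribution G \<mu> E h = measure_of bd (sets BB) (emeasure (distr (P h) BB ?L))"
    unfolding hitting_distribution_def
    by (intro measure_of_eq) (use sets.space_closed[of BB] sets.sigma_sets_eq[of BB] in auto)
  also have "\<dots> = distr (P h) BB ?L"
    using measure_of_of_measure[of "distr (P h) BB ?L"] by simp
  finally show ?thesis .
qed

text \<open>
  The maps \<open>\<pi>\<close> and \<open>\<kappa>\<close> between the two versions of the boundary are inverse to each other almost everywhere;
  restricting them to the fixed points of the two compositions makes them inverse bijections.
\<close>

theorem boundary_isomorphism:
  assumes bnd: "exit_quotient_map G \<mu> bnd"
  shows "\<exists>\<pi>. limit_quotient_map G \<mu> E bnd \<pi> \<and>
    isomorphism_mod_0 (carrier G) (harmonic_measure G \<mu> bnd) (hitting_distribution G \<mu> E) \<pi>"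
proof -
  have bm: "bnd \<in> PS \<rightarrow>\<^sub>M borel" using bnd by (simp add: exit_quotient_map_def)
  obtain D where D: "vertex_family borel D" "almost_all_paths G \<mu> (\<lambda>y. D (bnd y) = stem y)"
    using stem_from_quotient[OF bnd] by blast
  obtain \<kappa> where \<kappa>: "\<kappa> \<in> BB \<rightarrow>\<^sub>M borel" "almost_all_paths G \<mu> (\<lambda>y. \<kappa> (end_of (stem y)) = bnd y)"
    using quotient_from_stem[OF bnd] by blast
  define \<pi> where "\<pi> x = end_of (D x)" for x
  have \<pi>m: "\<pi> \<in> borel \<rightarrow>\<^sub>M BB" unfolding \<pi>_def by (rule measurable_end_of[OF D(1)])
  have \<pi>bd: "\<pi> x \<in> bd" for x by (simp add: \<pi>_def end_of_bd)
  have lim: "limit_quotient_map G \<mu> E bnd \<pi>"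
    unfolding limit_quotient_map_def
    using \<pi>m almost_all_paths_mono[OF almost_all_paths_conj[OF D(2) end_set_stem]]
    by (auto simp: \<pi>_def converges_end_of)
  have \<pi>_stem: "almost_all_paths G \<mu> (\<lambda>y. \<pi> (bnd y) = end_of (stem y) \<and> \<kappa> (\<pi> (bnd y)) = bnd y)"
    using almost_all_paths_conj[OF D(2) \<kappa>(2)] by (rule almost_all_paths_mono) (simp add: \<pi>_def)
  define X where "X = {x. \<kappa> (\<pi> x) = x}"
  define Y where "Y = {\<xi> \<in> bd. \<pi> (\<kappa> \<xi>) = \<xi>}"
  have \<kappa>\<pi>: "(\<lambda>x. \<kappa> (\<pi> x)) \<in> borel \<rightarrow>\<^sub>M borel" using measurable_compose[OF \<pi>m \<kappa>(1)] .
  have X: "X \<in> sets borel"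
    using borel_measurable_eq[OF \<kappa>\<pi> measurable_ident_sets[OF refl]] by (simp add: X_def)
  have D\<kappa>: "vertex_family BB (\<lambda>\<xi>. bstem (\<pi> (\<kappa> \<xi>)))"
    unfolding vertex_family_def
  proof (intro conjI ballI)
    show "bstem (\<pi> (\<kappa> \<xi>)) \<subseteq> carrier G" for \<xi> using bstem_V \<pi>bd by blast
    fix v
    have "(\<lambda>\<xi>. \<pi> (\<kappa> \<xi>)) \<in> BB \<rightarrow>\<^sub>M BB" using measurable_compose[OF \<kappa>(1) \<pi>m] .
    from measurable_sets[OF this cyl_sets[of v]]
    show "{\<xi> \<in> space BB. v \<in> bstem (\<pi> (\<kappa> \<xi>))} \<in> sets BB"
      using \<pi>bd by (simp add: cyl_def vimage_def Int_def conj_commute)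
  qed
  have "Y = {\<xi> \<in> space BB. \<forall>v\<in>carrier G. v \<in> bstem (\<pi> (\<kappa> \<xi>)) \<longleftrightarrow> v \<in> bstem \<xi>}"
  proof (intro equalityI subsetI)
    fix \<xi> assume "\<xi> \<in> {\<xi> \<in> space BB. \<forall>v\<in>carrier G. v \<in> bstem (\<pi> (\<kappa> \<xi>)) \<longleftrightarrow> v \<in> bstem \<xi>}"
    then have \<xi>: "\<xi> \<in> bd" "\<forall>v\<in>carrier G. v \<in> bstem (\<pi> (\<kappa> \<xi>)) \<longleftrightarrow> v \<in> bstem \<xi>" by auto
    then have "bstem (\<pi> (\<kappa> \<xi>)) = bstem \<xi>" using bstem_V[OF \<pi>bd] bstem_V[OF \<xi>(1)] by blast
    then show "\<xi> \<in> Y" using bstem_inj[OF \<pi>bd \<xi>(1)] \<xi>(1) by (simp add: Y_def)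
  qed (simp add: Y_def)
  also have "\<dots> = {\<xi> \<in> space BB. \<forall>v\<in>carrier G. (v \<in> bstem (\<pi> (\<kappa> \<xi>)) \<longrightarrow> v \<in> bstem \<xi>) \<and> (v \<in> bstem \<xi> \<longrightarrow> v \<in> bstem (\<pi> (\<kappa> \<xi>)))}"
    by (simp add: iff_conv_conj_imp)
  also have "\<dots> \<in> sets BB"
    by (intro sets_carrier_All sets.sets_Collect_conj sets.sets_Collect_imp vertex_family_mem[OF D\<kappa>]
        vertex_family_mem[OF vertex_family_bstem])
  finally have Y: "Y \<in> sets BB" .
  have bij: "bij_betw \<pi> X Y"
    by (rule bij_betw_byWitness[of _ \<kappa>]) (auto simp: X_def Y_def \<pi>bd)
  have inv: "inv_into X \<pi> \<xi> = \<kappa> \<xi>" if "\<xi> \<in> Y" for \<xi>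
    by (rule inv_into_f_eq) (use bij that in \<open>auto simp: bij_betw_def X_def Y_def\<close>)
  have "isomorphism_mod_0 (carrier G) (harmonic_measure G \<mu> bnd) (hitting_distribution G \<mu> E) \<pi>"
    unfolding isomorphism_mod_0_def
  proof (intro exI[of _ X] exI[of _ Y] conjI ballI bij)
    fix h assume h: "h \<in> carrier G"
    let ?M = "harmonic_measure G \<mu> bnd h" and ?N = "hitting_distribution G \<mu> E h"
    have bP: "bnd \<in> P h \<rightarrow>\<^sub>M borel" by (rule measurable_P[OF bm])
    have M: "?M = distr (P h) borel bnd" by (simp add: harmonic_measure_def)
    have sM: "sets ?M = sets borel" "space ?M = UNIV" by (simp_all add: M)
    have sN: "sets ?N = sets BB" "space ?N = bd" by (simp_all add: hitting_distribution_eq[OF h])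
    have ae: "AE y in P h. \<pi> (bnd y) = end_of (stem y) \<and> \<kappa> (\<pi> (bnd y)) = bnd y"
      using \<pi>_stem h by (simp add: almost_all_paths_def)
    have "AE x in ?M. x \<in> X"
      unfolding M using AE_distr_iff[OF bP, of "\<lambda>x. x \<in> X"] X ae by (auto simp: X_def)
    then have "emeasure ?M (space ?M - X) = 0"
      using AE_iff_measurable[of "space ?M - X" ?M "\<lambda>x. x \<in> X"] X sM by auto
    then show nX: "space ?M - X \<in> null_sets ?M" using X sM by (intro null_setsI) auto
    have N_distr: "?N = distr ?M BB \<pi>"
    proof -
      have "?N = distr (P h) BB (\<lambda>y. end_of (stem y))" by (rule hitting_distribution_eq[OF h])
      also have "\<dots> = distr (P h) BB (\<lambda>y. \<pi> (bnd y))"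
      proof (rule distr_cong_AE[OF refl refl])
        show "AE y in P h. end_of (stem y) = \<pi> (bnd y)" using ae by auto
        show "(\<lambda>y. end_of (stem y)) \<in> P h \<rightarrow>\<^sub>M BB"
          by (rule measurable_P[OF measurable_end_of[OF vertex_family_stem]])
        show "(\<lambda>y. \<pi> (bnd y)) \<in> P h \<rightarrow>\<^sub>M BB" using measurable_compose[OF bP \<pi>m] .
      qed
      also have "\<dots> = distr ?M BB \<pi>" unfolding M using distr_distr[OF \<pi>m bP] by (simp add: comp_def)
      finally show ?thesis .
    qed
    have \<pi>M: "\<pi> \<in> ?M \<rightarrow>\<^sub>M BB" using \<pi>m measurable_cong_sets[OF sM(1) refl, of BB] by simp
    have pre: "\<pi> -` B \<inter> space ?M \<in> sets ?M" if "B \<in> sets BB" for B using measurable_sets[OF \<pi>M that] .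
    have em: "emeasure ?N B = emeasure ?M (\<pi> -` B \<inter> X)" if B: "B \<in> sets BB" for B
    proof -
      have "emeasure ?N B = emeasure ?M (\<pi> -` B \<inter> space ?M)"
        unfolding N_distr by (rule emeasure_distr[OF \<pi>M B])
      also have "\<dots> = emeasure ?M (\<pi> -` B \<inter> X)"
      proof (rule emeasure_eq_AE)
        show "AE x in ?M. x \<in> \<pi> -` B \<inter> space ?M \<longleftrightarrow> x \<in> \<pi> -` B \<inter> X"
          using \<open>AE x in ?M. x \<in> X\<close> by (auto simp: sM)
        show "\<pi> -` B \<inter> X \<in> sets ?M" using pre[OF B] X sM by auto
      qed (rule pre[OF B])
      finally show ?thesis .
    qed
    show "X \<in> sets ?M" using X sM by simp
    show "Y \<in> sets ?N" using Y sN by simp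
    show "space ?N - Y \<in> null_sets ?N"
    proof (rule null_setsI)
      have B: "bd - Y \<in> sets BB" using Y sets.top[of BB] by auto
      have "\<pi> -` (bd - Y) \<inter> X = {}" using bij by (auto simp: bij_betw_def)
      then show "emeasure ?N (space ?N - Y) = 0" using em[OF B] sN by simp
      show "space ?N - Y \<in> sets ?N" using B sN by simp
    qed
    show "\<pi> \<in> restrict_space ?M X \<rightarrow>\<^sub>M restrict_space ?N Y"
    proof (rule measurable_restrict_space3)
      show "\<pi> \<in> ?M \<rightarrow>\<^sub>M ?N" using \<pi>M measurable_cong_sets[OF refl sN(1), of ?M] by simp
      show "\<pi> \<in> X \<rightarrow> Y" using bij by (auto simp: bij_betw_def)
    qed
    have "\<kappa> \<in> restrict_space ?N Y \<rightarrow>\<^sub>M restrict_space ?M X"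
    proof (rule measurable_restrict_space3)
      show "\<kappa> \<in> ?N \<rightarrow>\<^sub>M ?M" using \<kappa>(1) measurable_cong_sets[OF sN(1) sM(1)] by simp
      show "\<kappa> \<in> Y \<rightarrow> X" by (auto simp: X_def Y_def)
    qed
    then show "inv_into X \<pi> \<in> restrict_space ?N Y \<rightarrow>\<^sub>M restrict_space ?M X"
      by (rule measurable_cong[THEN iffD1, rotated]) (simp add: inv space_restrict_space)
    fix B assume "B \<in> sets ?N"
    then show "emeasure ?N B = emeasure ?M (\<pi> -` B \<inter> X)" using em sN by simp
  qed
  then show ?thesis using lim by blast
qed


subsection \<open>Freeness\<close>

lemma almost_all_paths_translate:
  assumes g: "g \<in> carrier G" and Q: "almost_all_paths G \<mu> Q"
  shows "almost_all_paths G \<mu> (\<lambda>y. Q (path_translate G g y))"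
  unfolding almost_all_paths_def
proof
  fix h assume h: "h \<in> carrier G"
  have tr: "path_translate G g \<in> PS \<rightarrow>\<^sub>M PS"
    unfolding measurable_PS_iff path_translate_def
    using measurable_mult[OF _ measurable_position] g by simp
  have "walk G (g \<otimes> h) x n = path_translate G g (walk G h x) n" if "x \<in> space W" for x n
    using that g h walk_closed[OF h that]
    by (induction n) (simp_all add: path_translate_def m_assoc space_W)
  then have "P (g \<otimes> h) = distr W PS (path_translate G g \<circ> walk G h)"
    unfolding path_measure_def by (intro distr_cong refl) auto
  also have "\<dots> = distr (P h) PS (path_translate G g)"
    unfolding path_measure_def by (rule distr_distr[OF tr measurable_walk[OF h], symmetric])
  finally have eq: "P (g \<otimes> h) = distr (P h) PS (path_translate G g)" .
  have "AE y in P (g \<otimes> h). Q y" using Q g h by (simp add: almost_all_paths_def)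
  then have "AE y in distr (P h) PS (path_translate G g). Q y" unfolding eq .
  then show "AE y in P h. Q (path_translate G g y)" by (rule AE_distrD[OF measurable_P[OF tr]])
qed

text \<open>
  The stem is a function of the boundary point, and translation by \<open>g \<noteq> \<one>\<close> changes the stem.
\<close>

theorem action_free:
  assumes pb: "poisson_boundary G \<mu> bnd act"
  shows "free_mod_0 G \<mu> bnd act"
  unfolding free_mod_0_def
proof
  have bnd: "exit_quotient_map G \<mu> bnd" and act: "descended_action G \<mu> bnd act"
    using pb by (simp_all add: poisson_boundary_def)
  have bm: "bnd \<in> PS \<rightarrow>\<^sub>M borel" using bnd by (simp add: exit_quotient_map_def)
  obtain D where D: "almost_all_paths G \<mu> (\<lambda>y. D (bnd y) = stem y)"
    using stem_from_quotient[OF bnd] by blast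
  have each: "almost_all_paths G \<mu> (\<lambda>y. act g (bnd y) = bnd y \<longleftrightarrow> g = \<one>)" if g: "g \<in> carrier G" for g
  proof -
    have a: "almost_all_paths G \<mu> (\<lambda>y. act g (bnd y) = bnd (path_translate G g y))"
      using act g by (simp add: descended_action_def)
    show ?thesis
    proof (cases "g = \<one>")
      case True
      have "path_translate G \<one> y = y" if "y \<in> space PS" for y
        using that by (auto simp: path_translate_def space_PS)
      with a True show ?thesis by (intro almost_all_paths_mono[OF a]) auto
    next
      case False
      show ?thesis
        using almost_all_paths_conj[OF a almost_all_paths_conj[OF D
              almost_all_paths_conj[OF almost_all_paths_translate[OF g D] stem_moved[OF g False]]]]
        by (rule almost_all_paths_mono) (use False in auto)
    qed
  qed
  have all: "almost_all_paths G \<mu> (\<lambda>y. \<forall>g\<in>carrier G. act g (bnd y) = bnd y \<longleftrightarrow> g = \<one>)"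
    by (rule almost_all_paths_all_countable[OF countable_carrier each])
  fix h assume h: "h \<in> carrier G"
  have bP: "bnd \<in> P h \<rightarrow>\<^sub>M borel" by (rule measurable_P[OF bm])
  have "{x \<in> space borel. act g x = x \<longleftrightarrow> g = \<one>} \<in> sets borel" if g: "g \<in> carrier G" for g
  proof -
    have "act g \<in> borel \<rightarrow>\<^sub>M borel" using act g by (simp add: descended_action_def)
    then have "{x \<in> space borel. act g x = x} \<in> sets borel"
      by (intro borel_measurable_eq) (auto intro: measurable_ident_sets)
    from this sets.sets_Collect_neg[OF this] show ?thesis by (cases "g = \<one>") simp_all
  qed
  then have "{x \<in> space borel. \<forall>g\<in>carrier G. act g x = x \<longleftrightarrow> g = \<one>} \<in> sets borel"
    by (rule sets_carrier_All)
  then have "AE x in harmonic_measure G \<mu> bnd h. \<forall>g\<in>carrier G. act g x = x \<longleftrightarrow> g = \<one>"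
    unfolding harmonic_measure_def using AE_distr_iff[OF bP] all h by (simp add: almost_all_paths_def)
  then show "AE x in harmonic_measure G \<mu> bnd h. {g \<in> carrier G. act g x = x} = {\<one>}"
    by eventually_elim auto
qed

end

section \<open>The forest of records\<close>

context group begin

primrec words :: "nat \<Rightarrow> 'a set \<Rightarrow> 'a set" where
  "words 0 Y = {\<one>}"
| "words (Suc k) Y = (\<lambda>(x, y). x \<otimes> y) ` (words k Y \<times> Y)"

text \<open>
  The neutral element is included so that words of bounded length are words of a fixed length.
\<close>

definition finite_symmetric :: "'a set \<Rightarrow> bool" where
  "finite_symmetric Y \<longleftrightarrow> finite Y \<and> Y \<subseteq> carrier G \<and> \<one> \<in> Y \<and> (\<forall>y\<in>Y. inv y \<in> Y)"

lemma words_closed: "Y \<subseteq> carrier G \<Longrightarrow> words k Y \<subseteq> carrier G"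
  by (induction k) auto

lemma words_finite: "finite Y \<Longrightarrow> finite (words k Y)"
  by (induction k) auto

lemma words_mult:
  assumes Y: "Y \<subseteq> carrier G" and "x \<in> words j Y" "y \<in> words k Y"
  shows "x \<otimes> y \<in> words (j + k) Y"
  using assms(3)
proof (induction k arbitrary: y)
  case 0
  then show ?case using assms(2) words_closed[OF Y, of j] by auto
next
  case (Suc k)
  then obtain z a where za: "y = z \<otimes> a" "z \<in> words k Y" "a \<in> Y" by auto
  have "x \<otimes> y = (x \<otimes> z) \<otimes> a"
    unfolding za(1) using za words_closed[OF Y] assms(2) Y by (intro m_assoc[symmetric]) auto
  then show ?case using Suc.IH[OF za(2)] za(3) by force
qed

lemma words_one: "Y \<subseteq> carrier G \<Longrightarrow> words 1 Y = Y"
  by force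

lemma words_three: "Y \<subseteq> carrier G \<Longrightarrow> x \<in> Y \<Longrightarrow> y \<in> Y \<Longrightarrow> z \<in> Y \<Longrightarrow> x \<otimes> y \<otimes> z \<in> words 3 Y"
  using words_mult[of Y "x \<otimes> y" 2 z 1] words_mult[of Y x 1 y 1] words_one[of Y]
  by (simp add: numeral_2_eq_2 numeral_3_eq_3 del: words.simps)

lemma words_mono: "Y \<subseteq> carrier G \<Longrightarrow> \<one> \<in> Y \<Longrightarrow> j \<le> k \<Longrightarrow> words j Y \<subseteq> words k Y"
proof (rule lift_Suc_mono_le[of "\<lambda>k. words k Y"])
  fix n assume Y: "Y \<subseteq> carrier G" "\<one> \<in> Y"
  show "words n Y \<subseteq> words (Suc n) Y"
  proof
    fix x assume x: "x \<in> words n Y"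
    then have "x \<in> carrier G" using words_closed[OF Y(1)] by blast
    then show "x \<in> words (Suc n) Y" using x Y(2) by (force intro!: image_eqI[of _ _ "(x, \<one>)"])
  qed
qed auto

lemma words_inv:
  assumes Y: "finite_symmetric Y" and "x \<in> words k Y"
  shows "inv x \<in> words k Y"
  using assms(2)
proof (induction k arbitrary: x)
  case (Suc k)
  have Yc: "Y \<subseteq> carrier G" using Y by (simp add: finite_symmetric_def)
  from Suc.prems obtain z a where za: "x = z \<otimes> a" "z \<in> words k Y" "a \<in> Y" by auto
  then have "inv x = inv a \<otimes> inv z" using words_closed[OF Yc, of k] Yc by (auto intro!: inv_mult_group)
  moreover have "inv a \<in> words 1 Y" using za Y words_one[OF Yc] by (simp add: finite_symmetric_def)
  ultimately show ?case using words_mult[OF Yc, of "inv a" 1 "inv z" k] Suc.IH[OF za(2)] by simp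
qed simp

lemma finite_symmetric_words: "finite_symmetric Y \<Longrightarrow> finite_symmetric (words k Y)"
proof -
  assume Y: "finite_symmetric Y"
  then have "\<one> \<in> words k Y" using words_mono[of Y 0 k] by (auto simp: finite_symmetric_def)
  then show ?thesis using words_inv[OF Y] words_closed[of Y k] words_finite[of Y k] Y by (simp add: finite_symmetric_def)
qed

text \<open>
  A product \<open>x \<otimes> a \<otimes> y\<close> with \<open>x, y \<in> X\<close> and \<open>a\<close> one of \<open>g\<close> and \<open>inv g\<close> determines \<open>x\<close>; that \<open>g\<close> is no product of
  three elements of \<open>X\<close> keeps such products out of \<open>X\<close>.
\<close>

definition switches :: "'a set \<Rightarrow> 'a \<Rightarrow> bool" where
  "switches X g \<longleftrightarrow> g \<in> carrier G \<and> g \<notin> words 3 X \<and>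
     (\<forall>x\<in>X. \<forall>x'\<in>X. \<forall>y\<in>X. \<forall>y'\<in>X. \<forall>a\<in>{g, inv g}. \<forall>b\<in>{g, inv g}.
        x \<otimes> a \<otimes> y = x' \<otimes> b \<otimes> y' \<longrightarrow> x = x')"

text \<open>
  From \<open>x \<otimes> a \<otimes> y = x' \<otimes> b \<otimes> y'\<close> it follows that \<open>inv x' \<otimes> x = b \<otimes> (y' \<otimes> inv y) \<otimes> inv a\<close>, an equation between
  two words of length two that a super-switching element only admits with the value \<open>\<one>\<close>.
\<close>

lemma switches_exists:
  assumes icc: "icc_group G" and X: "finite_symmetric X"
  shows "\<exists>g. switches X g"
proof -
  have Xc: "X \<subseteq> carrier G" "finite X" and Xi: "\<And>x. x \<in> X \<Longrightarrow> inv x \<in> X" using X by (auto simp: finite_symmetric_def)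
  obtain g where g: "g \<in> carrier G" "g \<notin> words 3 X"
    and sw: "\<And>c d a b. c \<in> words 2 X \<Longrightarrow> d \<in> words 2 X \<Longrightarrow> a \<in> {g, inv g} \<Longrightarrow> b \<in> {g, inv g} \<Longrightarrow>
      c = a \<otimes> d \<otimes> b \<Longrightarrow> c = \<one>"
    using super_switching_exists[OF icc words_finite[OF Xc(2), of 2] words_closed[OF Xc(1), of 2]
        words_finite[OF Xc(2), of 3] words_closed[OF Xc(1), of 3]] by blast
  have two: "x \<otimes> y \<in> words 2 X" if "x \<in> X" "y \<in> X" for x y
    using words_mult[OF Xc(1), of x 1 y 1] that words_one[OF Xc(1)] by (simp add: numeral_2_eq_2)
  have "x = x'" if x: "x \<in> X" "x' \<in> X" "y \<in> X" "y' \<in> X" and ab: "a \<in> {g, inv g}" "b \<in> {g, inv g}"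
    and eq: "x \<otimes> a \<otimes> y = x' \<otimes> b \<otimes> y'" for x x' y y' a b
  proof -
    have c: "x \<in> carrier G" "x' \<in> carrier G" "y \<in> carrier G" "y' \<in> carrier G" "a \<in> carrier G" "b \<in> carrier G"
      using x Xc ab g by auto
    have "inv x' \<otimes> x = inv x' \<otimes> (x \<otimes> a \<otimes> y) \<otimes> inv y \<otimes> inv a"
      using c by (simp add: group_arith)
    also have "\<dots> = b \<otimes> (y' \<otimes> inv y) \<otimes> inv a" unfolding eq using c by (simp add: group_arith)
    finally have "inv x' \<otimes> x = \<one>"
      by (rule sw[rotated -1]) (use x ab g Xi two in auto)
    then show ?thesis using c by (metis inv_equality inv_inv inv_closed)
  qed
  then show ?thesis using g unfolding switches_def by blast
qed

definition switching :: "'a set \<Rightarrow> 'a" where "switching X = (SOME g. switches X g)"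

end


locale icc_construction = group G for G :: "('a, 'b) monoid_scheme" (structure) +
  assumes countable_G: "countable (carrier G)" and icc: "icc_group G"
begin

definition enum :: "nat \<Rightarrow> 'a" where "enum = from_nat_into (carrier G)"

text \<open>Records of level \<open>n\<close> are superseded within \<open>horizon n\<close> steps, up to probability \<open>1 / (n + 2)\<^sup>2\<close>.\<close>

definition horizon :: "nat \<Rightarrow> nat" where
  "horizon n = (SOME k. (real (n + 1) / real (n + 2)) ^ k < 1 / (real n + 2)\<^sup>2)"

lemma horizon: "(real (n + 1) / real (n + 2)) ^ horizon n < 1 / (real n + 2)\<^sup>2"
  unfolding horizon_def by (rule someI_ex, rule real_arch_pow_inv) auto

text \<open>
  \<open>alphabet n\<close> contains all steps of level below \<open>n\<close> and the first starting points. The spike of level \<open>n\<close> is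
  chosen after the words of length \<open>horizon n + 3\<close> over this alphabet are known: a start and at most
  \<open>horizon n\<close> steps make up the position before the record or the increment after it, and three letters make
  up a product that straddles an earlier spike. Enumerated elements are added to exhaust the group.
\<close>

primrec alphabet :: "nat \<Rightarrow> 'a set" where
  "alphabet 0 = {\<one>, enum 0, inv (enum 0)}"
| "alphabet (Suc n) = words (horizon n + 3) (alphabet n) \<union>
     {switching (words (horizon n + 3) (alphabet n)), inv (switching (words (horizon n + 3) (alphabet n)))} \<union>
     {enum (Suc n), inv (enum (Suc n))}"

text \<open>
  The positions and the increments that can surround a record of level \<open>n\<close>.
\<close>

definition core :: "nat \<Rightarrow> 'a set" where "core n = words (horizon n + 3) (alphabet n)"

definition spikes :: "nat \<Rightarrow> 'a set" where "spikes n = {switching (core n), inv (switching (core n))}"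

lemma alphabet_Suc: "alphabet (Suc n) = core n \<union> spikes n \<union> {enum (Suc n), inv (enum (Suc n))}"
  by (simp only: core_def spikes_def alphabet.simps)

declare alphabet.simps(2) [simp del]

lemma enum: "enum n \<in> carrier G" "x \<in> carrier G \<Longrightarrow> \<exists>n. x = enum n"
proof -
  have ne: "carrier G \<noteq> {}" using one_closed by blast
  show "enum n \<in> carrier G" unfolding enum_def by (rule from_nat_into[OF ne])
  show "x \<in> carrier G \<Longrightarrow> \<exists>n. x = enum n"
    using range_from_nat_into[OF ne countable_G] unfolding enum_def by force
qed

lemma alphabet_ok: "finite_symmetric (alphabet n)"
proof (induction n)
  case 0
  then show ?case using enum(1)[of 0] by (auto simp: finite_symmetric_def)
next
  case (Suc n)
  have core: "finite_symmetric (core n)" unfolding core_def by (rule finite_symmetric_words[OF Suc])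
  have "switches (core n) (switching (core n))"
    unfolding switching_def by (rule someI_ex[OF switches_exists[OF icc core]])
  then have "switching (core n) \<in> carrier G" by (simp add: switches_def)
  then show ?case unfolding alphabet_Suc using core enum(1)[of "Suc n"] by (auto simp: finite_symmetric_def spikes_def)
qed

lemma core_ok: "finite_symmetric (core n)"
  unfolding core_def by (rule finite_symmetric_words[OF alphabet_ok])

lemma switching_ok: "switches (core n) (switching (core n))"
  unfolding switching_def by (rule someI_ex[OF switches_exists[OF icc core_ok]])

lemma alphabet_closed: "alphabet n \<subseteq> carrier G" and one_alphabet: "\<one> \<in> alphabet n"
  using alphabet_ok[of n] by (auto simp: finite_symmetric_def)

lemma core_closed: "core n \<subseteq> carrier G" and one_core: "\<one> \<in> core n" and finite_core: "finite (core n)"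
  and inv_core: "x \<in> core n \<Longrightarrow> inv x \<in> core n"
  using core_ok[of n] by (auto simp: finite_symmetric_def)

lemma spikes_closed: "spikes n \<subseteq> carrier G"
  using switching_ok[of n] by (auto simp: spikes_def switches_def)

lemma spikes_inv: "a \<in> spikes n \<Longrightarrow> inv a \<in> spikes n"
  using spikes_closed[of n] by (auto simp: spikes_def)

lemma words_alphabet_core: "k \<le> horizon n + 3 \<Longrightarrow> words k (alphabet n) \<subseteq> core n"
  unfolding core_def by (rule words_mono[OF alphabet_closed one_alphabet])

lemma alphabet_core: "alphabet n \<subseteq> core n"
  using words_alphabet_core[of 1 n] words_one[OF alphabet_closed] by simp

lemma core_mono: "m \<le> n \<Longrightarrow> core m \<subseteq> core n"
proof (rule lift_Suc_mono_le[of core])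
  show "core n \<subseteq> core (Suc n)" for n using alphabet_Suc[of n] alphabet_core[of "Suc n"] by blast
qed

lemma alphabet_mono: "m \<le> n \<Longrightarrow> alphabet m \<subseteq> alphabet n"
proof (rule lift_Suc_mono_le[of alphabet])
  show "alphabet n \<subseteq> alphabet (Suc n)" for n using alphabet_Suc[of n] alphabet_core[of n] by blast
qed

lemma spikes_not_core:
  assumes "a \<in> spikes n" "x \<in> core n" "y \<in> core n"
  shows "x \<otimes> a \<otimes> y \<notin> core n"
proof
  assume z: "x \<otimes> a \<otimes> y \<in> core n"
  have c: "a \<in> carrier G" "x \<in> carrier G" "y \<in> carrier G" using assms spikes_closed core_closed by blast+
  have "inv x \<otimes> (x \<otimes> a \<otimes> y) \<otimes> inv y \<in> words 3 (core n)" by (rule words_three[OF core_closed]) (use z assms inv_core in auto)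
  moreover have "inv x \<otimes> (x \<otimes> a \<otimes> y) \<otimes> inv y = a" using c by (simp add: group_arith)
  ultimately have "a \<in> words 3 (core n)" by simp
  moreover from this have "inv a \<in> words 3 (core n)" by (rule words_inv[OF core_ok])
  ultimately show False using switching_ok[of n] assms(1) by (auto simp: spikes_def switches_def)
qed

text \<open>
  The possible positions while a record of level \<open>n\<close> is in force. By the choice of the spikes the shells are
  disjoint, and \<open>shell m \<subseteq> core n\<close> for \<open>m < n\<close>.
\<close>

definition shell :: "nat \<Rightarrow> 'a set" where
  "shell n = {x \<otimes> a \<otimes> y | x a y. x \<in> core n \<and> a \<in> spikes n \<and> y \<in> core n}"

lemma shell_not_core: "v \<in> shell n \<Longrightarrow> v \<notin> core n"
  using spikes_not_core by (auto simp: shell_def)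

lemma shell_core_Suc: "shell n \<subseteq> core (Suc n)"
proof
  fix v assume "v \<in> shell n"
  then obtain x a y where v: "v = x \<otimes> a \<otimes> y" "x \<in> core n" "a \<in> spikes n" "y \<in> core n" by (auto simp: shell_def)
  then have "x \<in> alphabet (Suc n)" "a \<in> alphabet (Suc n)" "y \<in> alphabet (Suc n)"
    unfolding alphabet_Suc by auto
  then have "x \<otimes> a \<otimes> y \<in> words 3 (alphabet (Suc n))"
    by (rule words_three[OF alphabet_closed])
  then show "v \<in> core (Suc n)" using words_alphabet_core[of 3 "Suc n"] v by auto
qed

lemma shell_less_core: "m < n \<Longrightarrow> shell m \<subseteq> core n"
  using shell_core_Suc[of m] core_mono[of "Suc m" n] by auto

lemma shell_disjoint: "v \<in> shell m \<Longrightarrow> v \<in> shell n \<Longrightarrow> m = n"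
  using shell_less_core[of m n] shell_less_core[of n m] shell_not_core by (cases m n rule: linorder_cases) auto

lemma shell_closed: "shell n \<subseteq> carrier G"
  using shell_core_Suc core_closed by blast

lemma finite_shell: "finite (shell n)"
  using finite_subset[OF shell_core_Suc finite_core] .

text \<open>
  After a record of level \<open>n\<close>, the next record has level at least \<open>growth n\<close> with probability of order
  \<open>(n + 2) / growth n\<close>; this is summable for a cubic bound.
\<close>

definition growth :: "nat \<Rightarrow> nat" where "growth n = (n + 2) ^ 3"

text \<open>
  Without the bound on \<open>n\<close> the vertices would have children in all higher shells. A vertex whose level exceeds
  the bound is a root.
\<close>

definition C :: "('a \<times> 'a) set" where
  "C = {(w, v). \<exists>m n. w \<in> shell m \<and> m < n \<and> n \<le> growth m \<and> (\<exists>a\<in>spikes n. \<exists>y\<in>core n. v = w \<otimes> a \<otimes> y)}"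

definition rk :: "'a \<Rightarrow> nat" where "rk v = (THE n. v \<in> shell n)"

lemma rk_eq: "v \<in> shell n \<Longrightarrow> rk v = n"
  unfolding rk_def using shell_disjoint by blast

lemma C_shell: "(w, v) \<in> C \<Longrightarrow> w \<in> shell (rk w) \<and> v \<in> shell (rk v) \<and> rk w < rk v \<and> rk v \<le> growth (rk w) \<and>
    (\<exists>a\<in>spikes (rk v). \<exists>y\<in>core (rk v). v = w \<otimes> a \<otimes> y)"
proof -
  assume "(w, v) \<in> C"
  then obtain m n where mn: "w \<in> shell m" "m < n" "n \<le> growth m" "\<exists>a\<in>spikes n. \<exists>y\<in>core n. v = w \<otimes> a \<otimes> y"
    by (auto simp: C_def)
  then have "w \<in> core n" using shell_less_core by blast
  then have "v \<in> shell n" using mn(4) by (auto simp: shell_def)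
  then show ?thesis using mn rk_eq[OF mn(1)] rk_eq[of v n] by simp
qed

sublocale ranked_forest "carrier G" C rk
proof
  show "C \<subseteq> carrier G \<times> carrier G" using C_shell shell_closed by fastforce
  show "rk p < rk c" if "(p, c) \<in> C" for p c using C_shell[OF that] by simp
  show "p = p'" if pc: "(p, c) \<in> C" "(p', c) \<in> C" for p p' c
  proof -
    obtain a y a' y' where c: "a \<in> spikes (rk c)" "y \<in> core (rk c)" "c = p \<otimes> a \<otimes> y"
      "a' \<in> spikes (rk c)" "y' \<in> core (rk c)" "c = p' \<otimes> a' \<otimes> y'"
      using C_shell[OF pc(1)] C_shell[OF pc(2)] by metis
    have "p \<in> core (rk c)" "p' \<in> core (rk c)"
      using C_shell[OF pc(1)] C_shell[OF pc(2)] shell_less_core by blast+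
    moreover have "p \<otimes> a \<otimes> y = p' \<otimes> a' \<otimes> y'" using c by simp
    ultimately show ?thesis using switching_ok[of "rk c"] c unfolding switches_def spikes_def by blast
  qed
  show "finite {c. (p, c) \<in> C}" for p
  proof (rule finite_subset)
    show "{c. (p, c) \<in> C} \<subseteq> (\<Union>n\<le>growth (rk p). shell n)" using C_shell by blast
    show "finite (\<Union>n\<le>growth (rk p). shell n)" using finite_shell by auto
  qed
qed


text \<open>
  Every level contains its two spikes; the enumerated elements are thrown in so that every group element has
  a level.
\<close>

definition lev :: "'a \<Rightarrow> nat" where "lev x = (LEAST n. x \<in> spikes n \<union> {enum n, inv (enum n)})"

lemma lev_mem: "x \<in> carrier G \<Longrightarrow> x \<in> spikes (lev x) \<union> {enum (lev x), inv (enum (lev x))}"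
  proof -
  assume "x \<in> carrier G"
  then obtain n where "x \<in> spikes n \<union> {enum n, inv (enum n)}" using enum(2)[of x] by auto
  then show ?thesis unfolding lev_def by (rule LeastI)
qed

lemma enum_alphabet: "k \<le> n \<Longrightarrow> enum k \<in> alphabet n \<and> inv (enum k) \<in> alphabet n"
proof -
  assume "k \<le> n"
  moreover have "enum k \<in> alphabet k \<and> inv (enum k) \<in> alphabet k"
    by (cases k) (simp_all add: alphabet_Suc)
  ultimately show ?thesis using alphabet_mono[of k n] by blast
qed

lemma alphabet_exhausts: "u \<in> carrier G \<Longrightarrow> \<exists>n. u \<in> alphabet n"
  using enum(2)[of u] enum_alphabet by blast

lemma lev_less_alphabet: "x \<in> carrier G \<Longrightarrow> lev x < n \<Longrightarrow> x \<in> alphabet n"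
proof -
  assume x: "x \<in> carrier G" "lev x < n"
  have "spikes (lev x) \<subseteq> alphabet n"
    using alphabet_Suc[of "lev x"] alphabet_mono[of "Suc (lev x)" n] x(2) by auto
  then show ?thesis using lev_mem[OF x(1)] enum_alphabet[of "lev x" n] x(2) by auto
qed

lemma lev_spikes: "a \<in> spikes n \<Longrightarrow> lev a = n"
proof -
  assume a: "a \<in> spikes n"
  have "lev a \<le> n" unfolding lev_def by (rule Least_le) (use a in simp)
  moreover have "\<not> lev a < n"
  proof
    assume "lev a < n"
    then have "a \<in> core n" using lev_less_alphabet alphabet_core a spikes_closed by blast
    then show False using spikes_not_core[OF a one_core one_core] a spikes_closed[of n] by auto
  qed
  ultimately show ?thesis by simp
qed

lemma lev_inv: "x \<in> carrier G \<Longrightarrow> lev (inv x) = lev x"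
proof -
  have "inv x \<in> spikes n \<union> {enum n, inv (enum n)} \<longleftrightarrow> x \<in> spikes n \<union> {enum n, inv (enum n)}" if "x \<in> carrier G" for x n
    using that spikes_inv[of x n] spikes_inv[of "inv x" n] enum(1)[of n] inv_inv[of x] by auto (metis inv_inv)+
  then show "x \<in> carrier G \<Longrightarrow> lev (inv x) = lev x" unfolding lev_def by simp
qed

text \<open>
  The four conditions concern a record of level \<open>n\<close>: it is superseded in time, it is a spike, it is not tied,
  and it is not followed by too high a jump.
\<close>

definition tame :: "nat \<Rightarrow> (nat \<Rightarrow> 'a) \<Rightarrow> bool" where
  "tame N x \<longleftrightarrow> (\<forall>n\<ge>N.
     (\<exists>i<horizon n. n < lev (x i)) \<and>
     (\<forall>i. (\<forall>j<i. lev (x j) < n) \<longrightarrow> lev (x i) = n \<longrightarrow> x i \<in> spikes n) \<and>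
     (\<forall>i j. i < j \<longrightarrow> (\<forall>k<j. k \<noteq> i \<longrightarrow> lev (x k) < n) \<longrightarrow> lev (x i) = n \<longrightarrow> lev (x j) \<noteq> n) \<and>
     (\<forall>i. (\<forall>j<i. lev (x j) \<le> n) \<longrightarrow> lev (x i) \<le> growth n))"

end

locale tame_steps = icc_construction +
  fixes x :: "nat \<Rightarrow> 'a" and N :: nat
  assumes steps: "\<And>i. x i \<in> carrier G" and tame: "tame N x"
begin

lemma level_exceeded: "n \<ge> N \<Longrightarrow> \<exists>i<horizon n. n < lev (x i)"
  and record_letter: "n \<ge> N \<Longrightarrow> (\<And>j. j < i \<Longrightarrow> lev (x j) < n) \<Longrightarrow> lev (x i) = n \<Longrightarrow> x i \<in> spikes n"
  and no_tie: "n \<ge> N \<Longrightarrow> i < j \<Longrightarrow> (\<And>k. k < j \<Longrightarrow> k \<noteq> i \<Longrightarrow> lev (x k) < n) \<Longrightarrow> lev (x i) = n \<Longrightarrow> lev (x j) \<noteq> n"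
  and slow_growth: "n \<ge> N \<Longrightarrow> (\<And>j. j < i \<Longrightarrow> lev (x j) \<le> n) \<Longrightarrow> lev (x i) \<le> growth n"
  using tame unfolding tame_def by blast+

text \<open>
  The record of level \<open>n\<close> at time \<open>s\<close> is in force at time \<open>i\<close>. Since the step \<open>x s\<close> leads to the position at time
  \<open>Suc s\<close>, the position before the record is the one at time \<open>s\<close>.
\<close>

definition last_record :: "nat \<Rightarrow> nat \<Rightarrow> nat \<Rightarrow> bool" where
  "last_record i n s \<longleftrightarrow> s < i \<and> lev (x s) = n \<and> (\<forall>j<s. lev (x j) < n) \<and> (\<forall>j<i. lev (x j) \<le> n)"

lemma last_record_exists:
  assumes "i > 0"
  obtains n s where "last_record i n s"
proof -
  define n where "n = Max ((\<lambda>j. lev (x j)) ` {..<i})"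
  have n: "n \<in> (\<lambda>j. lev (x j)) ` {..<i}" "\<And>j. j < i \<Longrightarrow> lev (x j) \<le> n"
    using assms unfolding n_def by (auto intro!: Max_in)
  define s where "s = (LEAST j. lev (x j) = n)"
  obtain j where j: "j < i" "lev (x j) = n" using n(1) by auto
  have s: "lev (x s) = n" unfolding s_def by (rule LeastI) (rule j(2))
  have "s \<le> j" unfolding s_def by (rule Least_le) (rule j(2))
  have "lev (x k) < n" if "k < s" for k
    using not_less_Least[of k "\<lambda>j. lev (x j) = n"] that n(2)[of k] \<open>s \<le> j\<close> j(1) unfolding s_def[symmetric] by fastforce
  then have "last_record i n s" using s n(2) \<open>s \<le> j\<close> j(1) by (auto simp: last_record_def)
  then show ?thesis by (rule that)
qed

lemma walk_words:
  assumes "u \<in> carrier G" "p \<le> i" "\<And>j. p \<le> j \<Longrightarrow> j < i \<Longrightarrow> x j \<in> Y" "Y \<subseteq> carrier G"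
  shows "\<exists>w\<in>words (i - p) Y. walk G u x i = walk G u x p \<otimes> w"
  using assms(2,3)
proof (induction i rule: dec_induct)
  case base
  have "walk G u x p \<in> carrier G" using assms(1) steps by (induction p) auto
  then show ?case by simp
next
  case (step i)
  then obtain w where w: "w \<in> words (i - p) Y" "walk G u x i = walk G u x p \<otimes> w" by auto
  have "walk G u x p \<in> carrier G" using assms(1) steps by (induction p) auto
  moreover have "w \<in> carrier G" using w words_closed[OF assms(4)] by blast
  moreover have xi: "x i \<in> Y" using step by simp
  ultimately have "walk G u x (Suc i) = walk G u x p \<otimes> (w \<otimes> x i)" using w(2) steps by (simp add: m_assoc)
  moreover have "w \<otimes> x i \<in> words (Suc i - p) Y"
    using w(1) xi step.hyps by (force simp: Suc_diff_le)
  ultimately show ?case by blast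
qed

text \<open>
  While the record is in force, all steps other than the record itself have lower levels, because a tie is
  excluded; and their number is at most the horizon, since otherwise the record would have been superseded.
\<close>

lemma walk_decomposition:
  assumes u: "u \<in> alphabet N" and r: "last_record i n s" and n: "n \<ge> N"
  shows "walk G u x s \<in> core n" "x s \<in> spikes n" "\<exists>w\<in>core n. walk G u x i = walk G u x s \<otimes> x s \<otimes> w"
proof -
  have r': "s < i" "lev (x s) = n" "\<And>j. j < s \<Longrightarrow> lev (x j) < n" "\<And>j. j < i \<Longrightarrow> lev (x j) \<le> n"
    using r by (auto simp: last_record_def)
  have less: "lev (x j) < n" if "j < i" "j \<noteq> s" for j
    using that
  proof (induction j rule: less_induct)
    case (less j)
    show ?case
    proof (cases "j < s")
      case False
      then have "lev (x j) \<noteq> n" using less by (intro no_tie[OF n, of s j] r'(2)) auto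
      then show ?thesis using r'(4)[of j] less.prems by auto
    qed (rule r'(3))
  qed
  obtain i0 where i0: "i0 < horizon n" "n < lev (x i0)" using level_exceeded[OF n] by blast
  then have i: "i \<le> horizon n" using r'(4)[of i0] by force
  have Y: "x j \<in> alphabet n" if "j < i" "j \<noteq> s" for j using lev_less_alphabet[OF steps less[OF that]] .
  have un: "u \<in> alphabet n" using u alphabet_mono[OF n] by blast
  then have uc: "u \<in> carrier G" using alphabet_closed by blast
  show "x s \<in> spikes n" by (rule record_letter[OF n r'(3) r'(2)])
  obtain w where w: "w \<in> words (s - 0) (alphabet n)" "walk G u x s = walk G u x 0 \<otimes> w"
    using walk_words[OF uc, of 0 s "alphabet n"] Y r'(1) alphabet_closed by auto
  have "walk G u x s \<in> words (1 + s) (alphabet n)"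
    using words_mult[OF alphabet_closed[of n], of u 1 w s] w un words_one[OF alphabet_closed[of n]]
    by (simp del: words.simps)
  then show "walk G u x s \<in> core n" using words_alphabet_core[of "1 + s" n] i r'(1) by auto
  obtain w' where w': "w' \<in> words (i - Suc s) (alphabet n)" "walk G u x i = walk G u x (Suc s) \<otimes> w'"
    using walk_words[OF uc, of "Suc s" i "alphabet n"] Y r'(1) alphabet_closed by auto
  moreover have "w' \<in> core n" using w'(1) words_alphabet_core[of "i - Suc s" n] i by force
  ultimately show "\<exists>w\<in>core n. walk G u x i = walk G u x s \<otimes> x s \<otimes> w" by auto
qed

lemma walk_shell: "u \<in> alphabet N \<Longrightarrow> last_record i n s \<Longrightarrow> n \<ge> N \<Longrightarrow> walk G u x i \<in> shell n"
  using walk_decomposition[of u i n s] unfolding shell_def by blast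

text \<open>
  The previous record bounds the level of the current one by \<open>growth\<close>.
\<close>

lemma walk_edge:
  assumes u: "u \<in> alphabet N" and r: "last_record i n s" and r': "last_record s n' s'" "n' \<ge> N"
  shows "(walk G u x s, walk G u x i) \<in> C"
proof -
  have "n' < n" "n = lev (x s)" using r r' by (auto simp: last_record_def)
  moreover have "lev (x s) \<le> growth n'" by (rule slow_growth[OF r'(2)]) (use r'(1) in \<open>simp add: last_record_def\<close>)
  ultimately show ?thesis
    unfolding C_def using walk_shell[OF u r'] walk_decomposition[OF u r] r'(2) by auto
qed


definition is_record :: "nat \<Rightarrow> bool" where "is_record r \<longleftrightarrow> (\<forall>j<r. lev (x j) < lev (x r))"

lemma late_record:
  assumes "N \<le> lev (x t)"
  obtains r n s where "t < r" "is_record r" "last_record r n s" "N \<le> n" "K \<le> n"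
proof -
  obtain i where i: "max N K < lev (x i)" using level_exceeded[of "max N K"] by auto
  define m where "m = Max ((\<lambda>j. lev (x j)) ` {..max i t})"
  have m: "lev (x j) \<le> m" if "j \<le> max i t" for j unfolding m_def by (rule Max_ge) (use that in auto)
  define r where "r = (LEAST r. m < lev (x r))"
  have "\<exists>r. m < lev (x r)" using level_exceeded[of "max N m"] by auto
  then have r: "m < lev (x r)" unfolding r_def by (rule LeastI_ex)
  have "lev (x j) \<le> m" if "j < r" for j using not_less_Least[of j "\<lambda>r. m < lev (x r)"] that unfolding r_def by auto
  then have rec: "is_record r" using r by (force simp: is_record_def)
  have big: "max i t < r" using m[of r] r by (meson not_le)
  obtain n s where ns: "last_record r n s" using last_record_exists[of r] big by auto
  then have "lev (x i) \<le> n" "lev (x t) \<le> n" using big by (auto simp: last_record_def)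
  then show ?thesis using that[OF _ rec ns] big i assms by auto
qed

lemma last_record_after:
  assumes "is_record r" "r < i" "last_record i n s"
  shows "r \<le> s"
  using assms unfolding is_record_def last_record_def by (meson leD not_le)

lemma edge_after:
  assumes u: "u \<in> alphabet N" and t: "N \<le> lev (x t)" and r: "t < r" "is_record r" "r < i" "last_record i n s"
  shows "(walk G u x s, walk G u x i) \<in> C"
proof -
  have s: "t < s" using last_record_after[OF r(2-4)] r(1) by simp
  then obtain n' s' where ns': "last_record s n' s'" using last_record_exists[of s] by auto
  then have "N \<le> n'" using s t unfolding last_record_def by (meson le_trans)
  then show ?thesis using walk_edge[OF u r(4) ns'] by simp
qed

text \<open>
  Climbing from the position at time \<open>i\<close> to its parent means going back to the time of the last record, which
  is never before \<open>r\<close>.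
\<close>

lemma record_ancestor:
  assumes u: "u \<in> alphabet N" and t: "N \<le> lev (x t)" and r: "t < r" "is_record r" and "r \<le> i"
  shows "walk G u x r \<in> anc (walk G u x i)"
  using \<open>r \<le> i\<close>
proof (induction i rule: less_induct)
  case (less i)
  show ?case
  proof (cases "i = r")
    case False
    then have "r < i" using less by simp
    obtain n s where ns: "last_record i n s" using last_record_exists[of i] \<open>r < i\<close> by auto
    have "s < i" using ns by (simp add: last_record_def)
    then have "walk G u x r \<in> anc (walk G u x s)"
      using less.IH last_record_after[OF r(2) \<open>r < i\<close> ns] by simp
    then show ?thesis using anc_child[OF edge_after[OF u t r \<open>r < i\<close> ns]] by simp
  qed simp
qed

lemma record_stem:
  assumes "u \<in> alphabet N" "N \<le> lev (x t)" "t < r" "is_record r"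
  shows "walk G u x r \<in> stem (walk G u x)"
  using record_ancestor[OF assms] by (auto simp: stem_def eventually_sequentially)

lemma late_time: "\<exists>t. N \<le> lev (x t)"
  using level_exceeded[of N] by (auto intro: less_imp_le)

lemma unbounded_rk_infinite: "(\<And>K. \<exists>w\<in>S. K \<le> rk w) \<Longrightarrow> infinite S"
proof
  assume unb: "\<And>K. \<exists>w\<in>S. K \<le> rk w" and "finite S"
  obtain w where w: "w \<in> S" "Suc (Max (rk ` S)) \<le> rk w" using unb by blast
  have "rk w \<le> Max (rk ` S)" by (rule Max_ge) (use \<open>finite S\<close> w in auto)
  then show False using w by simp
qed

lemma walk_translate: "g \<in> carrier G \<Longrightarrow> u \<in> carrier G \<Longrightarrow> walk G (g \<otimes> u) x n = g \<otimes> walk G u x n \<and> walk G u x n \<in> carrier G"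
  by (induction n) (simp_all add: m_assoc steps)

lemma tame_translate:
  assumes u: "u \<in> alphabet N" and g: "g \<in> carrier G" "g \<otimes> u \<in> alphabet N"
  shows "infinite {w \<in> stem (walk G u x). g \<otimes> w \<in> stem (walk G (g \<otimes> u) x)}"
proof (rule unbounded_rk_infinite)
  fix K
  have uc: "u \<in> carrier G" using u alphabet_closed by blast
  obtain t where t: "N \<le> lev (x t)" using late_time ..
  obtain r n s where r: "t < r" "is_record r" "last_record r n s" "N \<le> n" "K \<le> n" using late_record[OF t] .
  have "g \<otimes> walk G u x r \<in> stem (walk G (g \<otimes> u) x)"
    using record_stem[OF g(2) t r(1,2)] walk_translate[OF g(1) uc] by simp
  moreover have "rk (walk G u x r) = n" using rk_eq[OF walk_shell[OF u r(3,4)]] .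
  ultimately show "\<exists>w\<in>{w \<in> stem (walk G u x). g \<otimes> w \<in> stem (walk G (g \<otimes> u) x)}. K \<le> rk w"
    using record_stem[OF u t r(1,2)] r(5) by auto
qed

text \<open>
  The translated walk has the same steps, so at a record time both walks are at vertices of the same rank, and
  a stem contains only one vertex of each rank.
\<close>

lemma tame_moved:
  assumes u: "u \<in> alphabet N" and g: "g \<in> carrier G" "g \<otimes> u \<in> alphabet N"
    and eq: "stem (walk G (g \<otimes> u) x) = stem (walk G u x)"
  shows "g = \<one>"
proof -
  have uc: "u \<in> carrier G" using u alphabet_closed by blast
  obtain t where t: "N \<le> lev (x t)" using late_time ..
  obtain r n s where r: "t < r" "is_record r" "last_record r n s" "N \<le> n" using late_record[OF t] .
  let ?w = "walk G u x r"
  have w: "g \<otimes> ?w = walk G (g \<otimes> u) x r" "?w \<in> carrier G" using walk_translate[OF g(1) uc] by simp_all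
  have "rk (g \<otimes> ?w) = rk ?w"
    unfolding w(1) using rk_eq[OF walk_shell[OF u r(3,4)]] rk_eq[OF walk_shell[OF g(2) r(3,4)]] by simp
  moreover have "g \<otimes> ?w \<in> stem (walk G u x)" "?w \<in> stem (walk G u x)"
    using record_stem[OF g(2) t r(1,2)] record_stem[OF u t r(1,2)] eq w(1) by simp_all
  ultimately have "g \<otimes> ?w = ?w" by (intro stem_rk_inj)
  then show ?thesis using w(2) g(1) by simp
qed

text \<open>
  As long as the last record is late, the parent of a position is an earlier position. So the ancestors
  of all positions are positions themselves, up to the finitely many ancestors of early positions.
\<close>

lemma tame_visited:
  assumes u: "u \<in> alphabet N"
  shows "finite (stem (walk G u x) - range (walk G u x))"
proof -
  obtain t where t: "N \<le> lev (x t)" using late_time ..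
  obtain r where r: "t < r" "is_record r" using late_record[OF t] .
  let ?B = "\<Union>j\<in>{..r}. anc (walk G u x j)"
  have "anc (walk G u x i) \<subseteq> range (walk G u x) \<union> ?B" for i
  proof (induction i rule: less_induct)
    case (less i)
    show ?case
    proof (cases "i \<le> r")
      case False
      then have "r < i" by simp
      obtain n s where ns: "last_record i n s" using last_record_exists[of i] \<open>r < i\<close> by auto
      have "s < i" using ns by (simp add: last_record_def)
      then show ?thesis using less anc_child[OF edge_after[OF u t r \<open>r < i\<close> ns]] by auto
    qed auto
  qed
  then have "stem (walk G u x) - range (walk G u x) \<subseteq> ?B"
    by (auto simp: stem_def eventually_sequentially) blast
  then show ?thesis by (rule finite_subset) (simp add: finite_anc)
qed

end

context icc_construction begin

definition steps_of :: "(nat \<Rightarrow> 'a) \<Rightarrow> nat \<Rightarrow> 'a" where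
  "steps_of y i = inv (y i) \<otimes> y (Suc i)"

lemma walk_steps_of: "(\<And>i. y i \<in> carrier G) \<Longrightarrow> walk G (y 0) (steps_of y) = y"
proof
  fix n assume y: "\<And>i. y i \<in> carrier G"
  show "walk G (y 0) (steps_of y) n = y n"
    by (induction n) (simp_all add: steps_of_def group_arith y)
qed

lemma steps_of_walk: "u \<in> carrier G \<Longrightarrow> (\<And>i. x i \<in> carrier G) \<Longrightarrow> steps_of (walk G u x) = x"
proof
  fix n assume "u \<in> carrier G" "\<And>i. x i \<in> carrier G"
  moreover from this have "walk G u x n \<in> carrier G" by (induction n) auto
  ultimately show "steps_of (walk G u x) n = x n" by (simp add: steps_of_def group_arith)
qed

definition tame_path :: "(nat \<Rightarrow> 'a) \<Rightarrow> bool" where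
  "tame_path y \<longleftrightarrow> (\<exists>N. tame N (steps_of y))"

lemma tame_path_steps:
  assumes y: "\<And>i. y i \<in> carrier G" and "tame_path y" and g: "g \<in> carrier G"
  obtains N where "tame_steps G (steps_of y) N" "y 0 \<in> alphabet N" "g \<otimes> y 0 \<in> alphabet N"
proof -
  obtain N where N: "tame N (steps_of y)" using assms(2) by (auto simp: tame_path_def)
  obtain m where m: "y 0 \<in> alphabet m" using alphabet_exhausts[OF y[of 0]] ..
  obtain k where k: "g \<otimes> y 0 \<in> alphabet k" using alphabet_exhausts[OF m_closed[OF g y[of 0]]] ..
  let ?N = "max N (max m k)"
  have "tame ?N (steps_of y)" using N unfolding tame_def by simp
  then have "tame_steps G (steps_of y) ?N"
    by unfold_locales (auto simp: steps_of_def y)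
  moreover have "y 0 \<in> alphabet ?N" by (rule subsetD[OF alphabet_mono m]) simp
  moreover have "g \<otimes> y 0 \<in> alphabet ?N" by (rule subsetD[OF alphabet_mono k]) simp
  ultimately show ?thesis by (rule that)
qed

lemma tame_path_stem:
  assumes y: "\<And>i. y i \<in> carrier G" and "tame_path y"
  shows "infinite (stem y)" "finite (stem y - range y)"
    and "g \<in> carrier G \<Longrightarrow> infinite {w \<in> stem y. g \<otimes> w \<in> stem (path_translate G g y)}"
    and "g \<in> carrier G \<Longrightarrow> g \<noteq> \<one> \<Longrightarrow> stem (path_translate G g y) \<noteq> stem y"
proof -
  have *: "finite (stem y - range y) \<and> infinite {w \<in> stem y. g \<otimes> w \<in> stem (path_translate G g y)} \<and>
      (g \<noteq> \<one> \<longrightarrow> stem (path_translate G g y) \<noteq> stem y)" if g: "g \<in> carrier G" for g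
  proof -
    obtain N where N: "tame_steps G (steps_of y) N" "y 0 \<in> alphabet N" "g \<otimes> y 0 \<in> alphabet N"
      using tame_path_steps[OF y assms(2) g] .
    interpret T: tame_steps G "steps_of y" N by (rule N(1))
    have w: "walk G (y 0) (steps_of y) = y" by (rule walk_steps_of[OF y])
    have gw: "walk G (g \<otimes> y 0) (steps_of y) = path_translate G g y"
      using T.walk_translate[OF g y[of 0]] w by (auto simp: path_translate_def)
    show ?thesis
      using T.tame_visited[OF N(2)] T.tame_translate[OF N(2) g N(3)] T.tame_moved[OF N(2) g N(3)]
      unfolding w gw by blast
  qed
  show "finite (stem y - range y)" using *[of \<one>] by simp
  have "infinite {w \<in> stem y. \<one> \<otimes> w \<in> stem (path_translate G \<one> y)}" using *[of \<one>] by simp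
  then show "infinite (stem y)" by (rule contrapos_nn) simp
  show "g \<in> carrier G \<Longrightarrow> infinite {w \<in> stem y. g \<otimes> w \<in> stem (path_translate G g y)}" using * by blast
  show "g \<in> carrier G \<Longrightarrow> g \<noteq> \<one> \<Longrightarrow> stem (path_translate G g y) \<noteq> stem y" using * by blast
qed

end

section \<open>The step distribution\<close>

definition level_pmf :: "nat pmf" where
  "level_pmf = embed_pmf (\<lambda>n. 1 / ((real n + 1) * (real n + 2)))"

lemma level_sum: "(\<Sum>k<n. 1 / ((real k + 1) * (real k + 2))) = 1 - 1 / (real n + 1)"
proof (induction n)
  case (Suc n)
  have "(1 :: real) - 1 / (real n + 1) + 1 / ((real n + 1) * (real n + 2)) = 1 - 1 / (real (Suc n) + 1)"
    by (simp add: divide_simps) (simp add: algebra_simps)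
  then show ?case using Suc by simp
qed simp

lemma level_sums: "(\<lambda>n. 1 / ((real n + 1) * (real n + 2))) sums 1"
proof -
  have "(\<lambda>n. 1 - 1 / (real n + 1)) \<longlonglongrightarrow> 1 - 0"
    using LIMSEQ_inverse_real_of_nat by (intro tendsto_diff tendsto_const) (simp add: inverse_eq_divide add.commute)
  then show ?thesis unfolding sums_def level_sum by simp
qed

lemma pmf_level: "pmf level_pmf n = 1 / ((real n + 1) * (real n + 2))"
proof -
  let ?f = "\<lambda>n. 1 / ((real n + 1) * (real n + 2))"
  have "(\<integral>\<^sup>+ n. ennreal (?f n) \<partial>count_space UNIV) = 1"
    unfolding nn_integral_count_space_nat by (subst suminf_ennreal_eq[OF _ level_sums]) simp_all
  from pmf_embed_pmf[of ?f n, OF _ this] show ?thesis unfolding level_pmf_def by simp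
qed

lemma measure_level_less: "measure level_pmf {..<n} = 1 - 1 / (real n + 1)"
  by (simp add: measure_measure_pmf_finite pmf_level level_sum)

lemma measure_level_ge: "measure level_pmf {n..} = 1 / (real n + 1)"
proof -
  have "{n..} = UNIV - {..<n}" by auto
  then show ?thesis using measure_pmf.prob_compl[of "{..<n}" level_pmf] measure_level_less by simp
qed


context random_walk begin

lemma letter_event: "Z \<subseteq> carrier G \<Longrightarrow> {x \<in> space W. x i \<in> Z} \<in> sets W"
proof -
  assume "Z \<subseteq> carrier G"
  then have "(\<lambda>x. x i) -` Z \<inter> space W \<in> sets W" by (intro measurable_sets[OF measurable_letter]) simp
  then show ?thesis by (simp add: vimage_def Int_def conj_commute)
qed

lemma measure_step: "Z \<subseteq> carrier G \<Longrightarrow> measure step Z = measure \<mu> Z"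
  by (rule measure_restrict_space) auto

lemma measure_letters:
  fixes k :: nat
  assumes "\<And>j. j < k \<Longrightarrow> F j \<subseteq> carrier G"
  shows "measure W {x \<in> space W. \<forall>j<k. x j \<in> F j} = (\<Prod>j<k. measure \<mu> (F j))"
proof -
  have "{x \<in> space W. \<forall>j<k. x j \<in> F j} = prod_emb UNIV (\<lambda>_. step) {..<k} (Pi\<^sub>E {..<k} F)"
    by (auto simp: prod_emb_def space_W space_step Pi_iff)
  also have "measure W \<dots> = (\<Prod>j<k. measure step (F j))"
    unfolding W_eq by (rule inc.measure_PiM_emb) (use assms in \<open>auto simp: sets_step\<close>)
  also have "\<dots> = (\<Prod>j<k. measure \<mu> (F j))"
    by (intro prod.cong refl measure_step assms) auto
  finally show ?thesis .
qed

lemma letters_event: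
  fixes k :: nat
  assumes "\<And>j. j < k \<Longrightarrow> F j \<subseteq> carrier G"
  shows "{x \<in> space W. \<forall>j<k. x j \<in> F j} \<in> sets W"
proof -
  have "{x \<in> space W. \<forall>j\<in>{..<k}. x j \<in> F j} \<in> sets W"
  proof (rule sets.sets_Collect_finite_All)
    show "{x \<in> space W. x j \<in> F j} \<in> sets W" if "j \<in> {..<k}" for j
      by (rule letter_event) (use that assms in simp)
  qed simp
  then show ?thesis unfolding Ball_def lessThan_iff .
qed

lemma union_bound:
  assumes A: "\<And>i. A i \<in> sets W" "\<And>i. measure W (A i) \<le> u ^ i * c" and u: "0 \<le> u" "u < 1"
  shows "measure W (\<Union>i. A i) \<le> c / (1 - u)"
proof -
  interpret prob_space W by (rule prob_space_W)
  have s: "(\<lambda>i. u ^ i * c) sums (1 / (1 - u) * c)" using u by (intro sums_mult2 geometric_sums) simp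
  have sm: "summable (\<lambda>i. measure W (A i))"
    by (rule summable_comparison_test'[OF sums_summable[OF s], of 0]) (use A(2) in simp)
  have "measure W (\<Union>i. A i) \<le> (\<Sum>i. measure W (A i))"
    by (rule finite_measure_subadditive_countably) (use A(1) sm in auto)
  also have "\<dots> \<le> (\<Sum>i. u ^ i * c)" by (rule suminf_le[OF A(2) sm sums_summable[OF s]])
  finally show ?thesis using sums_unique[OF s] by simp
qed

text \<open>
  Summed over the time of the step into \<open>Z\<close>, the probabilities form a geometric series.
\<close>

lemma first_visit:
  assumes U: "U \<subseteq> carrier G" "measure \<mu> U < 1" and Z: "Z \<subseteq> carrier G"
  shows "measure W (\<Union>i::nat. {x \<in> space W. (\<forall>j<i. x j \<in> U) \<and> x i \<in> Z}) \<le> measure \<mu> Z / (1 - measure \<mu> U)"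
proof (rule union_bound)
  fix i :: nat
  let ?F = "\<lambda>j. if j < i then U else Z"
  have eq: "{x \<in> space W. (\<forall>j<i. x j \<in> U) \<and> x i \<in> Z} = {x \<in> space W. \<forall>j<Suc i. x j \<in> ?F j}"
    by (auto simp: less_Suc_eq)
  show "{x \<in> space W. (\<forall>j<i. x j \<in> U) \<and> x i \<in> Z} \<in> sets W"
    unfolding eq by (rule letters_event) (use U Z in auto)
  have "measure W {x \<in> space W. \<forall>j<Suc i. x j \<in> ?F j} = (\<Prod>j<Suc i. measure \<mu> (?F j))"
    by (rule measure_letters) (use U Z in auto)
  also have "\<dots> = measure \<mu> U ^ i * measure \<mu> Z" by simp
  finally show "measure W {x \<in> space W. (\<forall>j<i. x j \<in> U) \<and> x i \<in> Z} \<le> measure \<mu> U ^ i * measure \<mu> Z"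
    unfolding eq by simp
qed (use U in auto)

lemma two_visits_at:
  fixes i d :: nat
  assumes U: "U \<subseteq> carrier G" and Z: "Z \<subseteq> carrier G"
  defines "A \<equiv> {x \<in> space W. (\<forall>k<i + Suc d. k \<noteq> i \<longrightarrow> x k \<in> U) \<and> x i \<in> Z \<and> x (i + Suc d) \<in> Z}"
  shows "A \<in> sets W \<and> measure W A \<le> measure \<mu> U ^ d * (measure \<mu> U ^ i * measure \<mu> Z * measure \<mu> Z)"
proof -
  let ?F = "\<lambda>k. if k = i \<or> k = i + Suc d then Z else U"
  have eq: "A = {x \<in> space W. \<forall>k<Suc (i + Suc d). x k \<in> ?F k}"
    unfolding A_def
  proof (intro Collect_cong conj_cong refl iffI)
    fix x :: "nat \<Rightarrow> 'a"
    assume *: "(\<forall>k<i + Suc d. k \<noteq> i \<longrightarrow> x k \<in> U) \<and> x i \<in> Z \<and> x (i + Suc d) \<in> Z"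
    show "\<forall>k<Suc (i + Suc d). x k \<in> ?F k"
    proof (intro allI impI)
      fix k assume "k < Suc (i + Suc d)"
      then consider "k = i" | "k = i + Suc d" | "k < i + Suc d" "k \<noteq> i" "k \<noteq> i + Suc d" by linarith
      then show "x k \<in> ?F k" by cases (use * in simp_all)
    qed
  next
    fix x :: "nat \<Rightarrow> 'a"
    assume *: "\<forall>k<Suc (i + Suc d). x k \<in> ?F k"
    have "x k \<in> U" if "k < i + Suc d" "k \<noteq> i" for k using *[rule_format, of k] that by simp
    moreover have "x i \<in> Z" "x (i + Suc d) \<in> Z" using *[rule_format, of i] *[rule_format, of "i + Suc d"] by simp_all
    ultimately show "(\<forall>k<i + Suc d. k \<noteq> i \<longrightarrow> x k \<in> U) \<and> x i \<in> Z \<and> x (i + Suc d) \<in> Z" by blast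
  qed
  have "(\<Prod>k<i + Suc d. measure \<mu> (?F k)) = (\<Prod>k<i + Suc d. if k = i then measure \<mu> Z else measure \<mu> U)"
    by (rule prod.cong) auto
  also have "\<dots> = measure \<mu> U ^ (i + d) * measure \<mu> Z" by (induction d) simp_all
  finally have "(\<Prod>k<Suc (i + Suc d). measure \<mu> (?F k)) = measure \<mu> U ^ d * (measure \<mu> U ^ i * measure \<mu> Z * measure \<mu> Z)"
    by (simp add: power_add)
  moreover have "measure W {x \<in> space W. \<forall>k<Suc (i + Suc d). x k \<in> ?F k} = (\<Prod>k<Suc (i + Suc d). measure \<mu> (?F k))"
    by (rule measure_letters) (use U Z in auto)
  ultimately have m: "measure W A = measure \<mu> U ^ d * (measure \<mu> U ^ i * measure \<mu> Z * measure \<mu> Z)" unfolding eq by (simp only:)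
  have "A \<in> sets W" unfolding eq by (rule letters_event) (use U Z in auto)
  from this eq_refl[OF m] show ?thesis by (rule conjI)
qed

lemma two_visits:
  assumes U: "U \<subseteq> carrier G" "measure \<mu> U < 1" and Z: "Z \<subseteq> carrier G"
  shows "measure W (\<Union>i. \<Union>d. {x \<in> space W. (\<forall>k<i + Suc d. k \<noteq> i \<longrightarrow> x k \<in> U) \<and> x i \<in> Z \<and> x (i + Suc d) \<in> Z})
    \<le> (measure \<mu> Z / (1 - measure \<mu> U))\<^sup>2"
proof -
  let ?A = "\<lambda>i d. {x \<in> space W. (\<forall>k<i + Suc d. k \<noteq> i \<longrightarrow> x k \<in> U) \<and> x i \<in> Z \<and> x (i + Suc d) \<in> Z}"
  let ?u = "measure \<mu> U" and ?z = "measure \<mu> Z"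
  note A = two_visits_at[OF U(1) Z]
  have inner: "measure W (\<Union>d. ?A i d) \<le> ?u ^ i * (?z * ?z / (1 - ?u))" for i
  proof -
    have "measure W (\<Union>d. ?A i d) \<le> (?u ^ i * ?z * ?z) / (1 - ?u)"
      by (rule union_bound[OF conjunct1[OF A] conjunct2[OF A]]) (use U in simp_all)
    then show ?thesis by (simp add: mult.assoc)
  qed
  have "measure W (\<Union>i. \<Union>d. ?A i d) \<le> (?z * ?z / (1 - ?u)) / (1 - ?u)"
  proof (rule union_bound[OF _ inner])
    have "range (?A i) \<subseteq> sets W" for i by (rule image_subsetI) (rule conjunct1[OF A])
    then show "(\<Union>d. ?A i d) \<in> sets W" for i by (rule sets.countable_nat_UN)
  qed (use U in simp_all)
  then show ?thesis by (simp add: power2_eq_square)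
qed

end


context icc_construction begin

definition level_set :: "nat \<Rightarrow> 'a set" where "level_set n = {x \<in> carrier G. lev x = n}"

lemma spikes_level_set: "spikes n \<subseteq> level_set n"
  using lev_spikes spikes_closed by (auto simp: level_set_def)

lemma finite_spikes: "finite (spikes n)" and spikes_nonempty: "spikes n \<noteq> {}"
  by (simp_all add: spikes_def)

lemma finite_level_set: "finite (level_set n)" and card_level_set: "card (level_set n) \<le> 4"
proof -
  let ?S = "{switching (core n), inv (switching (core n)), enum n, inv (enum n)}"
  have sub: "level_set n \<subseteq> ?S" using lev_mem by (auto simp: level_set_def spikes_def)
  then show "finite (level_set n)" using finite_subset by blast
  have "card (level_set n) \<le> card ?S" by (rule card_mono[OF _ sub]) simp
  also have "\<dots> \<le> 4" by (intro order.trans[OF card_insert_le_m1]) (auto intro: order.trans[OF card_insert_le_m1])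
  finally show "card (level_set n) \<le> 4" .
qed

lemma level_set_nonempty: "level_set n \<noteq> {}"
  using spikes_level_set spikes_nonempty by blast

lemma level_set_inv: "x \<in> carrier G \<Longrightarrow> inv x \<in> level_set n \<longleftrightarrow> x \<in> level_set n"
  using lev_inv by (auto simp: level_set_def)

lemma spikes_inv_iff: "x \<in> carrier G \<Longrightarrow> inv x \<in> spikes n \<longleftrightarrow> x \<in> spikes n"
  using spikes_inv[of x n] spikes_inv[of "inv x" n] by auto

text \<open>
  A rare uniform choice from the whole level makes the walk non-degenerate; it is rare enough that only
  finitely many records are affected.
\<close>

definition letter_law :: "nat \<Rightarrow> 'a pmf" where
  "letter_law n = bind_pmf (bernoulli_pmf (1 / (real n + 2))) (\<lambda>b. pmf_of_set (if b then level_set n else spikes n))"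

definition step_law :: "'a pmf" where
  "step_law = bind_pmf level_pmf letter_law"

lemma pmf_letter:
  "pmf (letter_law n) x = 1 / (real n + 2) * (indicator (level_set n) x / card (level_set n)) +
    (1 - 1 / (real n + 2)) * (indicator (spikes n) x / card (spikes n))"
  unfolding letter_law_def pmf_bind
  by (simp add: pmf_of_set finite_spikes spikes_nonempty finite_level_set level_set_nonempty mult.commute)

lemma set_letter_law: "set_pmf (letter_law n) = level_set n"
proof (intro equalityI subsetI)
  fix x assume "x \<in> set_pmf (letter_law n)"
  then show "x \<in> level_set n"
    unfolding letter_law_def using spikes_level_set
    by (auto simp: finite_spikes spikes_nonempty finite_level_set level_set_nonempty split: if_splits)
next
  fix x assume "x \<in> level_set n"
  then have "0 < 1 / (real n + 2) * (indicator (level_set n) x / card (level_set n))"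
    using finite_level_set level_set_nonempty by (simp add: card_gt_0_iff)
  moreover have "0 \<le> (1 - 1 / (real n + 2)) * (indicator (spikes n) x / card (spikes n))" by (intro mult_nonneg_nonneg) auto
  ultimately have "0 < pmf (letter_law n) x" unfolding pmf_letter by linarith
  then show "x \<in> set_pmf (letter_law n)" by (simp add: set_pmf_iff)
qed

lemma pmf_step: "x \<in> carrier G \<Longrightarrow> pmf step_law x = pmf level_pmf (lev x) * pmf (letter_law (lev x)) x"
  unfolding step_law_def pmf_bind
  by (subst integral_measure_pmf_real[of "{lev x}"])
    (auto simp: pmf_eq_0_set_pmf set_letter_law level_set_def mult.commute)

lemma set_step_law: "set_pmf step_law = carrier G"
  unfolding step_law_def by (auto simp: set_letter_law level_set_def set_pmf_iff pmf_level)

lemma map_lev: "map_pmf lev step_law = level_pmf"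
proof -
  have "map_pmf lev (letter_law n) = return_pmf n" for n
  proof -
    have "map_pmf lev (letter_law n) = map_pmf (\<lambda>_. n) (letter_law n)"
      by (rule map_pmf_cong) (auto simp: set_letter_law level_set_def)
    then show ?thesis by simp
  qed
  then show ?thesis unfolding step_law_def map_bind_pmf by (simp add: bind_return_pmf')
qed

lemma measure_lev: "measure step_law {x \<in> carrier G. lev x \<in> B} = measure level_pmf B"
proof -
  have "measure level_pmf B = measure step_law (lev -` B)" unfolding map_lev[symmetric] by simp
  also have "\<dots> = measure step_law {x \<in> carrier G. lev x \<in> B}"
    by (rule measure_prob_cong_0) (auto simp: set_step_law[symmetric] set_pmf_iff)
  finally show ?thesis ..
qed

lemma measure_odd_letters: "measure step_law (level_set n - spikes n) \<le> pmf level_pmf n / (real n + 2)"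
proof -
  have "measure step_law (level_set n - spikes n) = (\<Sum>x\<in>level_set n - spikes n. pmf step_law x)"
    using finite_level_set by (simp add: measure_measure_pmf_finite)
  also have "\<dots> = (\<Sum>x\<in>level_set n - spikes n. pmf level_pmf n / (real n + 2) * (1 / card (level_set n)))"
    by (intro sum.cong refl) (auto simp: pmf_step pmf_letter level_set_def)
  also have "\<dots> \<le> (\<Sum>x\<in>level_set n. pmf level_pmf n / (real n + 2) * (1 / card (level_set n)))"
    by (rule sum_mono2) (auto simp: finite_level_set)
  also have "\<dots> = pmf level_pmf n / (real n + 2)"
    using finite_level_set[of n] level_set_nonempty[of n] by simp
  finally show ?thesis .
qed

lemma step_law_on_group: "pmf_on_group G step_law"
  by (simp add: pmf_on_group_def set_step_law)

lemma step_law_nondegenerate: "nondegenerate G step_law"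
proof -
  have "x \<in> carrier G" if "x \<in> semigroup_span G (carrier G)" for x
    using that by (induction rule: semigroup_span.induct) auto
  then show ?thesis unfolding nondegenerate_def set_step_law by (auto intro: semigroup_span.base)
qed

lemma step_law_symmetric: "symmetric_pmf G step_law"
  unfolding symmetric_pmf_def
  by (auto simp: pmf_step lev_inv pmf_letter level_set_inv spikes_inv_iff indicator_def)

text \<open>
  Any exponent between one half and one would do: the masses of the levels are of order \<open>n\<^sup>-\<^sup>2\<close>, and their
  powers have to be summable.
\<close>

lemma neg_mult_ln_le:
  assumes "0 < t"
  shows "- (t * ln t) \<le> 4 * t powr (3 / 4 :: real)"
proof -
  have "ln (t powr (- 1 / 4)) \<le> t powr (- 1 / 4) - 1" using assms by (intro ln_le_minus_one) simp
  then have "- ln t \<le> 4 * t powr (- 1 / 4)" using assms by (simp add: ln_powr)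
  then have "t * - ln t \<le> t * (4 * t powr (- 1 / 4))" using assms by (intro mult_left_mono) auto
  also have "t * (4 * t powr (- 1 / 4)) = 4 * (t powr 1 * t powr (- 1 / 4))" using assms by simp
  also have "\<dots> = 4 * t powr (3 / 4)" unfolding powr_add[symmetric] by simp
  finally show ?thesis by simp
qed

lemma step_law_finite_entropy: "finite_entropy G step_law"
  unfolding finite_entropy_def
proof (rule nonneg_bdd_above_summable_on)
  let ?f = "\<lambda>g. - (pmf step_law g * ln (pmf step_law g))"
  have nonneg: "0 \<le> ?f g" for g
  proof (cases "pmf step_law g = 0")
    case False
    then have "0 < pmf step_law g" by (simp add: pmf_nonneg le_less)
    then have "ln (pmf step_law g) \<le> 0" by (simp add: pmf_le_1)
    then show ?thesis using mult_nonneg_nonpos[OF pmf_nonneg, of "ln (pmf step_law g)" step_law g] by simp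
  qed simp
  then show "0 \<le> ?f g" for g .
  have bound: "?f g \<le> 4 * (real n + 1) powr (- 3 / 2)" if g: "g \<in> level_set n" for g n
  proof -
    have pos: "0 < pmf step_law g" using g set_step_law by (auto simp: level_set_def pmf_positive)
    have "pmf step_law g = pmf level_pmf n * pmf (letter_law n) g" using g pmf_step by (auto simp: level_set_def)
    also have "\<dots> \<le> pmf level_pmf n * 1" by (intro mult_left_mono pmf_le_1) simp
    also have "\<dots> \<le> 1 / (real n + 1)\<^sup>2" unfolding pmf_level by (simp add: power2_eq_square frac_le)
    also have "\<dots> = (real n + 1) powr (- 2)" by (simp add: powr_minus_divide powr_numeral)
    finally have le: "pmf step_law g \<le> (real n + 1) powr (- 2)" .
    have "?f g \<le> 4 * pmf step_law g powr (3 / 4)" by (rule neg_mult_ln_le[OF pos])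
    also have "\<dots> \<le> 4 * ((real n + 1) powr (- 2)) powr (3 / 4)" using le pos by (intro mult_left_mono powr_mono2) auto
    also have "\<dots> = 4 * (real n + 1) powr (- 3 / 2)" by (simp add: powr_powr)
    finally show ?thesis .
  qed
  have "summable (\<lambda>n. real n powr (- 3 / 2))" by (simp add: summable_real_powr_iff)
  then have "summable (\<lambda>n. real (Suc n) powr (- 3 / 2))" by (subst summable_Suc_iff)
  then have sm: "summable (\<lambda>n. 16 * (real n + 1) powr (- 3 / 2))" by (intro summable_mult) (simp add: add.commute)
  show "bdd_above (sum ?f ` {F. F \<subseteq> carrier G \<and> finite F})"
  proof (rule bdd_aboveI2)
    fix F assume "F \<in> {F. F \<subseteq> carrier G \<and> finite F}"
    then have F: "F \<subseteq> carrier G" "finite F" by auto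
    define m where "m = Suc (Max (insert 0 (lev ` F)))"
    have "F \<subseteq> (\<Union>n<m. level_set n)"
    proof
      fix g assume "g \<in> F"
      then have "lev g \<le> Max (insert 0 (lev ` F))" using F by (intro Max_ge) auto
      then have "lev g < m" unfolding m_def by (rule le_imp_less_Suc)
      then show "g \<in> (\<Union>n<m. level_set n)" using F \<open>g \<in> F\<close> by (auto simp: level_set_def)
    qed
    then have "sum ?f F \<le> sum ?f (\<Union>n<m. level_set n)"
      by (intro sum_mono2) (use finite_level_set nonneg in auto)
    also have "\<dots> = (\<Sum>n<m. sum ?f (level_set n))"
      by (rule sum.UNION_disjoint) (use finite_level_set in \<open>auto simp: level_set_def\<close>)
    also have "\<dots> \<le> (\<Sum>n<m. 16 * (real n + 1) powr (- 3 / 2))"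
    proof (rule sum_mono)
      fix n
      have "sum ?f (level_set n) \<le> real (card (level_set n)) * (4 * (real n + 1) powr (- 3 / 2))"
        by (rule sum_bounded_above) (rule bound)
      also have "\<dots> \<le> 4 * (4 * (real n + 1) powr (- 3 / 2))"
        using card_level_set[of n] by (intro mult_right_mono) auto
      finally show "sum ?f (level_set n) \<le> 16 * (real n + 1) powr (- 3 / 2)" by simp
    qed
    also have "\<dots> \<le> (\<Sum>n. 16 * (real n + 1) powr (- 3 / 2))"
      by (rule sum_le_suminf[OF sm]) auto
    finally show "sum ?f F \<le> (\<Sum>n. 16 * (real n + 1) powr (- 3 / 2))" .
  qed
qed

end

sublocale icc_construction \<subseteq> random_walk G step_law
  by unfold_locales (rule countable_G, rule step_law_on_group)

context icc_construction begin

abbreviation "below n \<equiv> {x \<in> carrier G. lev x \<in> {..<n}}"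

lemma measure_below: "1 - measure step_law (below n) = 1 / (real n + 1)" "measure step_law (below n) < 1"
  unfolding measure_lev measure_level_less by auto

lemma summable_bounds: "summable (\<lambda>n. 1 / (real n + 2)\<^sup>2)"
proof -
  have "summable (\<lambda>n. inverse (real (n + 2) ^ 2))"
    using inverse_power_summable[of 2, where ?'a = real] by (subst summable_iff_shift) auto
  then show ?thesis by (simp add: inverse_eq_divide add.commute)
qed

lemma eventually_avoided:
  assumes "\<And>n. A n \<in> sets W" "\<And>n. measure W (A n) \<le> 1 / (real n + 2)\<^sup>2"
  shows "AE x in W. \<forall>\<^sub>F n in sequentially. x \<notin> A n"
proof -
  interpret prob_space W by (rule prob_space_W)
  have "summable (\<lambda>n. measure W (A n))"
    by (rule summable_comparison_test'[OF summable_bounds, of 0]) (use assms(2) in simp)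
  then have "AE x in W. \<forall>\<^sub>F n in sequentially. x \<in> space W - A n"
    using assms(1) by (intro borel_cantelli_AE1) (auto simp: less_top[symmetric])
  then show ?thesis by eventually_elim (auto elim: eventually_mono)
qed

text \<open>
  The four ways in which a level can fail to be tame all have probability at most \<open>1 / (n + 2)\<^sup>2\<close>, so the
  Borel-Cantelli lemma applies.
\<close>

lemma AE_tame: "AE x in W. \<exists>N. tame N x"
proof -
  define late where "late n = {x \<in> space W. \<forall>i<horizon n. x i \<in> below (Suc n)}" for n
  define odd where "odd n = (\<Union>i::nat. {x \<in> space W. (\<forall>j<i. x j \<in> below n) \<and> x i \<in> level_set n - spikes n})" for n
  define tie where "tie n = (\<Union>i. \<Union>d. {x \<in> space W. (\<forall>k<i + Suc d. k \<noteq> i \<longrightarrow> x k \<in> below n) \<and>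
    x i \<in> level_set n \<and> x (i + Suc d) \<in> level_set n})" for n
  define jump where "jump n = (\<Union>i::nat. {x \<in> space W. (\<forall>j<i. x j \<in> below (Suc n)) \<and> x i \<in> {x \<in> carrier G. lev x \<in> {growth n..}}})" for n
  have ls: "level_set n = {x \<in> carrier G. lev x \<in> {n}}" for n by (auto simp: level_set_def)
  have lsc: "level_set n \<subseteq> carrier G" for n by (auto simp: level_set_def)
  have ev1: "{x \<in> space W. (\<forall>j<i. x j \<in> U) \<and> x i \<in> Z} \<in> sets W" if "U \<subseteq> carrier G" "Z \<subseteq> carrier G" for i U Z
    using sets.Int[OF letters_event[of i "\<lambda>_. U"] letter_event[of Z i]] that
    by (simp add: Int_def conj_ac)
  have ev_late: "late n \<in> sets W" for n unfolding late_def by (rule letters_event) auto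
  have ev_odd: "odd n \<in> sets W" for n
    unfolding odd_def by (rule sets.countable_nat_UN, rule image_subsetI, rule ev1) (use lsc in auto)
  have ev_jump: "jump n \<in> sets W" for n
    unfolding jump_def by (rule sets.countable_nat_UN, rule image_subsetI, rule ev1) auto
  have ev_tie: "tie n \<in> sets W" for n
    unfolding tie_def
  proof (rule sets.countable_nat_UN, rule image_subsetI, rule sets.countable_nat_UN, rule image_subsetI)
    show "{x \<in> space W. (\<forall>k<i + Suc d. k \<noteq> i \<longrightarrow> x k \<in> below n) \<and> x i \<in> level_set n \<and>
        x (i + Suc d) \<in> level_set n} \<in> sets W" for i d
      by (rule conjunct1[OF two_visits_at]) (use lsc in auto)
  qed
  have late: "measure W (late n) \<le> 1 / (real n + 2)\<^sup>2" for n
  proof -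
    have "measure W (late n) = (\<Prod>i<horizon n. measure step_law (below (Suc n)))"
      unfolding late_def by (rule measure_letters) auto
    also have "\<dots> = (real (n + 1) / real (n + 2)) ^ horizon n"
      unfolding measure_lev measure_level_less by (simp add: field_simps)
    finally show ?thesis using horizon[of n] by simp
  qed
  have odd: "measure W (odd n) \<le> 1 / (real n + 2)\<^sup>2" for n
  proof -
    have "measure W (odd n) \<le> measure step_law (level_set n - spikes n) / (1 - measure step_law (below n))"
      unfolding odd_def by (rule first_visit) (use lsc measure_below in auto)
    also have "\<dots> \<le> (pmf level_pmf n / (real n + 2)) / (1 / (real n + 1))"
      unfolding measure_below by (intro divide_right_mono measure_odd_letters) simp
    also have "\<dots> = 1 / (real n + 2)\<^sup>2" by (simp add: pmf_level power2_eq_square)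
    finally show ?thesis .
  qed
  have tie: "measure W (tie n) \<le> 1 / (real n + 2)\<^sup>2" for n
  proof -
    have "measure W (tie n) \<le> (measure step_law (level_set n) / (1 - measure step_law (below n)))\<^sup>2"
      unfolding tie_def by (rule two_visits) (use lsc measure_below in auto)
    also have "\<dots> = 1 / (real n + 2)\<^sup>2"
      unfolding measure_below unfolding ls measure_lev by (simp add: measure_pmf_single pmf_level power_divide)
    finally show ?thesis .
  qed
  have jump: "measure W (jump n) \<le> 1 / (real n + 2)\<^sup>2" for n
  proof -
    have "measure W (jump n) \<le> measure step_law {x \<in> carrier G. lev x \<in> {growth n..}} / (1 - measure step_law (below (Suc n)))"
      unfolding jump_def by (rule first_visit) (use measure_below in auto)
    also have "\<dots> = (real n + 2) / ((real n + 2) ^ 3 + 1)"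
      unfolding measure_below unfolding measure_lev measure_level_ge growth_def by (simp add: add.commute)
    also have "\<dots> \<le> (real n + 2) / (real n + 2) ^ 3"
    proof -
      have "0 < (real n + 2) ^ 3" by (rule zero_less_power) simp
      then show ?thesis by (intro divide_left_mono mult_pos_pos add_pos_pos) simp_all
    qed
    also have "\<dots> = 1 / (real n + 2)\<^sup>2" by (simp add: power2_eq_square power3_eq_cube)
    finally show ?thesis .
  qed
  show ?thesis
    using eventually_avoided[of late, OF ev_late late] eventually_avoided[of odd, OF ev_odd odd]
      eventually_avoided[of tie, OF ev_tie tie] eventually_avoided[of jump, OF ev_jump jump] AE_space[of W]
  proof eventually_elim
    case (elim x)
    have xs: "x i \<in> carrier G" for i using elim(5) by (simp add: space_W)
    have "\<forall>\<^sub>F n in sequentially. x \<notin> late n \<and> x \<notin> odd n \<and> x \<notin> tie n \<and> x \<notin> jump n"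
      using elim(1-4) by (intro eventually_conj)
    then obtain N where N: "\<And>n. n \<ge> N \<Longrightarrow> x \<notin> late n \<and> x \<notin> odd n \<and> x \<notin> tie n \<and> x \<notin> jump n"
      by (auto simp: eventually_sequentially)
    have "tame N x"
      unfolding tame_def
    proof (intro allI impI conjI)
      fix n assume n: "n \<ge> N"
      note N = N[OF n]
      have x: "x \<in> space W" by (rule elim(5))
      show "\<exists>i<horizon n. n < lev (x i)"
      proof (rule ccontr)
        assume "\<not> (\<exists>i<horizon n. n < lev (x i))"
        then have "\<forall>i<horizon n. x i \<in> below (Suc n)" using xs by (auto simp: less_Suc_eq_le)
        then have "x \<in> late n" using x by (simp add: late_def)
        then show False using N by simp
      qed
      show "x i \<in> spikes n" if "\<forall>j<i. lev (x j) < n" "lev (x i) = n" for i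
      proof (rule ccontr)
        assume "x i \<notin> spikes n"
        then have "(\<forall>j<i. x j \<in> below n) \<and> x i \<in> level_set n - spikes n" using that xs by (simp add: level_set_def)
        then have "x \<in> odd n" using x unfolding odd_def by blast
        then show False using N by simp
      qed
      show "lev (x j) \<noteq> n" if "i < j" "\<forall>k<j. k \<noteq> i \<longrightarrow> lev (x k) < n" "lev (x i) = n" for i j
      proof
        assume j: "lev (x j) = n"
        obtain d where d: "j = i + Suc d" using less_imp_Suc_add[OF \<open>i < j\<close>] by auto
        have "(\<forall>k<i + Suc d. k \<noteq> i \<longrightarrow> x k \<in> below n) \<and> x i \<in> level_set n \<and> x (i + Suc d) \<in> level_set n"
          using that j xs unfolding d by (simp add: level_set_def)
        then have "x \<in> tie n" using x unfolding tie_def by blast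
        then show False using N by simp
      qed
      show "lev (x i) \<le> growth n" if "\<forall>j<i. lev (x j) \<le> n" for i
      proof (rule ccontr)
        assume "\<not> lev (x i) \<le> growth n"
        then have "(\<forall>j<i. x j \<in> below (Suc n)) \<and> x i \<in> {x \<in> carrier G. lev x \<in> {growth n..}}"
          using that xs by (simp add: less_Suc_eq_le)
        then have "x \<in> jump n" using x unfolding jump_def by blast
        then show False using N by simp
      qed
    qed
    then show "\<exists>N. tame N x" ..
  qed
qed

lemma tame_path_event: "{y \<in> space PS. tame_path y} \<in> sets PS"
proof -
  have "(\<lambda>y. inv (y i)) \<in> PS \<rightarrow>\<^sub>M count_space (carrier G)" for i
    by (rule measurable_compose[OF measurable_position]) auto
  then have m: "(\<lambda>y. steps_of y i) \<in> PS \<rightarrow>\<^sub>M count_space (carrier G)" for i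
    unfolding steps_of_def by (intro measurable_mult measurable_position)
  have atom: "{y \<in> space PS. R (steps_of y i)} \<in> sets PS" for R i
  proof -
    have "{y \<in> space PS. R (steps_of y i)} = (\<lambda>y. steps_of y i) -` {a \<in> carrier G. R a} \<inter> space PS"
      using measurable_space[OF m[of i]] by auto
    also have "\<dots> \<in> sets PS" by (rule measurable_sets[OF m]) auto
    finally show ?thesis .
  qed
  show ?thesis
    unfolding tame_path_def tame_def
    by (intro sets.sets_Collect_countable_Ex sets.sets_Collect_countable_All sets.sets_Collect_imp sets.sets_Collect_conj
        sets.sets_Collect_const atom)
qed

lemma almost_all_tame: "almost_all_paths G step_law tame_path"
proof (rule almost_all_pathsI[OF tame_path_event])
  fix g assume g: "g \<in> carrier G"
  show "AE x in W. tame_path (walk G g x)"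
    using AE_tame AE_space[of W]
  proof eventually_elim
    case (elim x)
    then show ?case using steps_of_walk[OF g, of x] by (simp add: tame_path_def space_W)
  qed
qed

lemma walk_on_forest: "walk_on_forest G step_law C rk"
proof (unfold_locales)
  show "almost_all_paths G step_law (\<lambda>y. infinite (stem y))"
    using almost_all_tame by (rule almost_all_paths_mono) (rule tame_path_stem, simp_all add: space_PS)
  show "almost_all_paths G step_law (\<lambda>y. finite (stem y - range y))"
    using almost_all_tame by (rule almost_all_paths_mono) (rule tame_path_stem, simp_all add: space_PS)
  show "almost_all_paths G step_law (\<lambda>y. infinite {w \<in> stem y. g \<otimes> w \<in> stem (path_translate G g y)})"
    if "g \<in> carrier G" for g
    using almost_all_tame by (rule almost_all_paths_mono) (rule tame_path_stem, simp_all add: space_PS that)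
  show "almost_all_paths G step_law (\<lambda>y. stem (path_translate G g y) \<noteq> stem y)"
    if "g \<in> carrier G" "g \<noteq> \<one>" for g
    using almost_all_tame by (rule almost_all_paths_mono) (rule tame_path_stem, simp_all add: space_PS that)
qed

end

theorem theoremA:
  fixes G :: "('a, 'b) monoid_scheme"
  assumes "group G"
    and "countable (carrier G)"
    and "icc_group G"
  shows "\<exists>(\<mu> :: 'a pmf) (E :: ('a \<times> 'a) set).
    pmf_on_group G \<mu> \<and> symmetric_pmf G \<mu> \<and> nondegenerate G \<mu> \<and> finite_entropy G \<mu> \<and>
    forest (carrier G) E \<and> locally_finite_graph (carrier G) E \<and>
    almost_all_paths G \<mu> (\<lambda>y. \<exists>\<xi>. converges_to (carrier G) E y \<xi>) \<and>
    almost_all_paths G \<mu> (\<lambda>y. \<forall>\<xi>. converges_to (carrier G) E y \<xi> \<longrightarrow>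
      (\<forall>r \<in> \<xi>. finite (range r - range y))) \<and>
    (\<exists>bnd act. poisson_boundary G \<mu> bnd act) \<and>
    (\<forall>bnd act. poisson_boundary G \<mu> bnd act \<longrightarrow>
      (\<exists>\<pi>. limit_quotient_map G \<mu> E bnd \<pi> \<and>
         isomorphism_mod_0 (carrier G) (harmonic_measure G \<mu> bnd)
           (hitting_distribution G \<mu> E) \<pi>) \<and>
      free_mod_0 G \<mu> bnd act)"
proof -
  interpret icc_construction G
    by (intro icc_construction.intro icc_construction_axioms.intro assms)
  interpret F: walk_on_forest G step_law C rk by (rule walk_on_forest)
  show ?thesis
  proof (intro exI[of _ step_law] exI[of _ E] conjI allI impI)
    fix bnd act assume pb: "poisson_boundary G step_law bnd act"
    then have "exit_quotient_map G step_law bnd" by (simp add: poisson_boundary_def)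
    then show "\<exists>\<pi>. limit_quotient_map G step_law E bnd \<pi> \<and>
         isomorphism_mod_0 (carrier G) (harmonic_measure G step_law bnd) (hitting_distribution G step_law E) \<pi>"
      by (rule F.boundary_isomorphism)
    show "free_mod_0 G step_law bnd act" by (rule F.action_free[OF pb])
  qed (rule step_law_on_group step_law_symmetric step_law_nondegenerate step_law_finite_entropy
      forest_E locally_finite_E F.paths_converge F.paths_visit_rays F.poisson_boundary_exists)+
qed

end
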